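(* The class of $(\overline{2P_1+P_2},\,P_2+P_3)$-free graphs has bounded clique-width.
   Context: All graphs are finite, simple and undirected. For graphs $H_1,\dots,H_p$, a graph $G$ is $(H_1,\dots,H_p)$-free if no induced subgraph of $G$ is isomorphic to any $H_i$. $P_r$ denotes the path on $r$ vertices; $G+H$ is the disjoint union of $G$ and $H$, and $rG$ is the disjoint union of $r$ copies of $G$; $\overline{G}$ is the complement of $G$. Thus $\overline{2P_1+P_2}$ is the diamond ($K_4$ minus an edge). The clique-width of a graph $G$ is the minimum number of labels needed to construct $G$ using the operations: (1) create a single vertex with label $i$; (2) take the disjoint union of two labelled graphs; (3) add all edges between vertices with label $i$ and vertices with label $j$ ($i\ne j$); (4) rename label $i$ to $j$. A class of graphs has bounded clique-width if there is a constant $c$ such that every graph in the class has clique-width at most $c$. *)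

theory Defs
  imports Main
begin

record 'a ugraph =
  verts :: "'a set"
  edges :: "'a set set"

definition simple_graph :: "'a ugraph \<Rightarrow> bool" where
  "simple_graph G \<longleftrightarrow> finite (verts G) \<and> (\<forall>e\<in>edges G. e \<subseteq> verts G \<and> card e = 2)"

definition graph_iso :: "'a ugraph \<Rightarrow> 'b ugraph \<Rightarrow> bool" where
  "graph_iso G H \<longleftrightarrow>
     (\<exists>f. bij_betw f (verts G) (verts H) \<and>
          (\<forall>x\<in>verts G. \<forall>y\<in>verts G. {x, y} \<in> edges G \<longleftrightarrow> {f x, f y} \<in> edges H))"

definition induced :: "'a ugraph \<Rightarrow> 'a set \<Rightarrow> 'a ugraph" where
  "induced G S = \<lparr>verts = S, edges = {e \<in> edges G. e \<subseteq> S}\<rparr>"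

definition free_of :: "'b ugraph \<Rightarrow> 'a ugraph \<Rightarrow> bool" where
  "free_of H G \<longleftrightarrow> (\<forall>S \<subseteq> verts G. \<not> graph_iso (induced G S) H)"

definition path_graph :: "nat \<Rightarrow> nat ugraph" where
  "path_graph r = \<lparr>verts = {..<r}, edges = {{i, Suc i} | i. Suc i < r}\<rparr>"

definition disjoint_union :: "'a ugraph \<Rightarrow> 'b ugraph \<Rightarrow> ('a + 'b) ugraph" where
  "disjoint_union G H =
     \<lparr>verts = verts G <+> verts H,
      edges = (image Inl) ` edges G \<union> (image Inr) ` edges H\<rparr>"

definition copies :: "nat \<Rightarrow> 'a ugraph \<Rightarrow> (nat \<times> 'a) ugraph" where
  "copies r G =
     \<lparr>verts = {..<r} \<times> verts G,
      edges = {{i} \<times> e | i e. i < r \<and> e \<in> edges G}\<rparr>"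

definition complement_graph :: "'a ugraph \<Rightarrow> 'a ugraph" where
  "complement_graph G =
     \<lparr>verts = verts G,
      edges = {{u, v} | u v. u \<in> verts G \<and> v \<in> verts G \<and> u \<noteq> v \<and> {u, v} \<notin> edges G}\<rparr>"

(* cw_constructible k G l: the graph G, with vertex v labelled l v, can be built from the four
   clique-width operations using only the labels 1, ..., k. The values of l outside verts G
   play no role. *)
inductive cw_constructible :: "nat \<Rightarrow> 'a ugraph \<Rightarrow> ('a \<Rightarrow> nat) \<Rightarrow> bool" for k :: nat where
  create: "i \<in> {1..k} \<Longrightarrow> cw_constructible k \<lparr>verts = {v}, edges = {}\<rparr> (\<lambda>_. i)"
| union: "\<lbrakk>cw_constructible k G l; cw_constructible k H m; verts G \<inter> verts H = {}\<rbrakk> \<Longrightarrow>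
    cw_constructible k \<lparr>verts = verts G \<union> verts H, edges = edges G \<union> edges H\<rparr>
      (\<lambda>v. if v \<in> verts G then l v else m v)"
| join: "\<lbrakk>cw_constructible k G l; i \<in> {1..k}; j \<in> {1..k}; i \<noteq> j\<rbrakk> \<Longrightarrow>
    cw_constructible k
      \<lparr>verts = verts G,
       edges = edges G \<union> {{u, v} | u v. u \<in> verts G \<and> v \<in> verts G \<and> l u = i \<and> l v = j}\<rparr> l"
| rename: "\<lbrakk>cw_constructible k G l; i \<in> {1..k}; j \<in> {1..k}\<rbrakk> \<Longrightarrow>
    cw_constructible k G (\<lambda>v. if l v = i then j else l v)"

(* The operations never produce the graph without vertices; by convention it gets the value 0.
   Every other finite simple graph is constructible with some number of labels (one per vertex),
   so the minimum below exists; see simple_graph_cw_constructible. *)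
definition clique_width :: "'a ugraph \<Rightarrow> nat" where
  "clique_width G =
     (if verts G = {} then 0 else (LEAST k. \<exists>l. cw_constructible k G l))"

(* Every finite graph is isomorphic to one with vertices of type nat, so a class of finite graphs
   is represented in full as soon as the vertex type is infinite. *)
definition bounded_clique_width :: "'a ugraph set \<Rightarrow> bool" where
  "bounded_clique_width C \<longleftrightarrow> (\<exists>c. \<forall>G\<in>C. clique_width G \<le> c)"

lemma cw_join_vertex:
  assumes "finite N"
    and "cw_constructible k \<lparr>verts = V, edges = E\<rparr> l" "inj_on l V" "l ` V \<subseteq> {1..k}"
    and "v \<in> V" "N \<subseteq> V - {v}"
  shows "cw_constructible k \<lparr>verts = V, edges = E \<union> (\<lambda>u. {u, v}) ` N\<rparr> l"
  using assms
proof (induction N rule: finite_induct)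
  case empty
  then show ?case by simp
next
  case (insert x N)
  have x: "x \<in> V" "x \<noteq> v" using insert.prems by auto
  have c: "cw_constructible k \<lparr>verts = V, edges = E \<union> (\<lambda>u. {u, v}) ` N\<rparr> l"
    using insert by auto
  have "l x \<noteq> l v" using x insert.prems by (auto dest: inj_onD)
  with join[OF c, of "l x" "l v"] x insert.prems
  have j: "cw_constructible k \<lparr>verts = V, edges = (E \<union> (\<lambda>u. {u, v}) ` N) \<union>
     {{u, w} | u w. u \<in> V \<and> w \<in> V \<and> l u = l x \<and> l w = l v}\<rparr> l"
    by (auto simp: image_subset_iff)
  have s: "{{u, w} | u w. u \<in> V \<and> w \<in> V \<and> l u = l x \<and> l w = l v} = {{x, v}}"
    using x insert.prems(2,4) by (auto dest: inj_onD)
  show ?case using j unfolding s by (simp add: insert_commute Un_commute)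
qed

lemma simple_graph_cw_constructible:
  fixes G :: "'a ugraph"
  assumes "simple_graph G" "verts G \<noteq> {}"
  shows "\<exists>l. cw_constructible (card (verts G)) G l"
proof -
  have mono: "cw_constructible k' G l" if "cw_constructible k G l" "k \<le> k'"
    for k k' l and G :: "'a ugraph"
    using that by (induction rule: cw_constructible.induct) (auto intro: cw_constructible.intros)
  have "\<exists>l. cw_constructible (card V) \<lparr>verts = V, edges = E\<rparr> l \<and> inj_on l V \<and>
            l ` V \<subseteq> {1..card V}"
    if "finite V" "V \<noteq> {}" "\<forall>e\<in>E. e \<subseteq> V \<and> card e = 2" for V :: "'a set" and E
    using that
  proof (induction V arbitrary: E rule: finite_ne_induct)
    case (singleton x)
    have "E = {}"
    proof (rule ccontr)
      assume "E \<noteq> {}"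
      then obtain e where "e \<subseteq> {x}" "card e = 2" using singleton by blast
      then show False using card_mono[of "{x}" e] by simp
    qed
    then show ?case using create[of 1 1 x] by auto
  next
    case (insert x V)
    define F where "F = {e \<in> E. x \<notin> e}"
    define N where "N = {u. {u, x} \<in> E}"
    have N: "N \<subseteq> V" unfolding N_def using insert.prems by fastforce
    have E: "E = F \<union> (\<lambda>u. {u, x}) ` N"
    proof (rule set_eqI, rule iffI)
      fix e assume e: "e \<in> E"
      show "e \<in> F \<union> (\<lambda>u. {u, x}) ` N"
      proof (cases "x \<in> e")
        case True
        then obtain u where "e = {u, x}" using e insert.prems
          by (metis card_2_iff insert_commute insertE singletonD)
        then show ?thesis using e N_def by auto
      qed (use e F_def in auto)
    qed (auto simp: F_def N_def)
    have "\<forall>e\<in>F. e \<subseteq> V \<and> card e = 2" using insert.prems F_def by auto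
    from insert.IH[OF this] obtain l where
      l: "cw_constructible (card V) \<lparr>verts = V, edges = F\<rparr> l" "inj_on l V" "l ` V \<subseteq> {1..card V}"
      by blast
    let ?k = "card (insert x V)"
    let ?l = "\<lambda>v. if v \<in> V then l v else ?k"
    have k: "?k = Suc (card V)" using insert.hyps by simp
    have "cw_constructible ?k \<lparr>verts = V, edges = F\<rparr> l" using mono[OF l(1)] k by simp
    moreover have "cw_constructible ?k \<lparr>verts = {x}, edges = {}\<rparr> (\<lambda>_. ?k)"
      by (rule create) (simp add: k)
    ultimately have "cw_constructible ?k \<lparr>verts = insert x V, edges = F\<rparr> ?l"
      using union[of ?k "\<lparr>verts = V, edges = F\<rparr>" l "\<lparr>verts = {x}, edges = {}\<rparr>" "\<lambda>_. ?k"] insert.hyps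
      by simp
    moreover have "inj_on ?l (insert x V)"
    proof (rule inj_onI)
      fix a b assume "a \<in> insert x V" "b \<in> insert x V" "?l a = ?l b"
      moreover have "l u \<noteq> Suc (card V)" if "u \<in> V" for u using l(3) that by fastforce
      ultimately show "a = b" using l(2) k by (auto split: if_splits dest: inj_onD)
    qed
    moreover have "?l ` insert x V \<subseteq> {1..?k}" using l(3) k by fastforce
    moreover have "finite N" using N insert.hyps finite_subset by blast
    moreover have "N \<subseteq> insert x V - {x}" using N insert.hyps by auto
    ultimately show ?case
      using cw_join_vertex[of N ?k "insert x V" F ?l x] unfolding E by blast
  qed
  from this[of "verts G" "edges G"] assms show ?thesis
    by (cases G) (auto simp: simple_graph_def)
qed

end

theory Submission
  imports Defs "HOL-Library.Ramsey"
begin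

text \<open>
  Order the vertices so that the vertices of every prefix have at most \<open>k\<close> different nonempty
  neighbourhoods in the corresponding suffix. Adding the vertices in this order builds the graph with
  \<open>k + 2\<close> labels. The existence of such an order survives the deletion of boundedly many vertices and
  flipping the adjacency between boundedly many parts.

  If a maximum clique has at least five vertices, the rest of the graph is \<open>P\<^sub>3\<close>-free; if it has four,
  the rest has bounded degree, and a \<open>(P\<^sub>2 + P\<^sub>3)\<close>-free graph of bounded degree becomes edgeless or
  \<open>P\<^sub>3\<close>-free after the deletion of boundedly many vertices. Otherwise every edge lies in at most one
  triangle. If there is an induced \<open>C\<^sub>5\<close>, then up to boundedly many vertices the graph is a blow-up
  of it together with an independent set, and flipping consecutive parts leaves no path on four
  vertices. If there is no induced \<open>C\<^sub>5\<close> but a large biclique, the biclique extends to a bipartite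
  graph, with triangles attached to a set of twins. If there is no large biclique either, there are
  boundedly many vertices of large degree. Finally, in a bipartite \<open>(P\<^sub>2 + P\<^sub>3)\<close>-free graph the vertices on one
  side are ordered by degree: neighbourhoods of different sizes are nested, and neighbourhoods of the
  same size differ in at most one swap.
\<close>

subsection \<open>Orders of bounded width\<close>

text \<open>Most arguments look for an edge without neighbours on some induced
  \<open>P\<^sub>3\<close>. A maximum clique supplies one: an outside vertex has at most one
  neighbour in it, since two would force all. Three outside vertices thus leave two of five clique
  vertices untouched, which excludes \<open>P\<^sub>3\<close> outright; four clique vertices only
  serve two outside vertices, which bounds degrees instead. Below that size the clique is too small,
  and its role passes to a five-cycle, to a biclique, or to independent sets inside neighbourhoods
  that Ramsey's theorem provides. Flips multiply the width and deletions add to it, so only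
  boundedly many are affordable. What remains must have a width that does not depend on the number
  of pieces: cliques, stars and components of bounded size. The bipartite graph is the obstacle,
  since its degrees may take arbitrarily many values and no bounded number of flips breaks it up.
  There the order itself must do the work: degree layers follow each other, and what earlier layers
  contribute collapses to a single trace.\<close>

text \<open>Empty neighbourhoods are not counted, so that the width of a disjoint union is the maximum of the widths.\<close>

definition traces :: "('a \<Rightarrow> 'a \<Rightarrow> bool) \<Rightarrow> 'a set \<Rightarrow> 'a set \<Rightarrow> 'a set set" where
  "traces E A B = (\<lambda>v. {w \<in> B. E v w}) ` A - {{}}"

definition lw :: "('a \<Rightarrow> 'a \<Rightarrow> bool) \<Rightarrow> 'a set \<Rightarrow> nat \<Rightarrow> bool" where
  "lw E V k \<longleftrightarrow> (\<exists>xs. distinct xs \<and> set xs = V \<and>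
     (\<forall>ys zs. xs = ys @ zs \<longrightarrow> card (traces E (set ys) (set zs)) \<le> k))"

lemma finite_traces [simp]: "finite A \<Longrightarrow> finite (traces E A B)"
  by (simp add: traces_def)

lemma traces_empty [simp]: "traces E {} B = {}" "traces E A {} = {}"
  by (auto simp: traces_def)

lemma card_le_of_subset: "A \<subseteq> B \<Longrightarrow> card B \<le> k \<Longrightarrow> finite B \<Longrightarrow> card A \<le> k"
  by (meson card_mono le_trans)

lemma card_traces_le: "finite A \<Longrightarrow> card (traces E A B) \<le> card A"
  unfolding traces_def by (meson card_Diff1_le card_image_le finite_imageI le_trans)

lemma lw_mono:
  assumes "lw E V k" "k \<le> k'" shows "lw E V k'"
proof -
  from assms(1) obtain xs where xs: "distinct xs" "set xs = V"
    "\<And>ys zs. xs = ys @ zs \<Longrightarrow> card (traces E (set ys) (set zs)) \<le> k"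
    unfolding lw_def by blast
  have "card (traces E (set ys) (set zs)) \<le> k'" if "xs = ys @ zs" for ys zs
    using xs(3)[OF that] assms(2) by (rule le_trans)
  with xs show ?thesis unfolding lw_def by blast
qed

lemma lw_cong:
  assumes "lw E V k" "\<And>u v. u \<in> V \<Longrightarrow> v \<in> V \<Longrightarrow> u \<noteq> v \<Longrightarrow> E u v \<longleftrightarrow> F u v"
  shows "lw F V k"
proof -
  from assms(1) obtain xs where xs: "distinct xs" "set xs = V"
    "\<And>ys zs. xs = ys @ zs \<Longrightarrow> card (traces E (set ys) (set zs)) \<le> k"
    unfolding lw_def by blast
  have "traces F (set ys) (set zs) = traces E (set ys) (set zs)" if "xs = ys @ zs" for ys zs
  proof -
    have "(\<lambda>v. {w \<in> set zs. F v w}) ` set ys = (\<lambda>v. {w \<in> set zs. E v w}) ` set ys"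
    proof (rule image_cong[OF refl])
      fix v assume v: "v \<in> set ys"
      have "v \<noteq> w" if "w \<in> set zs" for w
        using xs(1) that v \<open>xs = ys @ zs\<close> by auto
      then show "{w \<in> set zs. F v w} = {w \<in> set zs. E v w}"
        using assms(2) xs(2) that v by auto
    qed
    then show ?thesis by (simp add: traces_def)
  qed
  with xs show ?thesis unfolding lw_def by (intro exI[of _ xs]) simp
qed

lemma lw_card:
  assumes "finite V" "card V \<le> k" shows "lw E V k"
proof -
  from assms(1) obtain xs where xs: "distinct xs" "set xs = V"
    using finite_distinct_list by blast
  have "card (traces E (set ys) (set zs)) \<le> k" if "xs = ys @ zs" for ys zs
  proof -
    have "card (set ys) \<le> card V" using xs that assms by (intro card_mono) auto
    then show ?thesis using card_traces_le[of "set ys" E "set zs"] assms by simp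
  qed
  with xs show ?thesis unfolding lw_def by blast
qed

lemma lw_empty [simp]: "lw E {} k"
  by (rule lw_card) auto

lemma lw_no_edges:
  assumes "finite V" "\<And>u v. u \<in> V \<Longrightarrow> v \<in> V \<Longrightarrow> u \<noteq> v \<Longrightarrow> \<not> E u v"
  shows "lw E V k"
proof -
  from assms(1) obtain xs where xs: "distinct xs" "set xs = V"
    using finite_distinct_list by blast
  have "traces (\<lambda>_ _. False) A B = {}" for A B :: "'a set" by (auto simp: traces_def)
  with xs have "lw (\<lambda>_ _. False) V k" unfolding lw_def by auto
  then show ?thesis by (rule lw_cong) (use assms in auto)
qed

lemma lw_clique:
  assumes "finite V" "\<And>u v. u \<in> V \<Longrightarrow> v \<in> V \<Longrightarrow> u \<noteq> v \<Longrightarrow> E u v"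
  shows "lw E V 1"
proof -
  from assms(1) obtain xs where xs: "distinct xs" "set xs = V"
    using finite_distinct_list by blast
  have "traces (\<lambda>_ _. True) A B \<subseteq> {B}" for A B :: "'a set" by (auto simp: traces_def)
  then have "card (traces (\<lambda>_ _. True) A B) \<le> 1" for A B :: "'a set"
    by (rule card_le_of_subset) auto
  with xs have "lw (\<lambda>_ _. True) V 1" unfolding lw_def by auto
  then show ?thesis by (rule lw_cong) (use assms in auto)
qed

lemma append_eq_append_cases:
  assumes "xs @ xs' = ys @ zs"
  obtains zs' where "xs = ys @ zs'" "zs = zs' @ xs'" | ys' where "ys = xs @ ys'" "xs' = ys' @ zs"
  using assms by (auto simp: append_eq_append_conv2)

lemma card_union_image_le:
  assumes "finite S" "finite T" "card S \<le> k" "card T \<le> m"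
  shows "card ((\<lambda>(s, t). s \<union> t) ` (S \<times> T)) \<le> k * m"
proof -
  have "card ((\<lambda>(s, t). s \<union> t) ` (S \<times> T)) \<le> card (S \<times> T)"
    using assms by (intro card_image_le) auto
  also have "\<dots> = card S * card T" by (simp add: card_cartesian_product)
  also have "\<dots> \<le> k * m" using assms by (intro mult_le_mono)
  finally show ?thesis .
qed

lemma card_insert_le': "card A \<le> k \<Longrightarrow> card (insert x A) \<le> k + 1"
  by (cases "finite A") (auto simp: card_insert_if)

text \<open>While the prefix stays inside \<open>A\<close>, a trace splits into a piece in the rest
  of \<open>A\<close> and a piece in \<open>B\<close>, each possibly empty; this gives the product.
  Once \<open>A\<close> is exhausted, its vertices contribute only restrictions of their
  \<open>m\<close> traces in \<open>B\<close>, in addition to the \<open>k2\<close> of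
  \<open>B\<close> itself.\<close>

lemma lw_append:
  assumes "lw E A k1" "lw E B k2" "A \<inter> B = {}" "card (traces E A B) \<le> m"
  shows "lw E (A \<union> B) ((k1 + 1) * (m + 1) + k2)"
proof -
  from assms(1) obtain xs where xs: "distinct xs" "set xs = A"
    "\<And>ys zs. xs = ys @ zs \<Longrightarrow> card (traces E (set ys) (set zs)) \<le> k1"
    unfolding lw_def by blast
  from assms(2) obtain xs' where xs': "distinct xs'" "set xs' = B"
    "\<And>ys zs. xs' = ys @ zs \<Longrightarrow> card (traces E (set ys) (set zs)) \<le> k2"
    unfolding lw_def by blast
  have fA: "finite A" using xs by auto
  have "card (traces E (set ys) (set zs)) \<le> (k1 + 1) * (m + 1) + k2" if "xs @ xs' = ys @ zs" for ys zs
    using that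
  proof (cases rule: append_eq_append_cases)
    case (1 zs')
    let ?S = "insert {} (traces E (set ys) (set zs'))" and ?T = "insert {} (traces E A B)"
    have sub: "traces E (set ys) (set zs) \<subseteq> (\<lambda>(s, t). s \<union> t) ` (?S \<times> ?T)"
    proof
      fix t assume "t \<in> traces E (set ys) (set zs)"
      then obtain v where v: "v \<in> set ys" "t = {w \<in> set zs. E v w}" by (auto simp: traces_def)
      have "t = {w \<in> set zs'. E v w} \<union> {w \<in> B. E v w}" using v 1 xs' by auto
      moreover have "{w \<in> set zs'. E v w} \<in> ?S" using v by (auto simp: traces_def)
      moreover have "{w \<in> B. E v w} \<in> ?T" using v 1 xs by (auto simp: traces_def)
      ultimately show "t \<in> (\<lambda>(s, t). s \<union> t) ` (?S \<times> ?T)" by (intro image_eqI[where x = "({w \<in> set zs'. E v w}, {w \<in> B. E v w})"]) auto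
    qed
    have "finite ?S" "finite ?T" using fA by auto
    then have "card ((\<lambda>(s, t). s \<union> t) ` (?S \<times> ?T)) \<le> (k1 + 1) * (m + 1)"
      using xs(3)[OF 1(1)] assms(4) by (intro card_union_image_le card_insert_le')
    then have "card (traces E (set ys) (set zs)) \<le> (k1 + 1) * (m + 1)"
      by (rule card_le_of_subset[OF sub]) (intro finite_imageI finite_cartesian_product \<open>finite ?S\<close> \<open>finite ?T\<close>)
    then show ?thesis by simp
  next
    case (2 ys')
    have "traces E (set ys) (set zs) \<subseteq> (\<lambda>t. t \<inter> set zs) ` traces E A B \<union> traces E (set ys') (set zs)"
    proof
      fix t assume "t \<in> traces E (set ys) (set zs)"
      then obtain v where v: "v \<in> set ys" "t = {w \<in> set zs. E v w}" "t \<noteq> {}" by (auto simp: traces_def)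
      show "t \<in> (\<lambda>t. t \<inter> set zs) ` traces E A B \<union> traces E (set ys') (set zs)"
      proof (cases "v \<in> A")
        case True
        have "t = {w \<in> B. E v w} \<inter> set zs" using v 2 xs' by auto
        moreover have "{w \<in> B. E v w} \<in> traces E A B" using True v calculation by (auto simp: traces_def)
        ultimately show ?thesis by blast
      next
        case False
        then have "v \<in> set ys'" using v 2 xs by auto
        then show ?thesis using v by (auto simp: traces_def)
      qed
    qed
    then have "card (traces E (set ys) (set zs)) \<le> card ((\<lambda>t. t \<inter> set zs) ` traces E A B \<union> traces E (set ys') (set zs))"
      using fA by (intro card_mono) auto
    also have "\<dots> \<le> card ((\<lambda>t. t \<inter> set zs) ` traces E A B) + card (traces E (set ys') (set zs))"
      by (rule card_Un_le)
    also have "\<dots> \<le> m + k2"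
      using card_image_le[of "traces E A B" "\<lambda>t. t \<inter> set zs"] fA assms(4) xs'(3)[OF 2(2)]
      by (meson add_le_mono finite_traces le_trans)
    finally show ?thesis by simp
  qed
  moreover have "distinct (xs @ xs')" "set (xs @ xs') = A \<union> B" using xs xs' assms by auto
  ultimately show ?thesis unfolding lw_def by blast
qed

lemma lw_disjoint_union:
  assumes "lw E A k" "lw E B k" "A \<inter> B = {}"
    "\<And>a b. a \<in> A \<Longrightarrow> b \<in> B \<Longrightarrow> \<not> E a b"
  shows "lw E (A \<union> B) k"
proof -
  from assms(1) obtain xs where xs: "distinct xs" "set xs = A"
    "\<And>ys zs. xs = ys @ zs \<Longrightarrow> card (traces E (set ys) (set zs)) \<le> k"
    unfolding lw_def by blast
  from assms(2) obtain xs' where xs': "distinct xs'" "set xs' = B"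
    "\<And>ys zs. xs' = ys @ zs \<Longrightarrow> card (traces E (set ys) (set zs)) \<le> k"
    unfolding lw_def by blast
  have "card (traces E (set ys) (set zs)) \<le> k" if "xs @ xs' = ys @ zs" for ys zs
    using that
  proof (cases rule: append_eq_append_cases)
    case (1 zs')
    have "{w \<in> set zs. E v w} = {w \<in> set zs'. E v w}" if "v \<in> set ys" for v
      using 1 xs xs' assms(4) that by auto
    then have "traces E (set ys) (set zs) = traces E (set ys) (set zs')"
      by (simp add: traces_def)
    then show ?thesis using xs(3)[OF 1(1)] by simp
  next
    case (2 ys')
    have "traces E (set ys) (set zs) \<subseteq> traces E (set ys') (set zs)"
    proof
      fix t assume "t \<in> traces E (set ys) (set zs)"
      then obtain v where v: "v \<in> set ys" "t = {w \<in> set zs. E v w}" "t \<noteq> {}" by (auto simp: traces_def)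
      then have "v \<notin> A" using 2 xs' assms(4) by auto
      then show "t \<in> traces E (set ys') (set zs)" using v 2 xs by (auto simp: traces_def)
    qed
    then show ?thesis using xs'(3)[OF 2(2)] by (rule card_le_of_subset) auto
  qed
  moreover have "distinct (xs @ xs')" "set (xs @ xs') = A \<union> B" using xs xs' assms by auto
  ultimately show ?thesis unfolding lw_def by blast
qed

lemma lw_UN:
  assumes "finite I" "\<And>i. i \<in> I \<Longrightarrow> lw E (B i) k"
    "\<And>i j. i \<in> I \<Longrightarrow> j \<in> I \<Longrightarrow> i \<noteq> j \<Longrightarrow> B i \<inter> B j = {}"
    "\<And>i j u v. i \<in> I \<Longrightarrow> j \<in> I \<Longrightarrow> i \<noteq> j \<Longrightarrow> u \<in> B i \<Longrightarrow> v \<in> B j \<Longrightarrow> \<not> E u v"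
  shows "lw E (\<Union>i\<in>I. B i) k"
  using assms
proof (induction I rule: finite_induct)
  case (insert i I)
  have "lw E (B i \<union> (\<Union>j\<in>I. B j)) k"
  proof (rule lw_disjoint_union)
    show "lw E (\<Union>j\<in>I. B j) k"
    proof (rule insert.IH)
      show "\<not> E u v" if "i \<in> I" "j \<in> I" "i \<noteq> j" "u \<in> B i" "v \<in> B j" for i j u v
        using insert.prems(3)[of i j u v] that by simp
    qed (use insert.prems in auto)
    show "B i \<inter> (\<Union>j\<in>I. B j) = {}" using insert.hyps insert.prems(2)[of i] by fastforce
    show "\<not> E a b" if "a \<in> B i" "b \<in> (\<Union>j\<in>I. B j)" for a b
      using that insert.hyps insert.prems(3)[of i _ a b] by fastforce
  qed (use insert in auto)
  then show ?case by simp
qed simp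

text \<open>The new vertex is placed first, so it lies in every nonempty prefix and adds only its
  own trace.\<close>

lemma lw_insert:
  assumes "lw E V k" shows "lw E (insert x V) (k + 1)"
proof (cases "x \<in> V")
  case True
  then show ?thesis using assms by (auto simp: insert_absorb intro: lw_mono)
next
  case False
  from assms(1) obtain xs where xs: "distinct xs" "set xs = V"
    "\<And>ys zs. xs = ys @ zs \<Longrightarrow> card (traces E (set ys) (set zs)) \<le> k"
    unfolding lw_def by blast
  have "card (traces E (set ys) (set zs)) \<le> k + 1" if "x # xs = ys @ zs" for ys zs
  proof (cases ys)
    case (Cons y ys')
    then have "xs = ys' @ zs" "y = x" using that by auto
    have "traces E (set ys) (set zs) \<subseteq> insert {w \<in> set zs. E x w} (traces E (set ys') (set zs))"
      using Cons \<open>y = x\<close> by (auto simp: traces_def)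
    then show ?thesis
      by (rule card_le_of_subset) (use card_insert_le'[OF xs(3)[OF \<open>xs = ys' @ zs\<close>]] in auto)
  qed simp
  moreover have "distinct (x # xs)" "set (x # xs) = insert x V" using xs False by auto
  ultimately show ?thesis unfolding lw_def by blast
qed

lemma lw_delete:
  assumes "lw E (V - S) k" "finite S" "S \<subseteq> V" "card S \<le> n"
  shows "lw E V (k + n)"
proof -
  have "lw E (A \<union> S) (k + card S)" if "lw E A k" for A
    using assms(2) that
  proof (induction S rule: finite_induct)
    case (insert x F)
    then show ?case using lw_insert[of E "A \<union> F" "k + card F" x] by simp
  qed simp
  from this[OF assms(1)] have "lw E V (k + card S)"
    using assms(3) by (simp add: Un_absorb2)
  then show ?thesis by (rule lw_mono) (use assms in simp)
qed

text \<open>The new trace of \<open>v\<close> is determined by its old trace and its part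
  \<open>p v\<close>. The old trace may be empty, hence \<open>k + 1\<close>.\<close>

lemma lw_flip:
  fixes p :: "'a \<Rightarrow> nat"
  assumes "lw F V k" "p ` V \<subseteq> {..<m}"
    "\<And>u v. u \<in> V \<Longrightarrow> v \<in> V \<Longrightarrow> u \<noteq> v \<Longrightarrow> E u v \<longleftrightarrow> F u v \<noteq> \<phi> (p u) (p v)"
  shows "lw E V ((k + 1) * m)"
proof -
  from assms(1) obtain xs where xs: "distinct xs" "set xs = V"
    "\<And>ys zs. xs = ys @ zs \<Longrightarrow> card (traces F (set ys) (set zs)) \<le> k"
    unfolding lw_def by blast
  have "card (traces E (set ys) (set zs)) \<le> (k + 1) * m" if eq: "xs = ys @ zs" for ys zs
  proof -
    let ?S = "insert {} (traces F (set ys) (set zs))"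
    let ?g = "\<lambda>(s, i). {w \<in> set zs. w \<in> s \<longleftrightarrow> \<not> \<phi> i (p w)}"
    have "traces E (set ys) (set zs) \<subseteq> ?g ` (?S \<times> {..<m})"
    proof
      fix t assume "t \<in> traces E (set ys) (set zs)"
      then obtain v where v: "v \<in> set ys" "t = {w \<in> set zs. E v w}" by (auto simp: traces_def)
      have "E v w \<longleftrightarrow> F v w \<noteq> \<phi> (p v) (p w)" if "w \<in> set zs" for w
        using assms(3)[of v w] eq xs v that by auto
      then have "t = ?g ({w \<in> set zs. F v w}, p v)" using v by auto
      moreover have "{w \<in> set zs. F v w} \<in> ?S" using v by (auto simp: traces_def)
      moreover have "p v \<in> {..<m}" using assms(2) v eq xs by auto
      ultimately show "t \<in> ?g ` (?S \<times> {..<m})" by blast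
    qed
    then have "card (traces E (set ys) (set zs)) \<le> card (?g ` (?S \<times> {..<m}))"
      by (intro card_mono) auto
    also have "\<dots> \<le> card (?S \<times> {..<m})" by (intro card_image_le) auto
    also have "\<dots> = card ?S * m" by (simp add: card_cartesian_product)
    also have "\<dots> \<le> (k + 1) * m" by (intro mult_le_mono1 card_insert_le' xs(3)[OF eq])
    finally show ?thesis .
  qed
  with xs show ?thesis unfolding lw_def by blast
qed

text \<open>Adjacent vertices have the same closed neighbourhood \<open>B u\<close>, so these sets
  are the components, and each of them is a clique.\<close>

lemma lw_P3_free:
  assumes "finite V" "\<And>u v. E u v \<Longrightarrow> E v u"
    "\<And>u v w. u \<in> V \<Longrightarrow> v \<in> V \<Longrightarrow> w \<in> V \<Longrightarrow> E u v \<Longrightarrow> E v w \<Longrightarrow> u \<noteq> w \<Longrightarrow> E u w"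
  shows "lw E V 1"
proof -
  define B where "B u = {w \<in> V. w = u \<or> E u w}" for u
  define I where "I = B ` V"
  have eq: "B u = B v" if "u \<in> V" "v \<in> V" "E u v" for u v
  proof -
    have "w = u \<or> E u w \<longleftrightarrow> w = v \<or> E v w" if "w \<in> V" for w
      using \<open>u \<in> V\<close> \<open>v \<in> V\<close> \<open>E u v\<close> that assms(2,3) by blast
    then show ?thesis by (auto simp: B_def)
  qed
  have "lw E (\<Union>i\<in>I. i) 1"
  proof (rule lw_UN)
    show "finite I" using assms by (simp add: I_def)
    show "lw E i 1" if i: "i \<in> I" for i
    proof (rule lw_clique)
      show "finite i" using i assms by (auto simp: I_def B_def)
      show "E u v" if "u \<in> i" "v \<in> i" "u \<noteq> v" for u v
      proof -
        obtain x where x: "x \<in> V" "i = B x" using i unfolding I_def by auto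
        then have uv: "u \<in> V" "v \<in> V" "u = x \<or> E x u" "v = x \<or> E x v" using that B_def by auto
        show ?thesis
        proof (cases "u = x \<or> v = x")
          case True
          then show ?thesis using uv that assms(2) by auto
        next
          case False
          then show ?thesis using assms(3)[of u x v] uv that assms(2)[of x u] x by simp
        qed
      qed
    qed
    have *: "i = B u" if iu: "i \<in> I" "u \<in> i" for i u
    proof -
      obtain v where "v \<in> V" "i = B v" using iu unfolding I_def by blast
      then show ?thesis using iu eq[of v u] by (auto simp: B_def)
    qed
    show "i \<inter> j = {}" if "i \<in> I" "j \<in> I" "i \<noteq> j" for i j
      using that * by blast
    show "\<not> E u v" if "i \<in> I" "j \<in> I" "i \<noteq> j" "u \<in> i" "v \<in> j" for i j u v
    proof
      assume "E u v"
      moreover have "u \<in> V" "v \<in> V" using that by (auto simp: I_def B_def)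
      ultimately have "B u = B v" by (intro eq)
      then show False using *[OF that(1,4)] *[OF that(2,5)] that(3) by simp
    qed
  qed
  moreover have "(\<Union>i\<in>I. i) = V" by (auto simp: I_def B_def)
  ultimately show ?thesis by simp
qed

subsection \<open>From orders to clique-width\<close>

text \<open>Since \<open>v\<close> is alone in its label, joining that label with each label of
  \<open>J\<close> in turn adds edges at \<open>v\<close> only.\<close>

lemma cw_join_labels:
  assumes "finite J" "cw_constructible k \<lparr>verts = V, edges = E\<rparr> l" "v \<in> V"
    "\<And>u. u \<in> V \<Longrightarrow> l u = l v \<Longrightarrow> u = v" "J \<subseteq> {1..k} - {l v}" "l v \<in> {1..k}"
  shows "cw_constructible k \<lparr>verts = V, edges = E \<union> {{u, v} | u. u \<in> V \<and> l u \<in> J}\<rparr> l"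
  using assms
proof (induction J rule: finite_induct)
  case empty
  then show ?case by simp
next
  case (insert j J)
  have "cw_constructible k \<lparr>verts = V, edges = E \<union> {{u, v} | u. u \<in> V \<and> l u \<in> J}\<rparr> l"
    using insert.prems by (intro insert.IH) auto
  from join[OF this, of j "l v"] insert.prems
  have "cw_constructible k \<lparr>verts = V, edges = (E \<union> {{u, v} | u. u \<in> V \<and> l u \<in> J}) \<union>
     {{u, w} | u w. u \<in> V \<and> w \<in> V \<and> l u = j \<and> l w = l v}\<rparr> l"
    by auto
  moreover have "{{u, w} | u w. u \<in> V \<and> w \<in> V \<and> l u = j \<and> l w = l v} = {{u, v} | u. u \<in> V \<and> l u = j}"
    using insert.prems(2,3) by blast
  moreover have "(E \<union> {{u, v} | u. u \<in> V \<and> l u \<in> J}) \<union> {{u, v} | u. u \<in> V \<and> l u = j} =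
      E \<union> {{u, v} | u. u \<in> V \<and> l u \<in> insert j J}" by blast
  ultimately show ?case by simp
qed

text \<open>In the application \<open>t\<close> is the neighbourhood among the vertices still to
  come, and vertices that agree there may share a label from then on. With fewer values of
  \<open>t\<close> than labels, the top label can always be vacated for the next vertex.\<close>

lemma cw_merge_label:
  assumes c: "cw_constructible (Suc k) G l" and "verts G \<noteq> {}" "finite (verts G)"
    and l: "l ` verts G \<subseteq> {1..Suc k}"
    and card: "card (t ` verts G) \<le> k"
    and t: "\<And>u v. u \<in> verts G \<Longrightarrow> v \<in> verts G \<Longrightarrow> l u = l v \<Longrightarrow> t u = t v"
  shows "\<exists>m. cw_constructible (Suc k) G m \<and> m ` verts G \<subseteq> {1..k} \<and>
    (\<forall>u\<in>verts G. \<forall>v\<in>verts G. m u = m v \<longrightarrow> t u = t v)"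
proof -
  have "\<exists>i m. i \<in> {1..Suc k} \<and> cw_constructible (Suc k) G m \<and> m ` verts G \<subseteq> {1..Suc k} - {i} \<and>
    (\<forall>u\<in>verts G. \<forall>v\<in>verts G. m u = m v \<longrightarrow> t u = t v)"
  proof (cases "l ` verts G = {1..Suc k}")
    case False
    then obtain i where i: "i \<in> {1..Suc k}" "i \<notin> l ` verts G" using l by blast
    then have "l ` verts G \<subseteq> {1..Suc k} - {i}" using l by blast
    with i(1) c show ?thesis using t by (intro exI[of _ i] exI[of _ l] conjI ballI impI)
  next
    case True
    define s where "s i = (SOME u. u \<in> verts G \<and> l u = i)" for i
    have s: "s i \<in> verts G \<and> l (s i) = i" if "i \<in> {1..Suc k}" for i
    proof -
      have "\<exists>u. u \<in> verts G \<and> l u = i" using that True by (metis imageE)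
      then show ?thesis unfolding s_def by (rule someI_ex)
    qed
    \<comment> \<open>\<open>s i\<close> represents label \<open>i\<close>. All \<open>Suc k\<close>
      labels are in use but \<open>t\<close> has at most \<open>k\<close> values, so two labels
      carry the same value and can be merged.\<close>
    have "\<not> inj_on (t \<circ> s) {1..Suc k}"
    proof
      assume "inj_on (t \<circ> s) {1..Suc k}"
      then have "card ((t \<circ> s) ` {1..Suc k}) = Suc k"
        by (simp only: card_image card_atLeastAtMost diff_Suc_1)
      moreover have "(t \<circ> s) ` {1..Suc k} \<subseteq> t ` verts G" using s by auto
      ultimately have "Suc k \<le> card (t ` verts G)"
        using card_mono[of "t ` verts G" "(t \<circ> s) ` {1..Suc k}"] assms(3) by simp
      then show False using card by simp
    qed
    then obtain i j where ij: "i \<in> {1..Suc k}" "j \<in> {1..Suc k}" "i \<noteq> j" "t (s i) = t (s j)"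
      by (auto simp: inj_on_def)
    let ?m = "\<lambda>v. if l v = i then j else l v"
    have "cw_constructible (Suc k) G ?m" using rename[OF c ij(1,2)] .
    moreover have "?m ` verts G \<subseteq> {1..Suc k} - {i}" using l ij by auto
    moreover have "t u = t (s (l u))" if "u \<in> verts G" for u
    proof -
      have "l u \<in> {1..Suc k}" using that l by blast
      then show ?thesis using that s[of "l u"] t[of u "s (l u)"] by simp
    qed
    then have "t u = t v" if "u \<in> verts G" "v \<in> verts G" "?m u = ?m v" for u v
      using that ij(4) by (auto split: if_splits)
    ultimately show ?thesis using ij(1) by blast
  qed
  then obtain i m where im: "i \<in> {1..Suc k}" "cw_constructible (Suc k) G m"
    "m ` verts G \<subseteq> {1..Suc k} - {i}" "\<forall>u\<in>verts G. \<forall>v\<in>verts G. m u = m v \<longrightarrow> t u = t v" by blast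
  \<comment> \<open>Label \<open>i\<close> is free, so the vertices labelled \<open>Suc k\<close>
    can move to it.\<close>
  let ?n = "\<lambda>v. if m v = Suc k then i else m v"
  have "?n ` verts G \<subseteq> {1..k}"
  proof -
    have "?n u \<in> {1..k}" if "u \<in> verts G" for u
    proof -
      have "m u \<in> {1..Suc k}" "m u \<noteq> i" using im(3) that by auto
      then show ?thesis using im(1) by auto
    qed
    then show ?thesis by blast
  qed
  moreover have "\<forall>u\<in>verts G. \<forall>v\<in>verts G. ?n u = ?n v \<longrightarrow> t u = t v"
  proof (intro ballI impI)
    fix u v assume uv: "u \<in> verts G" "v \<in> verts G" "?n u = ?n v"
    have "m u \<noteq> i" "m v \<noteq> i" using im(3) uv(1,2) by blast+
    then have "m u = m v" using uv(3) by (simp split: if_splits)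
    then show "t u = t v" using im(4) uv(1,2) by blast
  qed
  moreover have "cw_constructible (Suc k) G ?n" by (rule rename[OF im(2)]) (use im(1) in auto)
  ultimately show ?thesis by blast
qed

definition adj :: "'a ugraph \<Rightarrow> 'a \<Rightarrow> 'a \<Rightarrow> bool" where
  "adj G u v \<longleftrightarrow> {u, v} \<in> edges G"

text \<open>The invariant is that equal labels mean equal neighbourhoods in the suffix. Of the
  labels, \<open>k\<close> serve the nonempty traces, one the empty trace, and one the vertex being
  added.\<close>

lemma lw_clique_width:
  assumes G: "simple_graph G" and lw: "lw (adj G) (verts G) k"
  shows "clique_width G \<le> k + 2"
proof (cases "verts G = {}")
  case False
  from lw obtain xs where xs: "distinct xs" "set xs = verts G"
    "\<And>ys zs. xs = ys @ zs \<Longrightarrow> card (traces (adj G) (set ys) (set zs)) \<le> k"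
    unfolding lw_def by blast
  let ?K = "Suc (Suc k)"
  have edge: "\<exists>u v. e = {u, v} \<and> u \<noteq> v" if "e \<in> edges G" for e
  proof -
    have "card e = 2" using that G by (simp add: simple_graph_def)
    then show ?thesis by (auto simp: card_2_iff)
  qed
  define tr where "tr B v = {w \<in> B. adj G v w}" for B v
  have main: "\<exists>l. cw_constructible ?K (induced G (set ys)) l \<and> l ` set ys \<subseteq> {1..Suc k} \<and>
      (\<forall>u\<in>set ys. \<forall>v\<in>set ys. l u = l v \<longrightarrow> tr (set zs) u = tr (set zs) v)"
    if "xs = ys @ zs" "ys \<noteq> []" for ys zs
    using that
  proof (induction ys arbitrary: zs rule: rev_induct)
    case (snoc v ys)
    have v: "v \<notin> set ys" using snoc.prems xs(1) by auto
    have no_loop: "{e \<in> edges G. e \<subseteq> {v}} = {}"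
    proof -
      have False if "e \<in> edges G" "e \<subseteq> {v}" for e using edge[OF that(1)] that(2) by auto
      then show ?thesis by blast
    qed
    have "\<exists>l. cw_constructible ?K (induced G (set (ys @ [v]))) l \<and> l ` set (ys @ [v]) \<subseteq> {1..?K} \<and>
      (\<forall>u\<in>set (ys @ [v]). \<forall>w\<in>set (ys @ [v]). l u = l w \<longrightarrow> tr (set zs) u = tr (set zs) w)"
    proof (cases "ys = []")
      \<comment> \<open>The operations never produce a graph without vertices, so the first vertex
        is created instead of being united with an empty prefix.\<close>
      case True
      have "cw_constructible ?K \<lparr>verts = {v}, edges = {}\<rparr> (\<lambda>_. 1)" by (rule create) simp
      moreover have "induced G {v} = \<lparr>verts = {v}, edges = {}\<rparr>" using no_loop by (simp only: induced_def)
      ultimately show ?thesis using True by (intro exI[of _ "\<lambda>_. 1"]) simp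
    next
      case False
      obtain l where l: "cw_constructible ?K (induced G (set ys)) l" "l ` set ys \<subseteq> {1..Suc k}"
        "\<forall>u\<in>set ys. \<forall>w\<in>set ys. l u = l w \<longrightarrow> tr (set (v # zs)) u = tr (set (v # zs)) w"
        using snoc.IH[of "v # zs"] snoc.prems False by auto
      let ?E = "{e \<in> edges G. e \<subseteq> set ys}"
      let ?l = "\<lambda>u. if u \<in> set ys then l u else ?K"
      have lab: "l u \<noteq> ?K" if "u \<in> set ys" for u using l(2) that by fastforce
      have "cw_constructible ?K \<lparr>verts = {v}, edges = {}\<rparr> (\<lambda>_. ?K)" by (rule create) simp
      from union[OF l(1) this] v
      have c: "cw_constructible ?K \<lparr>verts = insert v (set ys), edges = ?E\<rparr> ?l"
        by (simp add: induced_def)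
      \<comment> \<open>Vertices with the same label agree on \<open>v\<close>, the next vertex of
        the order, so joining whole label classes produces exactly the edges between
        \<open>v\<close> and the prefix.\<close>
      define J where "J = l ` {u \<in> set ys. adj G u v}"
      have "cw_constructible ?K \<lparr>verts = insert v (set ys),
          edges = ?E \<union> {{u, v} | u. u \<in> insert v (set ys) \<and> ?l u \<in> J}\<rparr> ?l"
      proof (rule cw_join_labels[OF _ c])
        show "J \<subseteq> {1..?K} - {?l v}" using l(2) lab v by (fastforce simp: J_def)
        show "u = v" if "u \<in> insert v (set ys)" "?l u = ?l v" for u
          using that v lab by (auto split: if_splits)
      qed (auto simp: J_def v)
      moreover have "?E \<union> {{u, v} | u. u \<in> insert v (set ys) \<and> ?l u \<in> J} = {e \<in> edges G. e \<subseteq> insert v (set ys)}"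
        (is "?A = ?B")
      proof
        have "adj G u v" if "u \<in> set ys" "l u \<in> J" for u
        proof -
          obtain u' where u': "u' \<in> set ys" "adj G u' v" "l u = l u'" using \<open>l u \<in> J\<close> by (auto simp: J_def)
          then have "tr (set (v # zs)) u = tr (set (v # zs)) u'" using l(3) that by blast
          then show ?thesis using u'(2) by (auto simp: tr_def)
        qed
        moreover have "?K \<notin> J" 
        proof
          assume "?K \<in> J"
          then obtain u where "u \<in> set ys" "?K = l u" unfolding J_def by blast
          then show False using lab[of u] by simp
        qed
        ultimately have "{u, v} \<in> ?B" if "u \<in> insert v (set ys)" "?l u \<in> J" for u
          using that v by (auto simp: adj_def split: if_splits)
        then show "?A \<subseteq> ?B" by blast
        show "?B \<subseteq> ?A"
        proof
          fix e assume e: "e \<in> ?B"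
          then obtain a b where ab: "e = {a, b}" "a \<noteq> b" using edge by blast
          show "e \<in> ?A"
          proof (cases "v \<in> e")
            case True
            then obtain u where u: "e = {u, v}" "u \<noteq> v" using ab by (auto simp: insert_commute)
            then have "u \<in> set ys" "adj G u v" using e by (auto simp: adj_def)
            then have "l u \<in> J" by (auto simp: J_def)
            then show ?thesis using u \<open>u \<in> set ys\<close> by auto
          next
            case False
            then show ?thesis using e by auto
          qed
        qed
      qed
      ultimately have "cw_constructible ?K (induced G (set (ys @ [v]))) ?l"
        by (simp add: induced_def)
      moreover have "?l ` set (ys @ [v]) \<subseteq> {1..?K}" using l(2) by fastforce
      moreover have "tr (set zs) u = tr (set zs) w"
        if "u \<in> set (ys @ [v])" "w \<in> set (ys @ [v])" "?l u = ?l w" for u w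
      proof (cases "u \<in> set ys")
        case True
        then have w: "w \<in> set ys" using that(3) lab[OF True] by (simp split: if_splits)
        then have "l u = l w" using that(3) True by simp
        then have "tr (set (v # zs)) u = tr (set (v # zs)) w" using l(3) w True by blast
        then show ?thesis by (auto simp: tr_def)
      next
        case False
        then have "w \<notin> set ys" using that(3) lab[of w] by auto
        then have "u = v" "w = v" using False that(1,2) by auto
        then show ?thesis by simp
      qed
      ultimately show ?thesis by (intro exI[of _ ?l]) blast
    qed
    then obtain l where l: "cw_constructible ?K (induced G (set (ys @ [v]))) l"
      "l ` set (ys @ [v]) \<subseteq> {1..?K}"
      "\<forall>u\<in>set (ys @ [v]). \<forall>w\<in>set (ys @ [v]). l u = l w \<longrightarrow> tr (set zs) u = tr (set zs) w"
      by blast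
    have vs: "verts (induced G (set (ys @ [v]))) = set (ys @ [v])" by (simp add: induced_def)
    have card: "card (tr (set zs) ` set (ys @ [v])) \<le> Suc k"
    proof -
      have sub: "tr (set zs) ` set (ys @ [v]) \<subseteq> insert {} (traces (adj G) (set (ys @ [v])) (set zs))"
        by (auto simp: traces_def tr_def)
      have "card (insert {} (traces (adj G) (set (ys @ [v])) (set zs))) \<le> k + 1"
        by (rule card_insert_le'[OF xs(3)]) (use snoc.prems in simp)
      then have "card (tr (set zs) ` set (ys @ [v])) \<le> k + 1"
        by (rule card_le_of_subset[OF sub]) simp
      then show ?thesis by simp
    qed
    show ?case
      by (rule cw_merge_label[OF l(1), of "tr (set zs)", unfolded vs, OF _ _ l(2) card])
        (simp, simp, use l(3) in blast)
  qed simp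
  have "xs \<noteq> []" using False xs(2) by auto
  then obtain l where "cw_constructible ?K (induced G (verts G)) l"
    using main[of xs "[]"] unfolding xs(2) by auto
  moreover have "induced G (verts G) = G"
    using G by (cases G) (auto simp: induced_def simple_graph_def)
  ultimately show ?thesis using False unfolding clique_width_def
    by (auto intro!: Least_le)
qed (simp add: clique_width_def)

subsection \<open>Bipartite graphs\<close>

text \<open>The components are stars with centres in \<open>W\<close>, and isolated vertices. A
  centre that precedes its leaves causes a single trace.\<close>

lemma lw_stars:
  assumes "finite U" "finite W" "U \<inter> W = {}" "\<And>u v. F u v \<Longrightarrow> F v u"
    and indep: "\<And>u v. u \<in> U \<Longrightarrow> v \<in> U \<Longrightarrow> \<not> F u v" "\<And>u v. u \<in> W \<Longrightarrow> v \<in> W \<Longrightarrow> \<not> F u v"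
    and deg: "\<And>u w w'. u \<in> U \<Longrightarrow> w \<in> W \<Longrightarrow> w' \<in> W \<Longrightarrow> F u w \<Longrightarrow> F u w' \<Longrightarrow> w = w'"
  shows "lw F (U \<union> W) 1"
proof -
  define S where "S w = insert w {u \<in> U. F u w}" for w
  have leaf: "lw F {u \<in> U. P u} 0" for P
    using assms by (intro lw_no_edges) auto
  have "lw F (\<Union>w\<in>W. S w) 1"
  proof (rule lw_UN)
    show "lw F (S w) 1" for w
      using lw_insert[OF leaf, of w] by (simp add: S_def)
    show "S w \<inter> S w' = {}" if "w \<in> W" "w' \<in> W" "w \<noteq> w'" for w w'
      using that assms(3) deg[of _ w w'] by (auto simp: S_def)
    show "\<not> F u v" if "w \<in> W" "w' \<in> W" "w \<noteq> w'" "u \<in> S w" "v \<in> S w'" for w w' u v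
      using that indep deg[of _ w w'] assms(4)[of w u] assms(4)[of w v] assms(4)[of w w']
      by (auto simp: S_def)
  qed (use assms in auto)
  moreover have "lw F {u \<in> U. \<forall>w\<in>W. \<not> F u w} 1" using leaf by (rule lw_mono) simp
  ultimately have "lw F ((\<Union>w\<in>W. S w) \<union> {u \<in> U. \<forall>w\<in>W. \<not> F u w}) 1"
  proof (rule lw_disjoint_union)
    show "(\<Union>w\<in>W. S w) \<inter> {u \<in> U. \<forall>w\<in>W. \<not> F u w} = {}"
      using assms(3) by (auto simp: S_def)
    show "\<not> F a b" if "a \<in> (\<Union>w\<in>W. S w)" "b \<in> {u \<in> U. \<forall>w\<in>W. \<not> F u w}" for a b
      using that indep(1) assms(4) by (auto simp: S_def)
  qed
  moreover have "(\<Union>w\<in>W. S w) \<union> {u \<in> U. \<forall>w\<in>W. \<not> F u w} = U \<union> W"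
    by (auto simp: S_def)
  ultimately show ?thesis by simp
qed

text \<open>The excluded copies of \<open>P\<^sub>2 + P\<^sub>3\<close> are those whose path
  \<open>x v y\<close> has its middle in \<open>U\<close>: exactly what is needed to compare the
  neighbourhoods of two vertices of \<open>U\<close>. The condition passes to subsets of both sides,
  which the induction on layers uses.\<close>

locale bipartite_P2P3_free =
  fixes E :: "'a \<Rightarrow> 'a \<Rightarrow> bool" and U W :: "'a set"
  assumes finite: "finite U" "finite W"
    and disjoint: "U \<inter> W = {}"
    and sym: "E u v \<Longrightarrow> E v u"
    and indep: "u \<in> U \<Longrightarrow> v \<in> U \<Longrightarrow> \<not> E u v" "w \<in> W \<Longrightarrow> x \<in> W \<Longrightarrow> \<not> E w x"
    and P2P3_free: "u \<in> U \<Longrightarrow> v \<in> U \<Longrightarrow> w \<in> W \<Longrightarrow> x \<in> W \<Longrightarrow> y \<in> W \<Longrightarrow> x \<noteq> y \<Longrightarrow>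
      E u w \<Longrightarrow> \<not> E v w \<Longrightarrow> E v x \<Longrightarrow> E v y \<Longrightarrow> \<not> E u x \<Longrightarrow> \<not> E u y \<Longrightarrow> False"
begin

definition nb :: "'a \<Rightarrow> 'a set" where
  "nb u = {w \<in> W. E u w}"

lemma finite_nb [simp]: "finite (nb u)"
  using finite by (simp add: nb_def)

lemma card_diff_le_1:
  assumes "u \<in> U" "v \<in> U" "\<not> nb u \<subseteq> nb v"
  shows "card (nb v - nb u) \<le> 1"
proof (rule ccontr)
  assume "\<not> card (nb v - nb u) \<le> 1"
  then obtain x y where "x \<in> nb v - nb u" "y \<in> nb v - nb u" "x \<noteq> y"
    by (metis One_nat_def card_le_Suc0_iff_eq finite_Diff finite_nb)
  moreover obtain w where "w \<in> nb u" "w \<notin> nb v" using assms by blast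
  ultimately show False using P2P3_free[of u v w x y] assms by (auto simp: nb_def)
qed

text \<open>If some element of \<open>nb u\<close> is outside \<open>nb v\<close>, then at most one
  element of \<open>nb v\<close> is outside \<open>nb u\<close>, so \<open>nb v\<close> cannot be
  the larger set.\<close>

lemma nb_subset_of_card_less:
  assumes "u \<in> U" "v \<in> U" "card (nb u) < card (nb v)"
  shows "nb u \<subseteq> nb v"
proof (rule ccontr)
  assume n: "\<not> nb u \<subseteq> nb v"
  have "card (nb v - nb u) \<le> 1" using card_diff_le_1 assms n by blast
  moreover have "card (nb u - nb v) \<ge> 1"
    using n by (metis Diff_eq_empty_iff One_nat_def Suc_leI card_gt_0_iff finite_Diff finite_nb)
  moreover have "card (nb v) = card (nb v - nb u) + card (nb v \<inter> nb u)"
    "card (nb u) = card (nb u - nb v) + card (nb v \<inter> nb u)"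
    by (subst card_Un_disjoint[symmetric]; auto intro: arg_cong[of _ _ card])+
  ultimately show False using assms(3) by linarith
qed

text \<open>Any two neighbourhoods are equal or one swap apart. Such a family either contains all
  but one element of a fixed member \<open>A\<close>, or lies inside \<open>A\<close> plus one
  element; these are the two kinds of cliques in a Johnson graph. Once that element is removed from
  \<open>W\<close>, every neighbourhood deviates from \<open>A\<close> in at most one
  vertex.\<close>

lemma uniform_lw:
  assumes card: "\<And>u v. u \<in> U \<Longrightarrow> v \<in> U \<Longrightarrow> card (nb u) = card (nb v)"
  shows "lw E (U \<union> W) 7"
proof (cases "U = {}")
  case True
  then show ?thesis using finite indep by (intro lw_no_edges) auto
next
  case False
  then obtain u0 where u0: "u0 \<in> U" by blast
  define A where "A = nb u0"
  have finA: "finite A" by (simp add: A_def)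
  have AW: "A \<subseteq> W" by (auto simp: A_def nb_def)
  have eq: "card (nb u - nb v) = card (nb v - nb u)" if "u \<in> U" "v \<in> U" for u v
    using card[OF that] card_Diff_subset_Int[of "nb u" "nb v"] card_Diff_subset_Int[of "nb v" "nb u"]
    by (simp add: Int_commute)
  have le: "card (nb u - nb v) \<le> 1" if "u \<in> U" "v \<in> U" for u v
    using card_diff_le_1[of v u] eq[of u v] that by (cases "nb v \<subseteq> nb u") (auto simp: Diff_eq_empty_iff[THEN iffD2])
  have uniq: "x = y" if "x \<in> nb u - nb v" "y \<in> nb u - nb v" "u \<in> U" "v \<in> U" for x y u v
    using le[OF that(3,4)] that(1,2) by (metis One_nat_def card_le_Suc0_iff_eq finite_Diff finite_nb)
  have swap: "\<exists>x. x \<in> nb v - nb u" if "x \<in> nb u - nb v" "u \<in> U" "v \<in> U" for x u v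
  proof -
    have "card (nb u - nb v) \<noteq> 0" using that(1) by auto
    then show ?thesis using eq[OF that(2,3)] by (metis card.empty ex_in_conv)
  qed
  \<comment> \<open>\<open>r\<close> is the removed vertex and \<open>B\<close> the reference
    neighbourhood. Flipping \<open>U\<close> against \<open>B\<close> leaves stars; the three parts
    give \<open>(1 + 1) * 3\<close>, and \<open>r\<close> adds one.\<close>
  have lw': "lw E (U \<union> W) 7"
    if B: "\<And>u w w'. u \<in> U \<Longrightarrow> w \<in> W - {r} \<Longrightarrow> w' \<in> W - {r} \<Longrightarrow>
      E u w \<noteq> (w \<in> B) \<Longrightarrow> E u w' \<noteq> (w' \<in> B) \<Longrightarrow> w = w'" and "r \<in> W" "B \<subseteq> W" for r B
  proof -
    let ?p = "\<lambda>v. if v \<in> U then 0 else if v \<in> B then 1 else (2::nat)"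
    define F where "F x y \<longleftrightarrow> (x \<in> U \<and> y \<in> W - {r} \<and> E x y \<noteq> (y \<in> B)) \<or> (y \<in> U \<and> x \<in> W - {r} \<and> E x y \<noteq> (x \<in> B))" for x y
    have "lw F (U \<union> (W - {r})) 1"
    proof (rule lw_stars)
      show "F v u" if "F u v" for u v using that sym by (auto simp: F_def)
      show "w = w'" if "u \<in> U" "w \<in> W - {r}" "w' \<in> W - {r}" "F u w" "F u w'" for u w w'
        using B[OF that(1-3)] that disjoint by (auto simp: F_def)
    qed (use finite disjoint in \<open>auto simp: F_def\<close>)
    then have "lw E (U \<union> (W - {r})) ((1 + 1) * 3)"
    proof (rule lw_flip[where p = ?p and \<phi> = "\<lambda>i j. i = 0 \<and> j = 1 \<or> i = 1 \<and> j = 0"])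
      show "E x y \<longleftrightarrow> F x y \<noteq> (?p x = 0 \<and> ?p y = 1 \<or> ?p x = 1 \<and> ?p y = 0)"
        if "x \<in> U \<union> (W - {r})" "y \<in> U \<union> (W - {r})" for x y
        using that indep disjoint \<open>B \<subseteq> W\<close> sym by (auto simp: F_def)
    qed auto
    from lw_insert[OF this, of r] have "lw E (insert r (U \<union> (W - {r}))) 7" by simp
    moreover have "insert r (U \<union> (W - {r})) = U \<union> W" using \<open>r \<in> W\<close> by blast
    ultimately show ?thesis by simp
  qed
  show ?thesis
  proof (cases "\<exists>u\<in>U. nb u \<noteq> A")
    case False
    then have "E u w \<longleftrightarrow> w \<in> A" if "u \<in> U" "w \<in> W" for u w using that by (auto simp: nb_def)
    then have "lw E (U \<union> W) 7" if "r \<in> W" for r using lw'[of r A] that AW by auto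
    then show ?thesis using finite indep by (cases "W = {}") (auto intro: lw_no_edges)
  next
    case True
    then obtain u where u: "u \<in> U" "nb u \<noteq> A" by blast
    have "\<exists>a. a \<in> A - nb u" "\<exists>b. b \<in> nb u - A"
      using u swap[of _ u u0] swap[of _ u0 u] u0 unfolding A_def by blast+
    then obtain a b where ab: "a \<in> A - nb u" "b \<in> nb u - A" by blast
    \<comment> \<open>If \<open>v\<close> misses some \<open>a' \<noteq> a\<close> of
      \<open>A\<close> and \<open>v'\<close> has some \<open>b'' \<noteq> b\<close> outside
      \<open>A\<close>, then \<open>a\<close> and \<open>b\<close> both lie in \<open>nb v\<close>
      but not in \<open>nb v'\<close>, which is more than one swap.\<close>
    consider "\<forall>v\<in>U. A - {a} \<subseteq> nb v" | "\<forall>v\<in>U. nb v \<subseteq> insert b A"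
    proof -
      have False if v: "v \<in> U" "a' \<in> A" "a' \<noteq> a" "a' \<notin> nb v" and v': "v' \<in> U" "b'' \<in> nb v'" "b'' \<noteq> b" "b'' \<notin> A" for v v' a' b''
      proof -
        have 1: "a \<in> nb v" using uniq[of a' u0 v a] v ab u0 by (auto simp: A_def)
        have "a' \<in> nb u" using uniq[of a' u0 u a] v ab u0 u by (auto simp: A_def)
        obtain b' where b': "b' \<in> nb v - A" using swap[of a' u0 v] v u0 by (auto simp: A_def)
        have 2: "b \<in> nb v" 
        proof (rule ccontr)
          assume "b \<notin> nb v"
          then have "a' = b" using uniq[of a' u v b] \<open>a' \<in> nb u\<close> v ab u by auto
          then show False using ab v by auto
        qed
        have 3: "b \<notin> nb v'" using uniq[of b'' v' u0 b] v' ab u0 by (auto simp: A_def)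
        have 4: "b'' \<notin> nb v"
          using uniq[of b'' v u0 b] v v' 2 ab u0 by (auto simp: A_def)
        have 5: "b'' \<notin> nb u" using uniq[of b'' u u0 b] u v' ab u0 by (auto simp: A_def)
        have 6: "a \<notin> nb v'" using uniq[of a v' u b''] u v' ab 5 by auto
        show False using uniq[of a v v' b] 1 2 3 6 v v' ab by auto
      qed
      then show ?thesis using that by blast
    qed
    then show ?thesis
    proof cases
      case 1
      show ?thesis
      proof (rule lw'[of a A])
        show "w = w'" if "v \<in> U" "w \<in> W - {a}" "w' \<in> W - {a}" "E v w \<noteq> (w \<in> A)" "E v w' \<noteq> (w' \<in> A)" for v w w'
        proof -
          have "w \<in> nb v - nb u0" "w' \<in> nb v - nb u0" using that 1 unfolding A_def by (auto simp: nb_def)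
          then show ?thesis using uniq that(1) u0 by blast
        qed
      qed (use ab AW in auto)
    next
      case 2
      show ?thesis
      proof (rule lw'[of b A])
        show "w = w'" if "v \<in> U" "w \<in> W - {b}" "w' \<in> W - {b}" "E v w \<noteq> (w \<in> A)" "E v w' \<noteq> (w' \<in> A)" for v w w'
        proof -
          have "w \<in> nb u0 - nb v" "w' \<in> nb u0 - nb v" using that 2 unfolding A_def by (auto simp: nb_def)
          then show ?thesis using uniq that(1) u0 by blast
        qed
      qed (use ab AW in \<open>auto simp: nb_def\<close>)
    qed
  qed
qed

end

text \<open>Inserting \<open>U \<inter> set zs\<close> makes the bound hereditary: every vertex of \<open>W\<close> placed in an earlier degree layer is adjacent to all later vertices of \<open>U\<close>.\<close>

lemma bipartite_order:
  assumes "bipartite_P2P3_free E U W"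
  shows "\<exists>xs. distinct xs \<and> set xs = U \<union> W \<and>
    (\<forall>ys zs. xs = ys @ zs \<longrightarrow> card (insert (U \<inter> set zs) (traces E (set ys) (set zs)) - {{}}) \<le> 16)"
  using assms
proof (induction "card U" arbitrary: U W rule: less_induct)
  case less
  interpret bipartite_P2P3_free E U W by (rule less.prems)
  show ?case
  proof (cases "U = {}")
    case True
    obtain xs where xs: "distinct xs" "set xs = W" using finite finite_distinct_list by blast
    have "insert (U \<inter> set zs) (traces E (set ys) (set zs)) - {{}} = {}" if "xs = ys @ zs" for ys zs
      using True indep(2) xs that by (auto simp: traces_def)
    then have "card (insert (U \<inter> set zs) (traces E (set ys) (set zs)) - {{}}) \<le> 16" if "xs = ys @ zs" for ys zs
      using that by (simp only: card.empty)
    then show ?thesis using xs True by (intro exI[of _ xs]) blast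
  next
    case False
    \<comment> \<open>The vertices of least degree and their neighbours form the first layer, where
      all degrees on the side of \<open>U\<close> are equal.\<close>
    define d where "d = Min ((\<lambda>u. card (nb u)) ` U)"
    define U1 where "U1 = {u \<in> U. card (nb u) = d}"
    define W1 where "W1 = (\<Union>u\<in>U1. nb u)"
    have d: "d \<le> card (nb u)" if "u \<in> U" for u using that finite by (simp add: d_def)
    have "d \<in> (\<lambda>u. card (nb u)) ` U" unfolding d_def using finite False by (intro Min_in) auto
    then have "U1 \<noteq> {}" by (auto simp: U1_def)
    then have less_card: "card (U - U1) < card U"
      using finite by (intro psubset_card_mono) (auto simp: U1_def)
    have W1: "W1 \<subseteq> W" by (auto simp: W1_def nb_def)
    have "bipartite_P2P3_free E (U - U1) (W - W1)"
    proof
      show "E u v \<Longrightarrow> E v u" for u v by (rule sym)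
      show False if "u \<in> U - U1" "v \<in> U - U1" "w \<in> W - W1" "x \<in> W - W1" "y \<in> W - W1" "x \<noteq> y"
        "E u w" "\<not> E v w" "E v x" "E v y" "\<not> E u x" "\<not> E u y" for u v w x y
        by (rule P2P3_free[of u v w x y]) (use that in auto)
    qed (use finite disjoint indep in auto)
    from less.hyps[OF less_card this] obtain xs2 where xs2: "distinct xs2"
      "set xs2 = (U - U1) \<union> (W - W1)"
      "\<And>ys zs. xs2 = ys @ zs \<Longrightarrow> card (insert ((U - U1) \<inter> set zs) (traces E (set ys) (set zs)) - {{}}) \<le> 16"
      by blast
    have layer: "bipartite_P2P3_free E U1 W1"
    proof
      show "E u v \<Longrightarrow> E v u" for u v by (rule sym)
      show False if "u \<in> U1" "v \<in> U1" "w \<in> W1" "x \<in> W1" "y \<in> W1" "x \<noteq> y"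
        "E u w" "\<not> E v w" "E v x" "E v y" "\<not> E u x" "\<not> E u y" for u v w x y
        by (rule P2P3_free[of u v w x y]) (use that W1 in \<open>auto simp: U1_def\<close>)
      show "finite W1" using finite finite_subset[OF W1] by blast
      show "\<not> E w x" if "w \<in> W1" "x \<in> W1" for w x using indep(2)[of w x] that W1 by blast
    qed (use finite disjoint indep W1 in \<open>auto simp: U1_def\<close>)
    have "lw E (U1 \<union> W1) 7"
    proof (rule bipartite_P2P3_free.uniform_lw[OF layer])
      have "bipartite_P2P3_free.nb E W1 u = nb u" if "u \<in> U1" for u
        unfolding bipartite_P2P3_free.nb_def[OF layer] nb_def using that W1
        by (auto simp: W1_def nb_def)
      then show "card (bipartite_P2P3_free.nb E W1 u) = card (bipartite_P2P3_free.nb E W1 v)"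
        if "u \<in> U1" "v \<in> U1" for u v using that by (simp add: U1_def)
    qed
    then obtain xs1 where xs1: "distinct xs1" "set xs1 = U1 \<union> W1"
      "\<And>ys zs. xs1 = ys @ zs \<Longrightarrow> card (traces E (set ys) (set zs)) \<le> 7"
      unfolding lw_def by blast
    \<comment> \<open>\<open>U1\<close> has no neighbours beyond \<open>W1\<close>. A vertex of
      \<open>W1\<close> has a neighbour \<open>u\<close> of least degree, and each vertex of
      \<open>U - U1\<close>, having larger degree, is adjacent to all of
      \<open>nb u\<close>.\<close>
    have later: "{w \<in> set xs2. E v w} = (if v \<in> U1 then {} else U - U1)" if v1: "v \<in> set xs1" for v
    proof (cases "v \<in> U1")
      case True
      then show ?thesis using xs2(2) indep(1)[of v] by (auto simp: U1_def W1_def nb_def)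
    next
      case False
      then obtain u where u: "u \<in> U1" "v \<in> nb u" using v1 xs1(2) by (auto simp: W1_def)
      have "E v w" if "w \<in> U - U1" for w
      proof -
        have "card (nb u) < card (nb w)" using u d[of w] that by (auto simp: U1_def)
        then have "nb u \<subseteq> nb w" using nb_subset_of_card_less u that by (auto simp: U1_def)
        then show ?thesis using u sym by (auto simp: nb_def)
      qed
      moreover have "v \<in> W" using u by (auto simp: nb_def)
      ultimately show ?thesis using False xs2(2) indep(2) by auto
    qed
    have "card (insert (U \<inter> set zs) (traces E (set ys) (set zs)) - {{}}) \<le> 16"
      if "xs1 @ xs2 = ys @ zs" for ys zs
      using that
    proof (cases rule: append_eq_append_cases)
      case (1 zs')
      let ?T = "traces E (set ys) (set zs')"
      let ?T' = "(\<lambda>t. t \<union> (U - U1)) ` insert {} ?T"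
      have "insert (U \<inter> set zs) (traces E (set ys) (set zs)) - {{}} \<subseteq> insert (U \<inter> set zs) (?T \<union> ?T')"
      proof
        fix t assume t: "t \<in> insert (U \<inter> set zs) (traces E (set ys) (set zs)) - {{}}"
        show "t \<in> insert (U \<inter> set zs) (?T \<union> ?T')"
        proof (cases "t = U \<inter> set zs")
          case False
          then obtain v where v: "v \<in> set ys" "t = {w \<in> set zs. E v w}" using t by (auto simp: traces_def)
          have "t = {w \<in> set zs'. E v w} \<union> {w \<in> set xs2. E v w}" using v 1 by auto
          moreover have "v \<in> set xs1" using v 1 by auto
          ultimately have "t = {w \<in> set zs'. E v w} \<union> (if v \<in> U1 then {} else U - U1)" using later by simp
          moreover have "{w \<in> set zs'. E v w} \<in> insert {} ?T" using v by (auto simp: traces_def)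
          ultimately show ?thesis using t by (cases "v \<in> U1") auto
        qed simp
      qed
      \<comment> \<open>There are 7 traces within the layer, 8 more (the empty one included)
        extended by \<open>U - U1\<close>, and the inserted set.\<close>
      moreover have "card (insert (U \<inter> set zs) (?T \<union> ?T')) \<le> 16"
      proof -
        have T: "card ?T \<le> 7" by (rule xs1(3)) (use 1 in simp)
        have "card ?T' \<le> card (insert {} ?T)" by (rule card_image_le) simp
        also have "\<dots> \<le> 7 + 1" by (rule card_insert_le'[OF T])
        finally have "card (?T \<union> ?T') \<le> 15" using T card_Un_le[of ?T ?T'] by linarith
        then show ?thesis using card_insert_le' by fastforce
      qed
      ultimately show ?thesis by (rule card_le_of_subset) simp
    next
      case (2 ys')
      have "insert (U \<inter> set zs) (traces E (set ys) (set zs)) - {{}} \<subseteq>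
        insert ((U - U1) \<inter> set zs) (traces E (set ys') (set zs)) - {{}}"
      proof
        fix t assume t: "t \<in> insert (U \<inter> set zs) (traces E (set ys) (set zs)) - {{}}"
        have Uz: "U \<inter> set zs = (U - U1) \<inter> set zs" using xs2(2) 2 disjoint by (auto simp: U1_def)
        show "t \<in> insert ((U - U1) \<inter> set zs) (traces E (set ys') (set zs)) - {{}}"
        proof (cases "t = U \<inter> set zs")
          case True
          then show ?thesis using t Uz by simp
        next
          case False
          then obtain v where v: "v \<in> set ys" "t = {w \<in> set zs. E v w}" using t by (auto simp: traces_def)
          show ?thesis
          proof (cases "v \<in> set xs1")
            case True
            have "t = {w \<in> set xs2. E v w} \<inter> set zs" using v 2 by auto
            then have "t = (if v \<in> U1 then {} else U - U1) \<inter> set zs" using later[OF True] by simp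
            then show ?thesis using t by (auto split: if_splits)
          next
            case False
            then have "v \<in> set ys'" using v 2 by auto
            then show ?thesis using v t by (auto simp: traces_def)
          qed
        qed
      qed
      then show ?thesis using xs2(3)[OF 2(2)] by (rule card_le_of_subset) simp
    qed
    moreover have "distinct (xs1 @ xs2)" "set (xs1 @ xs2) = U \<union> W"
      using xs1 xs2 disjoint W1 by (auto simp: U1_def)
    ultimately show ?thesis by blast
  qed
qed

lemma bipartite_lw:
  assumes "bipartite_P2P3_free E U W"
  shows "lw E (U \<union> W) 16"
proof -
  obtain xs where xs: "distinct xs" "set xs = U \<union> W" and
    card: "\<And>ys zs. xs = ys @ zs \<Longrightarrow> card (insert (U \<inter> set zs) (traces E (set ys) (set zs)) - {{}}) \<le> 16"
    using bipartite_order[OF assms] by blast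
  have "card (traces E (set ys) (set zs)) \<le> 16" if "xs = ys @ zs" for ys zs
    by (rule card_le_of_subset[OF _ card[OF that]]) (auto simp: traces_def)
  with xs show ?thesis unfolding lw_def by blast
qed

subsection \<open>Large cliques and sparse graphs\<close>

lemma card_Un3_le: "card (A \<union> B \<union> C) \<le> card A + card B + card C"
  by (meson add_le_mono1 card_Un_le le_trans)

lemma two_elements:
  assumes "2 \<le> card A" obtains x y where "x \<in> A" "y \<in> A" "x \<noteq> y"
proof -
  have "finite A" using assms by (intro card_ge_0_finite) simp
  then have "\<not> (\<forall>x\<in>A. \<forall>y\<in>A. x = y)" using assms card_le_Suc0_iff_eq[of A] by simp
  then show ?thesis using that by blast
qed

lemma card_le_1I:
  assumes "\<And>x y. x \<in> A \<Longrightarrow> y \<in> A \<Longrightarrow> x = y" shows "card A \<le> 1"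
proof (rule ccontr)
  assume "\<not> card A \<le> 1"
  then have "2 \<le> card A" by simp
  then obtain x y where "x \<in> A" "y \<in> A" "x \<noteq> y" by (rule two_elements)
  then show False using assms by blast
qed

text \<open>Distinctness is demanded only for \<open>a\<close> and \<open>b\<close>, respectively
  \<open>a\<close> and \<open>c\<close>: all other pairs of vertices are told apart by their
  adjacencies.\<close>

locale diamond_P2P3_free =
  fixes V :: "'a set" and E :: "'a \<Rightarrow> 'a \<Rightarrow> bool"
  assumes finite_V: "finite V"
    and sym: "E u v \<Longrightarrow> E v u"
    and irrefl: "\<not> E v v"
    and in_V: "E u v \<Longrightarrow> u \<in> V"
    and diamond: "E u v \<Longrightarrow> E u a \<Longrightarrow> E v a \<Longrightarrow> E u b \<Longrightarrow> E v b \<Longrightarrow> a \<noteq> b \<Longrightarrow> E a b"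
    and P2P3: "E u v \<Longrightarrow> E a b \<Longrightarrow> E b c \<Longrightarrow> a \<noteq> c \<Longrightarrow> \<not> E a c \<Longrightarrow> \<not> E u a \<Longrightarrow> \<not> E u b \<Longrightarrow> \<not> E u c \<Longrightarrow>
      \<not> E v a \<Longrightarrow> \<not> E v b \<Longrightarrow> \<not> E v c \<Longrightarrow> False"
begin

lemma finite_subset_V: "S \<subseteq> V \<Longrightarrow> finite S"
  using finite_V by (rule rev_finite_subset)

definition complete_on :: "'a set \<Rightarrow> bool" where
  "complete_on K \<longleftrightarrow> K \<subseteq> V \<and> (\<forall>u\<in>K. \<forall>v\<in>K. u \<noteq> v \<longrightarrow> E u v)"

text \<open>Every edge must meet the closed neighbourhood of any fixed induced path
  \<open>a b c\<close>, or the two together would be the forbidden graph. Deleting these three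
  closed neighbourhoods, of size at most \<open>d + 1\<close> each, leaves no edge.\<close>

lemma bounded_degree_lw:
  assumes "S \<subseteq> V" "\<And>v. v \<in> S \<Longrightarrow> card {w \<in> S. E v w} \<le> d"
  shows "lw E S (3 * d + 4)"
proof (cases "\<exists>a\<in>S. \<exists>b\<in>S. \<exists>c\<in>S. E a b \<and> E b c \<and> a \<noteq> c \<and> \<not> E a c")
  case False
  have "lw E S 1"
    by (rule lw_P3_free) (use False sym finite_subset_V[OF assms(1)] in blast)+
  then show ?thesis by (rule lw_mono) simp
next
  case True
  then obtain a b c where abc: "a \<in> S" "b \<in> S" "c \<in> S" "E a b" "E b c" "a \<noteq> c" "\<not> E a c" by blast
  define N where "N v = insert v {w \<in> S. E v w}" for v
  have fin: "finite S" using assms(1) by (rule finite_subset_V)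
  have N: "card (N v) \<le> d + 1" if "v \<in> S" for v
    unfolding N_def using assms(2)[OF that] by (rule card_insert_le')
  have "lw E S (0 + 3 * (d + 1))"
  proof (rule lw_delete)
    show "lw E (S - (N a \<union> N b \<union> N c)) 0"
    proof (rule lw_no_edges)
      show "\<not> E u v" if "u \<in> S - (N a \<union> N b \<union> N c)" "v \<in> S - (N a \<union> N b \<union> N c)" for u v
        using P2P3[of u v a b c] abc that sym by (auto simp: N_def)
    qed (use fin in simp)
    show "N a \<union> N b \<union> N c \<subseteq> S" using abc by (auto simp: N_def)
    then show "finite (N a \<union> N b \<union> N c)" using fin by (rule finite_subset)
    have "card (N a \<union> N b \<union> N c) \<le> (d + 1) + (d + 1) + (d + 1)"
      by (intro order_trans[OF card_Un3_le] add_mono N abc)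
    then show "card (N a \<union> N b \<union> N c) \<le> 3 * (d + 1)" by simp
  qed
  then show ?thesis by (rule lw_mono) simp
qed

text \<open>Two neighbours \<open>x\<close>, \<open>y\<close> of \<open>v\<close> are adjacent and
  have every other \<open>z\<close> of \<open>K\<close> as a common neighbour, so the absence of
  diamonds makes \<open>v\<close> adjacent to \<open>z\<close>; then \<open>v\<close> could be added
  to \<open>K\<close>.\<close>

lemma nbrs_in_maximum_clique:
  assumes K: "complete_on K" "\<And>K'. complete_on K' \<Longrightarrow> card K' \<le> card K"
    and "v \<in> V - K" "x \<in> K" "y \<in> K" "E v x" "E v y" "2 \<le> card K"
  shows "x = y"
proof (rule ccontr)
  assume "x \<noteq> y"
  have Kv: "E v z" if "z \<in> K" for z
  proof (cases "z = x \<or> z = y")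
    case False
    have "E x y" "E x z" "E y z" using K(1) assms(4,5) that False \<open>x \<noteq> y\<close> by (auto simp: complete_on_def)
    then have "E v z" using diamond[of x y v z] assms(3,6,7) sym that by blast
    then show ?thesis .
  qed (use assms in auto)
  have "complete_on (insert v K)"
    using K(1) Kv sym assms(3) by (auto simp: complete_on_def)
  moreover have "card (insert v K) = Suc (card K)"
    using K(1) assms(3) finite_subset_V by (auto simp: complete_on_def)
  ultimately show False using K(2) by fastforce
qed

text \<open>The rest \<open>R\<close> is a union of cliques. An edge \<open>u v\<close> of
  \<open>R\<close> now acts against paths that enter \<open>K\<close>: outside the clique
  \<open>Q\<close> of \<open>u\<close> and \<open>v\<close>, no vertex of \<open>R\<close> has a
  neighbour in \<open>K - D\<close>, where \<open>D\<close> collects the at most two neighbours of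
  \<open>u\<close> and \<open>v\<close> in \<open>K\<close>. Without \<open>D\<close>, only
  \<open>Q\<close> still interacts with the clique.\<close>

lemma large_clique_lw:
  assumes K: "complete_on K" "\<And>K'. complete_on K' \<Longrightarrow> card K' \<le> card K" and "5 \<le> card K"
  shows "lw E V 6"
proof -
  define R where "R = V - K"
  define T where "T v = {x \<in> K. E v x}" for v
  have KV: "K \<subseteq> V" and clq: "\<And>u v. u \<in> K \<Longrightarrow> v \<in> K \<Longrightarrow> u \<noteq> v \<Longrightarrow> E u v"
    using K(1) by (auto simp: complete_on_def)
  have finK: "finite K" using KV by (rule finite_subset_V)
  have uniq: "x = y" if "v \<in> R" "x \<in> K" "y \<in> K" "E v x" "E v y" for v x y
    using nbrs_in_maximum_clique[OF K, of v x y] that \<open>5 \<le> card K\<close> by (simp add: R_def)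
  have T1: "card (T v) \<le> 1" if "v \<in> R" for v
    by (rule card_le_1I) (use uniq[OF that] in \<open>auto simp: T_def\<close>)
  have finT: "finite (T v)" for v using finK by (simp add: T_def)
  have pair: "\<exists>x\<in>K. \<exists>y\<in>K. x \<noteq> y \<and> x \<notin> A \<and> y \<notin> A" if "card A \<le> 3" "finite A" for A
  proof -
    have "card K - card A \<le> card (K - A)" by (rule diff_card_le_card_Diff[OF that(2)])
    then have "2 \<le> card (K - A)" using that(1) \<open>5 \<le> card K\<close> by linarith
    then show ?thesis by (elim two_elements) blast
  qed
  have P3: "E u w" if uvw: "u \<in> R" "v \<in> R" "w \<in> R" "E u v" "E v w" "u \<noteq> w" for u v w
  proof (rule ccontr)
    assume "\<not> E u w"
    have "card (T u \<union> T v \<union> T w) \<le> 3"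
      using card_Un3_le[of "T u" "T v" "T w"] T1[OF uvw(1)] T1[OF uvw(2)] T1[OF uvw(3)] by linarith
    then obtain x y where xy: "x \<in> K" "y \<in> K" "x \<noteq> y" "x \<notin> T u \<union> T v \<union> T w" "y \<notin> T u \<union> T v \<union> T w"
      using pair finT by (metis finite_UnI)
    then show False
      using P2P3[of x y u v w] clq[of x y] uvw \<open>\<not> E u w\<close> sym by (auto simp: T_def)
  qed
  \<comment> \<open>Each vertex of \<open>Q\<close> has at most one neighbour in \<open>K'\<close>,
    so the edges between the two sets form stars. Flipping inside the two parts restores the rest,
    and \<open>b\<close> records whether \<open>Q\<close> is a clique or independent.\<close>
  have two_cliques: "lw E (K' \<union> Q) 4"
    if KQ: "K' \<subseteq> K" "Q \<subseteq> R" and Q: "(\<forall>u\<in>Q. \<forall>v\<in>Q. u \<noteq> v \<longrightarrow> E u v) \<or> (\<forall>u\<in>Q. \<forall>v\<in>Q. \<not> E u v)" for K' Q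
  proof -
    define F where "F x y \<longleftrightarrow> E x y \<and> (x \<in> K \<longleftrightarrow> y \<notin> K)" for x y
    define b where "b \<longleftrightarrow> (\<forall>u\<in>Q. \<forall>v\<in>Q. u \<noteq> v \<longrightarrow> E u v)"
    let ?p = "\<lambda>v. if v \<in> K then 0 else (1::nat)"
    have QK: "v \<notin> K" if "v \<in> Q" for v using that KQ R_def by auto
    have "lw F (Q \<union> K') 1"
    proof (rule lw_stars)
      show "w = w'" if "u \<in> Q" "w \<in> K'" "w' \<in> K'" "F u w" "F u w'" for u w w'
        using uniq[of u w w'] that KQ by (auto simp: F_def)
    qed (use KQ finK finite_V sym QK in \<open>auto simp: F_def R_def intro: finite_subset\<close>)
    then have "lw E (Q \<union> K') ((1 + 1) * 2)"
    proof (rule lw_flip[where p = ?p and \<phi> = "\<lambda>i j. i = 0 \<and> j = 0 \<or> i = 1 \<and> j = 1 \<and> b"])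
      show "E u v \<longleftrightarrow> F u v \<noteq> (?p u = 0 \<and> ?p v = 0 \<or> ?p u = 1 \<and> ?p v = 1 \<and> b)"
        if uv: "u \<in> Q \<union> K'" "v \<in> Q \<union> K'" "u \<noteq> v" for u v
      proof (cases "u \<in> K")
        case True
        then show ?thesis using clq[of u v] uv KQ by (auto simp: F_def)
      next
        case uK: False
        show ?thesis
        proof (cases "v \<in> K")
          case False
          then have "u \<in> Q" "v \<in> Q" using uK uv KQ by auto
          then have "E u v \<longleftrightarrow> b" using Q uv(3) unfolding b_def by blast
          then show ?thesis using uK False by (simp add: F_def)
        qed (use uK in \<open>simp add: F_def\<close>)
      qed
    qed auto
    then show ?thesis by (simp add: Un_commute)
  qed
  show ?thesis
  proof (cases "\<exists>u\<in>R. \<exists>v\<in>R. E u v")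
    case False
    then have "lw E (K \<union> R) 4" by (intro two_cliques) auto
    moreover have "K \<union> R = V" using KV by (auto simp: R_def)
    ultimately show ?thesis using lw_mono by force
  next
    case True
    then obtain u v where uv: "u \<in> R" "v \<in> R" "E u v" by blast
    define D where "D = T u \<union> T v"
    define Q where "Q = {w \<in> R. w = u \<or> E u w}"
    have D: "card D \<le> 2" using card_Un_le[of "T u" "T v"] T1[OF uv(1)] T1[OF uv(2)] by (simp add: D_def)
    have DK: "D \<subseteq> K" by (auto simp: D_def T_def)
    have "lw E (((K - D) \<union> Q) \<union> (R - Q)) 4"
    proof (rule lw_disjoint_union)
      show "lw E ((K - D) \<union> Q) 4"
      proof (rule two_cliques)
        show "(\<forall>x\<in>Q. \<forall>y\<in>Q. x \<noteq> y \<longrightarrow> E x y) \<or> (\<forall>x\<in>Q. \<forall>y\<in>Q. \<not> E x y)"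
        proof (intro disjI1 ballI impI)
          fix x y assume xy: "x \<in> Q" "y \<in> Q" "x \<noteq> y"
          show "E x y"
          proof (cases "x = u \<or> y = u")
            case True
            then show ?thesis using xy sym by (auto simp: Q_def)
          next
            case False
            then show ?thesis using P3[of x u y] xy sym[of u x] uv(1) by (auto simp: Q_def)
          qed
        qed
      qed (auto simp: Q_def)
      have "lw E (R - Q) 1"
        by (rule lw_P3_free) (use P3 sym finite_V in \<open>auto simp: R_def\<close>)
      then show "lw E (R - Q) 4" by (rule lw_mono) simp
      show "((K - D) \<union> Q) \<inter> (R - Q) = {}" by (auto simp: R_def)
      show "\<not> E a w" if a: "a \<in> (K - D) \<union> Q" and w: "w \<in> R - Q" for a w
      proof
        assume aw: "E a w"
        have wu: "w \<in> R" "w \<noteq> u" "\<not> E u w" using w by (auto simp: Q_def)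
        have wv: "\<not> E v w" using P3[of u v w] uv wu by auto
        show False
        proof (cases "a \<in> Q")
          case True
          then show False using P3[of u a w] wu aw uv(1) by (auto simp: Q_def)
        next
          case False
          then have aK: "a \<in> K" "\<not> E u a" "\<not> E v a" using a by (auto simp: D_def T_def)
          \<comment> \<open>A further vertex \<open>y\<close> of \<open>K\<close> outside
            \<open>D\<close> and different from \<open>a\<close> turns \<open>w a y\<close> into an
            induced path without neighbours of \<open>u\<close> and \<open>v\<close>.\<close>
          have "card (insert a D) \<le> 3" using card_insert_le'[OF D, of a] by simp
          moreover have "finite (insert a D)" using finT by (simp add: D_def)
          ultimately obtain y where y: "y \<in> K" "y \<notin> insert a D" using pair by blast
          then have "\<not> E u y" "\<not> E v y" "y \<noteq> a" by (auto simp: D_def T_def)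
          moreover have "w \<noteq> y" using wu(1) y(1) by (auto simp: R_def)
          moreover have "\<not> E w y" using uniq[of w a y] wu aK y sym[OF aw] by auto
          ultimately show False
            using P2P3[of u v w a y] uv(3) sym[OF aw] clq[of a y] aK y(1) wu wv by blast
        qed
      qed
    qed
    moreover have "((K - D) \<union> Q) \<union> (R - Q) = V - D" using KV DK by (auto simp: R_def Q_def)
    ultimately have "lw E (V - D) 4" by simp
    then have "lw E V (4 + 2)"
      by (rule lw_delete) (use D DK KV finT in \<open>auto simp: D_def\<close>)
    then show ?thesis by simp
  qed
qed

text \<open>An edge \<open>v w\<close> outside \<open>K\<close> leaves a pair of \<open>K\<close>
  without neighbours of \<open>v\<close> and \<open>w\<close>. Two neighbours of \<open>v\<close>
  that leave the same pair are adjacent, since otherwise they form with \<open>v\<close> a path that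
  this pair completes to the forbidden graph. So each pair accounts for a clique of at most four
  neighbours.\<close>

lemma clique_4_lw:
  assumes K: "complete_on K" "\<And>K'. complete_on K' \<Longrightarrow> card K' \<le> card K" and "card K = 4"
  shows "lw E V 200"
proof -
  define R where "R = V - K"
  define T where "T v = {x \<in> K. E v x}" for v
  have KV: "K \<subseteq> V" and clq: "\<And>u v. u \<in> K \<Longrightarrow> v \<in> K \<Longrightarrow> u \<noteq> v \<Longrightarrow> E u v"
    using K(1) by (auto simp: complete_on_def)
  have finK: "finite K" using KV by (rule finite_subset_V)
  have T1: "card (T v) \<le> 1" if "v \<in> R" for v
    by (rule card_le_1I) (use nbrs_in_maximum_clique[OF K, of v] that \<open>card K = 4\<close> in \<open>auto simp: T_def R_def\<close>)
  have "lw E R (3 * 64 + 4)"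
  proof (rule bounded_degree_lw)
    fix v assume v: "v \<in> R"
    let ?I = "{p \<in> K \<times> K. fst p \<noteq> snd p}"
    define M where "M p = {w \<in> R. E v w \<and> \<not> E v (fst p) \<and> \<not> E v (snd p) \<and> \<not> E w (fst p) \<and> \<not> E w (snd p)}" for p
    have finI: "finite ?I" using finK by simp
    have "{w \<in> R. E v w} \<subseteq> (\<Union>p\<in>?I. M p)"
    proof
      fix w assume w: "w \<in> {w \<in> R. E v w}"
      have "card (T v \<union> T w) \<le> 2" using card_Un_le[of "T v" "T w"] T1[OF v] T1[of w] w by simp
      moreover have "card K - card (T v \<union> T w) \<le> card (K - (T v \<union> T w))"
        using finK by (intro diff_card_le_card_Diff) (auto simp: T_def)
      ultimately have "2 \<le> card (K - (T v \<union> T w))" using \<open>card K = 4\<close> by linarith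
      then obtain x y where "x \<in> K - (T v \<union> T w)" "y \<in> K - (T v \<union> T w)" "x \<noteq> y" by (rule two_elements)
      then have "(x, y) \<in> ?I" "w \<in> M (x, y)" using w by (auto simp: M_def T_def)
      then show "w \<in> (\<Union>p\<in>?I. M p)" by blast
    qed
    moreover have finM: "finite (M p)" for p using finite_V by (simp add: M_def R_def)
    ultimately have "card {w \<in> R. E v w} \<le> card (\<Union>p\<in>?I. M p)"
      using finI by (intro card_mono) auto
    also have "\<dots> \<le> (\<Sum>p\<in>?I. card (M p))" by (rule card_UN_le[OF finI])
    also have "\<dots> \<le> (\<Sum>p\<in>?I. 4)"
    proof (rule sum_mono)
      fix p assume p: "p \<in> ?I"
      then have "E (fst p) (snd p)" using clq by auto
      then have "E w w'" if "w \<in> M p" "w' \<in> M p" "w \<noteq> w'" for w w'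
        using P2P3[of "fst p" "snd p" w v w'] that sym unfolding M_def by blast
      moreover have "M p \<subseteq> V" unfolding M_def R_def by blast
      ultimately have "complete_on (M p)" unfolding complete_on_def by blast
      then show "card (M p) \<le> 4" using K(2) \<open>card K = 4\<close> by metis
    qed
    also have "\<dots> = card ?I * 4" by simp
    \<comment> \<open>Counting all 16 ordered pairs keeps the number simple; it gives degree at most
      64, and then \<open>3 * 64 + 4 + 4 = 200\<close>.\<close>
    also have "\<dots> \<le> card (K \<times> K) * 4" using finK by (intro mult_le_mono1 card_mono) auto
    also have "\<dots> = 64" using \<open>card K = 4\<close> by (simp add: card_cartesian_product)
    finally show "card {w \<in> R. E v w} \<le> 64" .
  qed (auto simp: R_def)
  then have "lw E V (3 * 64 + 4 + 4)"
    unfolding R_def by (rule lw_delete) (use finK KV \<open>card K = 4\<close> in auto)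
  then show ?thesis by simp
qed

end

section \<open>Graphs whose edges lie in at most one triangle: no large biclique\<close>

locale K4_diamond_P2P3_free = diamond_P2P3_free +
  assumes one_triangle: "E u v \<Longrightarrow> E u a \<Longrightarrow> E v a \<Longrightarrow> E u b \<Longrightarrow> E v b \<Longrightarrow> a = b"
begin

text \<open>Neighbourhoods of nonadjacent vertices are nested up to fewer than \<open>r\<close>
  vertices. Many vertices of large degree would therefore include four with four common neighbours,
  which is a biclique.\<close>

lemma sparse_lw:
  assumes indep: "\<And>S. S \<subseteq> V \<Longrightarrow> r \<le> card S \<Longrightarrow> \<exists>I\<subseteq>S. card I = 8 \<and> (\<forall>u\<in>I. \<forall>v\<in>I. \<not> E u v)"
    and "4 \<le> r"
    and no_biclique: "\<And>X Y. card X = 4 \<Longrightarrow> 4 \<le> card Y \<Longrightarrow> \<forall>x\<in>X. \<forall>y\<in>Y. E x y \<Longrightarrow> False"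
  shows "lw E V (10 * r + 16)"
proof -
  define N where "N v = {w. E v w}" for v
  have NV: "N v \<subseteq> V" for v using in_V sym by (auto simp: N_def)
  have finN [simp]: "finite (N v)" for v using NV by (rule finite_subset_V)
  \<comment> \<open>If both differences had size \<open>r\<close>, take eight independent vertices
    \<open>I\<close> in \<open>N v' - N v\<close> and four vertices \<open>Y\<close> in
    \<open>N v - N v'\<close>. A vertex \<open>y\<close> missing \<open>e\<close> and
    \<open>e'\<close> of \<open>I\<close> gives the edge \<open>v y\<close> and the path
    \<open>e v' e'\<close>. So each \<open>y\<close> misses at most one, and at least 8 - 4 vertices
    of \<open>I\<close> are complete to \<open>Y\<close>.\<close>
  have small: "card (N v - N v') < r" if vv: "\<not> E v v'" "card (N v) \<le> card (N v')" for v v'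
  proof (rule ccontr)
    assume "\<not> card (N v - N v') < r"
    then have *: "r \<le> card (N v - N v')" by simp
    have "card (N v) - card (N v \<inter> N v') \<le> card (N v') - card (N v' \<inter> N v)"
      using vv(2) by (simp add: Int_commute)
    then have "card (N v - N v') \<le> card (N v' - N v)" by (simp add: card_Diff_subset_Int)
    with * have "r \<le> card (N v' - N v)" by simp
    with indep[of "N v' - N v"] NV obtain I where
      I: "I \<subseteq> N v' - N v" "card I = 8" "\<forall>u\<in>I. \<forall>v\<in>I. \<not> E u v" by (meson Diff_subset subset_trans)
    from * \<open>4 \<le> r\<close> obtain Y where Y: "Y \<subseteq> N v - N v'" "card Y = 4"
      by (meson le_trans obtain_subset_with_card_n)
    have finY: "finite Y" using Y(1) finN by (meson finite_Diff finite_subset)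
    have finI: "finite I" using I(1) finN by (meson finite_Diff finite_subset)
    define M where "M y = {e \<in> I. \<not> E y e}" for y
    have "card (M y) \<le> 1" if "y \<in> Y" for y
    proof (rule card_le_1I)
      fix e e' assume e: "e \<in> M y" "e' \<in> M y"
      have y: "E v y" "\<not> E y v'" using that Y sym by (auto simp: N_def)
      have "E e v'" "E v' e'" "\<not> E v e" "\<not> E v e'" "\<not> E e e'" "\<not> E y e" "\<not> E y e'"
        using e I sym by (auto simp: M_def N_def)
      then show "e = e'" using P2P3[of v y e v' e'] y vv(1) by blast
    qed
    then have "(\<Sum>y\<in>Y. card (M y)) \<le> 4" using sum_bounded_above[of Y "\<lambda>y. card (M y)" 1] Y(2) by simp
    then have "card (\<Union>y\<in>Y. M y) \<le> 4" using card_UN_le[OF finY, of M] by linarith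
    moreover have "card I - card (\<Union>y\<in>Y. M y) \<le> card (I - (\<Union>y\<in>Y. M y))"
      using finY finI by (intro diff_card_le_card_Diff) (auto simp: M_def)
    ultimately have "4 \<le> card (I - (\<Union>y\<in>Y. M y))" using I(2) by linarith
    then show False using no_biclique[OF Y(2)] by (auto simp: M_def)
  qed
  \<comment> \<open>The threshold \<open>3 * r + 4\<close> is chosen for four independent vertices
    of \<open>H\<close>: each of three misses at most \<open>r\<close> neighbours of the one of
    least degree, and four common neighbours remain.\<close>
  define H where "H = {v \<in> V. 3 * r + 4 \<le> card (N v)}"
  have "card H < r"
  proof (rule ccontr)
    assume "\<not> card H < r"
    then obtain I where I: "I \<subseteq> H" "card I = 8" "\<forall>u\<in>I. \<forall>v\<in>I. \<not> E u v"
      using indep[of H] by (auto simp: H_def)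
    have "4 \<le> card I" using I(2) by simp
    then obtain X where X: "X \<subseteq> I" "card X = 4" "finite X"
      by (rule obtain_subset_with_card_n)
    have finX: "finite X" "X \<noteq> {}" using X by auto
    obtain v where v: "v \<in> X" "\<And>w. w \<in> X \<Longrightarrow> card (N v) \<le> card (N w)"
    proof
      show "arg_min_on (\<lambda>v. card (N v)) X \<in> X" using finX by (rule arg_min_if_finite(1))
      show "card (N (arg_min_on (\<lambda>v. card (N v)) X)) \<le> card (N w)" if "w \<in> X" for w
        using finX that by (rule arg_min_least)
    qed
    have "card (N v - N w) \<le> r" if "w \<in> X - {v}" for w
    proof -
      have "\<not> E v w" using I(3) X(1) v(1) that by blast
      then show ?thesis using small[of v w] v(2)[of w] that by simp
    qed
    then have "(\<Sum>w\<in>X - {v}. card (N v - N w)) \<le> of_nat (card (X - {v})) * r"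
      by (rule sum_bounded_above)
    also have "card (X - {v}) = 3" using v(1) X(2) finX by simp
    finally have "(\<Sum>w\<in>X - {v}. card (N v - N w)) \<le> 3 * r" by simp
    then have le: "card (\<Union>w\<in>X - {v}. N v - N w) \<le> 3 * r"
      using card_UN_le[of "X - {v}" "\<lambda>w. N v - N w"] finX by simp
    have "card (N v) - card (\<Union>w\<in>X - {v}. N v - N w) \<le> card (N v - (\<Union>w\<in>X - {v}. N v - N w))"
      using finX by (intro diff_card_le_card_Diff) auto
    moreover have "3 * r + 4 \<le> card (N v)" using v(1) X I by (auto simp: H_def)
    ultimately have "4 \<le> card (N v - (\<Union>w\<in>X - {v}. N v - N w))" using le by linarith
    then show False using no_biclique[OF X(2)] by (auto simp: N_def)
  qed
  have "lw E (V - H) (3 * (3 * r + 4) + 4)"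
  proof (rule bounded_degree_lw)
    fix v assume v: "v \<in> V - H"
    have "card {w \<in> V - H. E v w} \<le> card (N v)" by (rule card_mono[OF finN]) (auto simp: N_def)
    then show "card {w \<in> V - H. E v w} \<le> 3 * r + 4" using v by (auto simp: H_def)
  qed auto
  then have "lw E V (3 * (3 * r + 4) + 4 + r)"
    by (rule lw_delete) (use \<open>card H < r\<close> finite_V in \<open>auto simp: H_def\<close>)
  then show ?thesis by (rule lw_mono) simp
qed

end

subsection \<open>Graphs with a biclique\<close>

context K4_diamond_P2P3_free
begin

text \<open>Four is chosen so that two outsiders with at most one neighbour each on a side leave two
  vertices of that side, the ends of a path whose middle is on the other side.\<close>

definition biclique :: "'a set \<Rightarrow> 'a set \<Rightarrow> bool" where
  "biclique X Y \<longleftrightarrow> 4 \<le> card X \<and> 4 \<le> card Y \<and> (\<forall>x\<in>X. \<forall>y\<in>Y. E x y)"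

text \<open>For a biclique on \<open>X\<close> and \<open>Y\<close> this enlarges \<open>Y\<close>:
  a vertex with two neighbours in \<open>X\<close> behaves like a vertex of
  \<open>Y\<close>.\<close>

definition rich :: "'a set \<Rightarrow> 'a set" where
  "rich X = {z. \<exists>x\<in>X. \<exists>x'\<in>X. x \<noteq> x' \<and> E z x \<and> E z x'}"

definition C5_free :: bool where
  "C5_free \<longleftrightarrow> \<not> (\<exists>a b c d e. E a b \<and> E b c \<and> E c d \<and> E d e \<and> E e a \<and>
     \<not> E a c \<and> \<not> E b d \<and> \<not> E c e \<and> \<not> E d a \<and> \<not> E e b)"

lemma C5_freeD:
  "C5_free \<Longrightarrow> E a b \<Longrightarrow> E b c \<Longrightarrow> E c d \<Longrightarrow> E d e \<Longrightarrow> E e a \<Longrightarrow>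
     \<not> E a c \<Longrightarrow> \<not> E b d \<Longrightarrow> \<not> E c e \<Longrightarrow> \<not> E d a \<Longrightarrow> \<not> E e b \<Longrightarrow> False"
  unfolding C5_free_def by blast

lemma biclique_sym: "biclique X Y \<Longrightarrow> biclique Y X"
  using sym by (auto simp: biclique_def)

lemma biclique_edge: "biclique X Y \<Longrightarrow> x \<in> X \<Longrightarrow> y \<in> Y \<Longrightarrow> E x y"
  by (simp add: biclique_def)

lemma biclique_two:
  assumes "biclique X Y" obtains x x' where "x \<in> X" "x' \<in> X" "x \<noteq> x'"
  using assms two_elements[of X] by (auto simp: biclique_def)

lemma biclique_independent:
  assumes "biclique X Y" "x \<in> X" "x' \<in> X" shows "\<not> E x x'"
proof
  assume "E x x'"
  obtain y y' where "y \<in> Y" "y' \<in> Y" "y \<noteq> y'" using biclique_two[OF biclique_sym[OF assms(1)]] .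
  then show False using one_triangle[of x x' y y'] \<open>E x x'\<close> biclique_edge[OF assms(1)] assms(2,3) by blast
qed

lemma biclique_rich:
  assumes "biclique X Y" shows "Y \<subseteq> rich X"
proof
  fix y assume "y \<in> Y"
  obtain x x' where "x \<in> X" "x' \<in> X" "x \<noteq> x'" using biclique_two[OF assms] .
  then show "y \<in> rich X"
    using biclique_edge[OF biclique_sym[OF assms]] \<open>y \<in> Y\<close> unfolding rich_def by blast
qed

lemma rich_nonadjacent:
  assumes "biclique X Y" "z \<in> rich X" "y \<in> Y" shows "\<not> E z y"
proof
  assume "E z y"
  obtain x x' where "x \<in> X" "x' \<in> X" "x \<noteq> x'" "E z x" "E z x'" using assms(2) by (auto simp: rich_def)
  then show False using one_triangle[of z y x x'] \<open>E z y\<close> biclique_edge[OF biclique_sym[OF assms(1)] assms(3)] by blast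
qed

text \<open>Adjacent \<open>u\<close> and \<open>v\<close> share at most one neighbour, so each has
  a private one in \<open>X\<close>, say \<open>x\<close> and \<open>x'\<close>. Any
  \<open>y\<close> in \<open>Y\<close> then closes the induced five-cycle
  \<open>u x y x' v\<close>.\<close>

lemma rich_independent:
  assumes "C5_free" "biclique X Y" "u \<in> rich X" "v \<in> rich X" shows "\<not> E u v"
proof
  assume uv: "E u v"
  have priv: "\<exists>x\<in>X. E u x \<and> \<not> E v x" if "E u v" "u \<in> rich X" for u v
    using that one_triangle[of u v] unfolding rich_def by blast
  obtain x x' where x: "x \<in> X" "E u x" "\<not> E v x" and x': "x' \<in> X" "E v x'" "\<not> E u x'"
    using priv[OF uv assms(3)] priv[OF sym[OF uv] assms(4)] by blast
  obtain y where y: "y \<in> Y" using biclique_two[OF biclique_sym[OF assms(2)]] by blast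
  show False
    using C5_freeD[OF assms(1), of u x y x' v] uv x x' y rich_nonadjacent[OF assms(2)] assms(3,4)
      biclique_edge[OF assms(2)] biclique_independent[OF assms(2)] sym by metis
qed

lemma rich_disjoint: "biclique X Y \<Longrightarrow> rich X \<inter> rich Y = {}"
  using rich_nonadjacent unfolding rich_def by blast

text \<open>The ends of an edge \<open>u v\<close> have at most one neighbour each in
  \<open>X\<close> and in \<open>Y\<close>, so some path \<open>x y x'\<close> of the biclique
  avoids all of these.\<close>

lemma poor_independent:
  assumes XY: "biclique X Y" and "u \<notin> rich X \<union> rich Y" "v \<notin> rich X \<union> rich Y" shows "\<not> E u v"
proof
  assume uv: "E u v"
  have le1: "card {x \<in> X. E z x} \<le> 1" if "z \<notin> rich X" for z X
    by (rule card_le_1I) (use that in \<open>auto simp: rich_def\<close>)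
  have pair: "\<exists>x\<in>X. \<exists>x'\<in>X. x \<noteq> x' \<and> \<not> E u x \<and> \<not> E v x \<and> \<not> E u x' \<and> \<not> E v x'"
    if "u \<notin> rich X" "v \<notin> rich X" "4 \<le> card X" for X
  proof -
    let ?B = "{x \<in> X. E u x} \<union> {x \<in> X. E v x}"
    have "finite X" using that(3) by (intro card_ge_0_finite) simp
    then have "card X - card ?B \<le> card (X - ?B)" by (intro diff_card_le_card_Diff) auto
    moreover have "card ?B \<le> 2"
      using card_Un_le[of "{x \<in> X. E u x}" "{x \<in> X. E v x}"] le1[OF that(1)] le1[OF that(2)] by linarith
    ultimately have "2 \<le> card (X - ?B)" using that(3) by linarith
    then show ?thesis by (elim two_elements) auto
  qed
  obtain x x' where x: "x \<in> X" "x' \<in> X" "x \<noteq> x'" "\<not> E u x" "\<not> E v x" "\<not> E u x'" "\<not> E v x'"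
    using pair[of X] assms by (auto simp: biclique_def)
  obtain y where y: "y \<in> Y" "\<not> E u y" "\<not> E v y"
    using pair[of Y] assms by (auto simp: biclique_def)
  show False
    using P2P3[of u v x y x'] uv x y biclique_edge[OF XY] biclique_independent[OF XY] sym by blast
qed

text \<open>Otherwise \<open>u\<close> and \<open>w\<close> reach the biclique at vertices
  \<open>x\<close> and \<open>y\<close> that \<open>l\<close> does not see, and
  \<open>l u x y w\<close> is an induced five-cycle.\<close>

lemma poor_common_neighbours:
  assumes "C5_free" and XY: "biclique X Y" and "l \<notin> rich X" "l \<notin> rich Y" "u \<in> rich X" "w \<in> rich Y" "E l u" "E l w"
  shows "E u w"
proof (rule ccontr)
  assume "\<not> E u w"
  obtain x where x: "x \<in> X" "E u x" "\<not> E l x" using assms(3,5) unfolding rich_def by blast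
  obtain y where y: "y \<in> Y" "E w y" "\<not> E l y" using assms(4,6) unfolding rich_def by blast
  have "\<not> E u y" "\<not> E x w"
    using rich_nonadjacent[OF XY assms(5)] rich_nonadjacent[OF biclique_sym[OF XY] assms(6)] x y sym by blast+
  then show False
    using C5_freeD[OF assms(1), of l u x y w] assms(7,8) x y biclique_edge[OF XY] \<open>\<not> E u w\<close> sym by blast
qed

text \<open>Here \<open>L\<close> is the independent set of vertices outside the bipartite graph on \<open>U\<close> and \<open>W\<close>; those of its vertices with neighbours on both sides hang on a single edge \<open>u w\<close>.\<close>

lemma hosts_complete_and_twins:
  assumes indep: "\<And>u v. u \<in> U \<Longrightarrow> v \<in> U \<Longrightarrow> \<not> E u v" "\<And>u v. u \<in> W \<Longrightarrow> v \<in> W \<Longrightarrow> \<not> E u v"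
      "\<And>u v. u \<in> L \<Longrightarrow> v \<in> L \<Longrightarrow> \<not> E u v"
    and common: "\<And>l u w. l \<in> L \<Longrightarrow> u \<in> U \<Longrightarrow> w \<in> W \<Longrightarrow> E l u \<Longrightarrow> E l w \<Longrightarrow> E u w"
    and deg: "\<And>w. w \<in> W \<Longrightarrow> \<exists>u\<in>U. \<exists>v\<in>U. u \<noteq> v \<and> E w u \<and> E w v"
    and l: "l \<in> L" "u \<in> U" "w \<in> W" "E l u" "E l w"
    and l': "l' \<in> L" "u' \<in> U" "w' \<in> W" "E l' u'" "E l' w'"
  shows "E u w'" and "\<And>z. z \<in> W \<union> L \<Longrightarrow> z \<noteq> l \<Longrightarrow> E u z \<Longrightarrow> z = l' \<or> E u' z"
    and "u \<noteq> u' \<Longrightarrow> l'' \<in> L \<Longrightarrow> w'' \<in> W \<Longrightarrow> E l'' u \<Longrightarrow> E l'' w'' \<Longrightarrow> l'' = l"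
proof -
  \<comment> \<open>By \<open>common\<close>, neighbours of \<open>m\<close> in \<open>U\<close> are
    adjacent to \<open>x\<close>; two of them would put the edge \<open>m x\<close> into two
    triangles.\<close>
  have uniqU: "v = v'" if "m \<in> L" "v \<in> U" "v' \<in> U" "x \<in> W" "E m v" "E m v'" "E m x" for m v v' x
    using one_triangle[of m x v v'] common that sym by blast
  have uniqW: "v = v'" if "m \<in> L" "v \<in> W" "v' \<in> W" "x \<in> U" "E m v" "E m v'" "E m x" for m v v' x
    using one_triangle[of m x v v'] common that by blast
  have complete: "E u w'"
    if l: "l \<in> L" "u \<in> U" "w \<in> W" "E l u" "E l w"
    and l': "l' \<in> L" "u' \<in> U" "w' \<in> W" "E l' u'" "E l' w'" for l u w l' u' w'
  proof (rule ccontr)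
    assume n: "\<not> E u w'"
    have ne: "u \<noteq> u'" "w \<noteq> w'" using n common l l' by blast+
    \<comment> \<open>A second neighbour of \<open>w'\<close> yields the path
      \<open>l' w' u''\<close>, which together with the edge \<open>l u\<close> would be the
      forbidden graph.\<close>
    obtain u'' where u'': "u'' \<in> U" "u'' \<noteq> u'" "E w' u''" using deg[OF l'(3)] by metis
    have "\<not> E l' u''" using uniqU[of l' u' u'' w'] l' u'' by blast
    moreover have "\<not> E l w'" using uniqW[of l w w' u] l l' ne by blast
    moreover have "\<not> E l u''" using uniqU[of l u u'' w] l u'' n sym by blast
    moreover have "\<not> E u l'" using uniqU[of l' u' u w'] l l' ne sym by blast
    moreover have "l' \<noteq> u''" using l' u'' indep(1) by blast
    ultimately show False
      using P2P3[of l u l' w' u''] l l' u'' n indep(1)[of u u''] indep(3)[of l l'] by blast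
  qed
  show "E u w'" using complete[OF l l'] .
  \<comment> \<open>This claim and the next one play the edge \<open>l' u'\<close> against a path
    that starts with \<open>l u\<close> and ends in \<open>z\<close> or in
    \<open>l''\<close>.\<close>
  show "z = l' \<or> E u' z" if z: "z \<in> W \<union> L" "z \<noteq> l" "E u z" for z
  proof (rule ccontr)
    assume n: "\<not> (z = l' \<or> E u' z)"
    then have ne: "u \<noteq> u'" using z by blast
    have "\<not> E l z" using uniqW[of l w z u] complete[OF l' l] n indep(3) l z by blast
    moreover have "\<not> E l' z" using uniqW[of l' w' z u'] common[of l' u' w'] n indep(3) l' z by blast
    moreover have "\<not> E l' u" using uniqU[of l' u' u w'] l l' ne by blast
    moreover have "\<not> E u' l" using uniqU[of l u u' w] l l' ne sym by blast
    ultimately show False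
      using P2P3[of l' u' l u z] l l' z n indep by blast
  qed
  show "l'' = l" if "u \<noteq> u'" "l'' \<in> L" "w'' \<in> W" "E l'' u" "E l'' w''"
  proof (rule ccontr)
    assume "l'' \<noteq> l"
    have "\<not> E l' u" using uniqU[of l' u' u w'] l l' \<open>u \<noteq> u'\<close> by blast
    moreover have "\<not> E u' l" using uniqU[of l u u' w] l l' \<open>u \<noteq> u'\<close> sym by blast
    moreover have "\<not> E u' l''" using uniqU[of l'' u u' w''] l(2) l'(2) that sym by blast
    ultimately show False
      using P2P3[of l' u' l u l''] l l' \<open>l'' \<in> L\<close> \<open>E l'' u\<close> \<open>l'' \<noteq> l\<close> sym indep by blast
  qed
qed

lemma biclique_lw:
  assumes "C5_free" and XY: "biclique X Y"
  shows "lw E V 37"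
proof -
  define U where "U = rich X"
  define W where "W = rich Y"
  define L where "L = V - U - W"
  \<comment> \<open>\<open>L0\<close> can join the side of \<open>W\<close> and \<open>L1\<close>
    the side of \<open>U\<close>. Vertices of \<open>L\<close> without neighbours on either side are
    assigned to \<open>L0\<close>; only \<open>L2\<close> has neighbours on both sides.\<close>
  define L0 where "L0 = {l \<in> L. \<forall>w\<in>W. \<not> E l w}"
  define L1 where "L1 = {l \<in> L. \<forall>u\<in>U. \<not> E l u} - L0"
  define L2 where "L2 = L - L0 - L1"
  define Uh where "Uh = {u \<in> U. \<exists>l\<in>L2. E l u}"
  define Wh where "Wh = {w \<in> W. \<exists>l\<in>L2. E l w}"
  note YX = biclique_sym[OF XY]
  have UV: "U \<subseteq> V" and WV: "W \<subseteq> V" unfolding U_def W_def rich_def using in_V by blast+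
  have indU: "\<not> E u v" if "u \<in> U" "v \<in> U" for u v
    using rich_independent[OF \<open>C5_free\<close> XY] that by (simp add: U_def)
  have indW: "\<not> E u v" if "u \<in> W" "v \<in> W" for u v
    using rich_independent[OF \<open>C5_free\<close> YX] that by (simp add: W_def)
  have indL: "\<not> E u v" if "u \<in> L" "v \<in> L" for u v
    using poor_independent[OF XY] that by (simp add: L_def U_def W_def)
  have UW: "U \<inter> W = {}" using rich_disjoint[OF XY] by (simp add: U_def W_def)
  have common: "E u w" if "l \<in> L" "u \<in> U" "w \<in> W" "E l u" "E l w" for l u w
    using poor_common_neighbours[OF \<open>C5_free\<close> XY, of l u w] that by (simp add: L_def U_def W_def)
  have common': "E w u" if "l \<in> L" "w \<in> W" "u \<in> U" "E l w" "E l u" for l u w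
    using common that sym by blast
  have degU: "\<exists>w\<in>W. \<exists>x\<in>W. w \<noteq> x \<and> E u w \<and> E u x" if "u \<in> U" for u
    using that biclique_rich[OF YX] unfolding U_def W_def rich_def by blast
  have degW: "\<exists>u\<in>U. \<exists>v\<in>U. u \<noteq> v \<and> E w u \<and> E w v" if "w \<in> W" for w
    using that biclique_rich[OF XY] unfolding U_def W_def rich_def by blast
  have hosts: "\<exists>u\<in>U. \<exists>w\<in>W. E l u \<and> E l w" if "l \<in> L2" for l
    using that by (auto simp: L2_def L1_def L0_def)
  have L2L: "L2 \<subseteq> L" by (auto simp: L2_def)
  have uniqU: "u = v" if l: "l \<in> L2" "u \<in> U" "v \<in> U" "E l u" "E l v" for l u v
  proof -
    obtain w where "w \<in> W" "E l w" using hosts[OF l(1)] by blast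
    then show ?thesis using one_triangle[of l w u v] common l L2L sym by blast
  qed
  have uniqW: "w = x" if l: "l \<in> L2" "w \<in> W" "x \<in> W" "E l w" "E l x" for l w x
  proof -
    obtain u where "u \<in> U" "E l u" using hosts[OF l(1)] by blast
    then show ?thesis using one_triangle[of l u w x] common l L2L by blast
  qed
  note indeps = indU indW indL common degW
  note indeps' = indW indU indL common' degU
  have host_pair: "E u w'" "\<And>z. z \<in> W \<union> L \<Longrightarrow> z \<noteq> l \<Longrightarrow> E u z \<Longrightarrow> z = l' \<or> E u' z"
    "\<And>z. z \<in> U \<union> L \<Longrightarrow> z \<noteq> l \<Longrightarrow> E w z \<Longrightarrow> z = l' \<or> E w' z"
    "\<And>l''. u \<noteq> u' \<Longrightarrow> l'' \<in> L2 \<Longrightarrow> E l'' u \<Longrightarrow> l'' = l"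
    "\<And>l''. w \<noteq> w' \<Longrightarrow> l'' \<in> L2 \<Longrightarrow> E l'' w \<Longrightarrow> l'' = l"
    if l: "l \<in> L2" "u \<in> U" "w \<in> W" "E l u" "E l w"
    and l': "l' \<in> L2" "u' \<in> U" "w' \<in> W" "E l' u'" "E l' w'" for l u w l' u' w'
  proof -
    have lL: "l \<in> L" "l' \<in> L" using l l' L2L by auto
    show "E u w'"
      by (rule hosts_complete_and_twins(1)[where U = U and W = W and L = L and l = l and w = w and l' = l' and u' = u'])
        (fact indeps lL l l')+
    show "z = l' \<or> E u' z" if "z \<in> W \<union> L" "z \<noteq> l" "E u z" for z
      by (rule hosts_complete_and_twins(2)[where U = U and W = W and L = L and l = l and w = w and l' = l' and u' = u' and u = u and w' = w'])
        (fact indeps lL l l' that)+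
    show "z = l' \<or> E w' z" if "z \<in> U \<union> L" "z \<noteq> l" "E w z" for z
      by (rule hosts_complete_and_twins(2)[where U = W and W = U and L = L and l = l and w = u and l' = l' and u' = w' and u = w and w' = u'])
        (fact indeps' lL l l' that)+
    show "l'' = l" if l'': "u \<noteq> u'" "l'' \<in> L2" "E l'' u" for l''
    proof -
      obtain w'' where w'': "w'' \<in> W" "E l'' w''" using hosts[OF l''(2)] by blast
      have "l'' \<in> L" using l'' L2L by blast
      show ?thesis
        by (rule hosts_complete_and_twins(3)[where U = U and W = W and L = L and l = l and w = w and l' = l' and u' = u' and u = u and w' = w' and w'' = w''])
          (fact indeps lL l l' l'' w'' \<open>l'' \<in> L\<close>)+
    qed
    show "l'' = l" if l'': "w \<noteq> w'" "l'' \<in> L2" "E l'' w" for l''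
    proof -
      obtain u'' where w'': "u'' \<in> U" "E l'' u''" using hosts[OF l''(2)] by blast
      have "l'' \<in> L" using l'' L2L by blast
      show ?thesis
        by (rule hosts_complete_and_twins(3)[where U = W and W = U and L = L and l = l and w = u and l' = l' and u' = w' and u = w and w' = u' and w'' = u''])
          (fact indeps' lL l l' l'' w'' \<open>l'' \<in> L\<close>)+
    qed
  qed
  have complete: "E u w" if prem: "u \<in> Uh" "w \<in> Wh" for u w
  proof -
    obtain l where l: "l \<in> L2" "E l u" using prem by (auto simp: Uh_def)
    obtain l' where l': "l' \<in> L2" "E l' w" using prem by (auto simp: Wh_def)
    show ?thesis
      using host_pair(1)[of l u _ l' _ w] hosts[OF l(1)] hosts[OF l'(1)] l l' prem unfolding Uh_def Wh_def by blast
  qed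
  have twinU: "E u' z" if prem: "u \<in> Uh" "u' \<in> Uh" "z \<in> (W \<union> L) - L2" "E u z" for u u' z
  proof -
    obtain l where l: "l \<in> L2" "E l u" using prem by (auto simp: Uh_def)
    obtain l' where l': "l' \<in> L2" "E l' u'" using prem by (auto simp: Uh_def)
    show ?thesis
      using host_pair(2)[of l u _ l' u' _ z] hosts[OF l(1)] hosts[OF l'(1)] l l' prem unfolding Uh_def by blast
  qed
  have twinW: "E w' z" if prem: "w \<in> Wh" "w' \<in> Wh" "z \<in> (U \<union> L) - L2" "E w z" for w w' z
  proof -
    obtain l where l: "l \<in> L2" "E l w" using prem by (auto simp: Wh_def)
    obtain l' where l': "l' \<in> L2" "E l' w'" using prem by (auto simp: Wh_def)
    show ?thesis
      using host_pair(3)[of l _ w l' _ w' z] hosts[OF l(1)] hosts[OF l'(1)] l l' prem unfolding Wh_def by blast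
  qed
  have sub: "Uh \<subseteq> U" "Wh \<subseteq> W" by (auto simp: Uh_def Wh_def)
  have disj: "L2 \<inter> U = {}" "L2 \<inter> W = {}" by (auto simp: L2_def L_def)
  have finUW: "finite U" "finite W" "finite L" using finite_subset_V UV WV finite_V by (auto simp: L_def)
  have fin: "finite Uh" "finite Wh" "finite L2"
    using finite_subset[OF sub(1) finUW(1)] finite_subset[OF sub(2) finUW(2)] finite_subset[OF L2L finUW(3)] by auto
  have S: "lw E (Uh \<union> Wh \<union> L2) 6"
  proof (cases "\<exists>u v. Uh \<subseteq> {u} \<or> Wh \<subseteq> {v}")
    \<comment> \<open>If one side has at most one host, the other side and \<open>L2\<close> form
      stars, and the single host is put in front.\<close>
    case True
    have 1: "lw E (L2 \<union> Wh) 1"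
    proof (rule lw_stars)
      show "w = x" if "l \<in> L2" "w \<in> Wh" "x \<in> Wh" "E l w" "E l x" for l w x
        using uniqW[of l w x] that sub by blast
    qed (use fin sub disj indW indL L2L sym in blast)+
    have 2: "lw E (L2 \<union> Uh) 1"
    proof (rule lw_stars)
      show "w = x" if "l \<in> L2" "w \<in> Uh" "x \<in> Uh" "E l w" "E l x" for l w x
        using uniqU[of l w x] that sub by blast
    qed (use fin sub disj indU indL L2L sym in blast)+
    have del: "lw E (A \<union> B) 6" if "lw E A 1" "B \<subseteq> {x}" for A B x
    proof (cases "B = {}")
      case False
      then have "A \<union> B = insert x A" using that(2) by auto
      then show ?thesis using lw_mono[OF lw_insert[OF that(1), of x]] by simp
    qed (use that lw_mono in fastforce)
    obtain u v where "Uh \<subseteq> {u} \<or> Wh \<subseteq> {v}" using True by blast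
    then have "lw E ((L2 \<union> Wh) \<union> Uh) 6 \<or> lw E ((L2 \<union> Uh) \<union> Wh) 6" using del[OF 1] del[OF 2] by blast
    then show ?thesis by (simp add: Un_ac)
  next
    case False
    \<comment> \<open>With two hosts on each side, no host belongs to two vertices of
      \<open>L2\<close>. Flipping between \<open>Uh\<close> and \<open>Wh\<close>, which are
      complete to each other, then leaves stars centred in \<open>L2\<close>.\<close>
    have otherU: "\<exists>u'\<in>Uh. u' \<noteq> u" and otherW: "\<exists>w'\<in>Wh. w' \<noteq> u" for u using False by blast+
    have oneU: "l = l'" if prem: "u \<in> Uh" "l \<in> L2" "l' \<in> L2" "E l u" "E l' u" for u l l'
    proof -
      obtain u' m where u': "u' \<in> U" "u' \<noteq> u" "m \<in> L2" "E m u'" using otherU[of u] by (auto simp: Uh_def)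
      obtain w where w: "w \<in> W" "E l w" using hosts prem(2) by blast
      obtain w' where w': "w' \<in> W" "E m w'" using hosts u'(3) by blast
      show ?thesis using host_pair(4)[of l u w m u' w' l'] prem u' w w' sub by blast
    qed
    have oneW: "l = l'" if prem: "w \<in> Wh" "l \<in> L2" "l' \<in> L2" "E l w" "E l' w" for w l l'
    proof -
      obtain w' m where w': "w' \<in> W" "w' \<noteq> w" "m \<in> L2" "E m w'" using otherW[of w] by (auto simp: Wh_def)
      obtain u where u: "u \<in> U" "E l u" using hosts prem(2) by blast
      obtain u' where u': "u' \<in> U" "E m u'" using hosts w'(3) by blast
      show ?thesis using host_pair(5)[of l u w m u' w' l'] prem u' u w' sub by blast
    qed
    define F where "F x y \<longleftrightarrow> E x y \<and> (x \<in> L2 \<or> y \<in> L2)" for x y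
    let ?p = "\<lambda>v. if v \<in> Uh then 0 else if v \<in> Wh then 1 else (2::nat)"
    have "lw F ((Uh \<union> Wh) \<union> L2) 1"
    proof (rule lw_stars)
      show "l = l'" if "u \<in> Uh \<union> Wh" "l \<in> L2" "l' \<in> L2" "F u l" "F u l'" for u l l'
        using oneU[of u l l'] oneW[of u l l'] that sym by (auto simp: F_def)
      show "\<not> F x y" if "x \<in> Uh \<union> Wh" "y \<in> Uh \<union> Wh" for x y
        using that sub disj by (auto simp: F_def)
      show "\<not> F x y" if "x \<in> L2" "y \<in> L2" for x y
        using that indL L2L by (auto simp: F_def)
      show "F x y \<Longrightarrow> F y x" for x y using sym by (auto simp: F_def)
    qed (use fin sub disj in auto)
    then have "lw E ((Uh \<union> Wh) \<union> L2) ((1 + 1) * 3)"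
    proof (rule lw_flip[where p = ?p and \<phi> = "\<lambda>i j. i = 0 \<and> j = 1 \<or> i = 1 \<and> j = 0"])
      show "E x y \<longleftrightarrow> F x y \<noteq> (?p x = 0 \<and> ?p y = 1 \<or> ?p x = 1 \<and> ?p y = 0)"
        if x: "x \<in> (Uh \<union> Wh) \<union> L2" and y: "y \<in> (Uh \<union> Wh) \<union> L2" for x y
      proof -
        have d: "Uh \<inter> Wh = {}" "Uh \<inter> L2 = {}" "Wh \<inter> L2 = {}" using sub disj UW by auto
        consider "x \<in> L2 \<or> y \<in> L2" | "x \<in> Uh" "y \<in> Uh" | "x \<in> Wh" "y \<in> Wh"
          | "x \<in> Uh" "y \<in> Wh" | "x \<in> Wh" "y \<in> Uh" using x y by blast
        then show ?thesis
        proof cases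
          case 1
          then show ?thesis using d by (auto simp: F_def)
        next
          case 2
          then show ?thesis using indU sub d by (auto simp: F_def)
        next
          case 3
          then have "\<not> E x y" using indW sub by blast
          then show ?thesis using 3 d by (auto simp: F_def)
        next
          case 4
          then have "E x y" using complete by blast
          then show ?thesis using 4 d by (auto simp: F_def)
        next
          case 5
          then have "E x y" using complete sym by blast
          then show ?thesis using 5 d by (auto simp: F_def)
        qed
      qed
    qed auto
    then show ?thesis by simp
  qed
  define U' where "U' = (U - Uh) \<union> L1"
  define W' where "W' = (W - Wh) \<union> L0"
  have "bipartite_P2P3_free E U' W'"
  proof
    show "finite U'" "finite W'" using finUW by (auto simp: U'_def W'_def L0_def L1_def)
    show "U' \<inter> W' = {}" using UW by (auto simp: U'_def W'_def L0_def L1_def L_def)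
    show iU: "\<not> E u v" if "u \<in> U'" "v \<in> U'" for u v
      using that indU indL sym unfolding U'_def L1_def by blast
    show iW: "\<not> E u v" if "u \<in> W'" "v \<in> W'" for u v
      using that indW indL sym unfolding W'_def L0_def by blast
    show False if "u \<in> U'" "v \<in> U'" "w \<in> W'" "x \<in> W'" "y \<in> W'" "x \<noteq> y"
      "E u w" "\<not> E v w" "E v x" "E v y" "\<not> E u x" "\<not> E u y" for u v w x y
      using P2P3[of u w x v y] that iU iW sym by blast
  qed (rule sym)
  then have rest: "lw E (U' \<union> W') 16" by (rule bipartite_lw)
  \<comment> \<open>Hosts of one side agree on the remainder and \<open>L2\<close> sees nothing of
    it, so only two traces cross over.\<close>
  have "lw E ((Uh \<union> Wh \<union> L2) \<union> (U' \<union> W')) ((6 + 1) * (2 + 1) + 16)"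
  proof (rule lw_append[OF S rest])
    show "(Uh \<union> Wh \<union> L2) \<inter> (U' \<union> W') = {}"
      using sub UW by (auto simp: U'_def W'_def L0_def L1_def L2_def L_def)
    let ?B = "U' \<union> W'"
    have UN: "{z \<in> ?B. E u z} = {z \<in> ?B. E u' z}" if "u \<in> Uh" "u' \<in> Uh" for u u'
    proof -
      have "z \<in> (W \<union> L) - L2" if "z \<in> ?B" "E x z" "x \<in> Uh" for x z
        using that indU[of x z] sub disj unfolding U'_def W'_def L0_def L1_def L2_def by blast
      then show ?thesis using twinU that by blast
    qed
    have WN: "{z \<in> ?B. E u z} = {z \<in> ?B. E u' z}" if "u \<in> Wh" "u' \<in> Wh" for u u'
    proof -
      have "z \<in> (U \<union> L) - L2" if "z \<in> ?B" "E x z" "x \<in> Wh" for x z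
        using that indW[of x z] sub disj unfolding U'_def W'_def L0_def L1_def L2_def by blast
      then show ?thesis using twinW that by blast
    qed
    have LN: "{z \<in> ?B. E l z} = {}" if "l \<in> L2" for l
    proof -
      have "\<not> E l z" if "z \<in> ?B" for z
        using that \<open>l \<in> L2\<close> indL[of l z] L2L unfolding U'_def W'_def L0_def L1_def Uh_def Wh_def by blast
      then show ?thesis by blast
    qed
    define tr where "tr v = {z \<in> ?B. E v z}" for v
    have "traces E (Uh \<union> Wh \<union> L2) ?B \<subseteq> {tr (SOME u. u \<in> Uh), tr (SOME w. w \<in> Wh)}"
    proof
      fix t assume "t \<in> traces E (Uh \<union> Wh \<union> L2) ?B"
      then obtain v where v: "v \<in> Uh \<union> Wh \<union> L2" "t = tr v" "t \<noteq> {}" by (auto simp: traces_def tr_def)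
      then have "v \<notin> L2" using LN tr_def by blast
      then consider "v \<in> Uh" | "v \<in> Wh" using v by blast
      then show "t \<in> {tr (SOME u. u \<in> Uh), tr (SOME w. w \<in> Wh)}"
      proof cases
        case 1
        then have "(SOME u. u \<in> Uh) \<in> Uh" by (rule someI)
        then show ?thesis using UN[OF 1] v(2) by (simp add: tr_def)
      next
        case 2
        then have "(SOME u. u \<in> Wh) \<in> Wh" by (rule someI)
        then show ?thesis using WN[OF 2] v(2) by (simp add: tr_def)
      qed
    qed
    then show "card (traces E (Uh \<union> Wh \<union> L2) ?B) \<le> 2"
      by (rule card_le_of_subset) (auto simp: card_insert_if)
  qed
  moreover have "(Uh \<union> Wh \<union> L2) \<union> (U' \<union> W') = V"
    using UV WV sub unfolding U'_def W'_def L2_def L1_def L0_def L_def by blast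
  ultimately show ?thesis by simp
qed

end

subsection \<open>Graphs with an induced five-cycle\<close>

text \<open>A component lies within distance two of each of its vertices and so has at most
  \<open>1 + d + d * d\<close> vertices. Triangles are allowed, hence the conclusion
  \<open>x = u\<close> in \<open>path\<close>.\<close>

lemma lw_no_P4:
  assumes "finite V" and sym: "\<And>u v. F u v \<Longrightarrow> F v u"
    and deg: "\<And>v. v \<in> V \<Longrightarrow> card {w \<in> V. F v w} \<le> d"
    and path: "\<And>x y z u. {x, y, z, u} \<subseteq> V \<Longrightarrow> F x y \<Longrightarrow> F y z \<Longrightarrow> F z u \<Longrightarrow> x \<noteq> z \<Longrightarrow> y \<noteq> u \<Longrightarrow> x = u"
  shows "lw F V (d * d + d + 1)"
  using assms
proof (induction "card V" arbitrary: V rule: less_induct)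
  case less
  show ?case
  proof (cases "V = {}")
    case False
    then obtain v where v: "v \<in> V" by blast
    define N where "N x = {w \<in> V. F x w}" for x
    define C where "C = (\<Union>x\<in>N v. N x) \<union> N v \<union> {v}"
    have fin: "finite (N x)" for x using less.prems(1) by (simp add: N_def)
    have NV: "N x \<subseteq> V" for x by (auto simp: N_def)
    have cardN: "card (N x) \<le> d" if "x \<in> V" for x using less.prems(3)[OF that] by (simp add: N_def)
    have CV: "C \<subseteq> V" using v NV by (auto simp: C_def)
    have "card (\<Union>x\<in>N v. N x) \<le> (\<Sum>x\<in>N v. card (N x))" by (rule card_UN_le[OF fin])
    also have "\<dots> \<le> of_nat (card (N v)) * d"
      using cardN NV by (intro sum_bounded_above) blast
    also have "\<dots> \<le> d * d" using cardN[OF v] by simp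
    finally have 1: "card (\<Union>x\<in>N v. N x) \<le> d * d" .
    have "card C \<le> card (\<Union>x\<in>N v. N x) + card (N v) + card {v}" unfolding C_def by (rule card_Un3_le)
    also have "\<dots> \<le> d * d + d + 1" using 1 cardN[OF v] by simp
    finally have cardC: "card C \<le> d * d + d + 1" .
    have finC: "finite C" using CV less.prems(1) by (rule finite_subset)
    have closed: "\<not> F x u" if x: "x \<in> C" and u: "u \<in> V - C" for x u
    proof
      assume xu: "F x u"
      show False
      proof (cases "x = v \<or> x \<in> N v")
        case True
        then show False using xu u by (auto simp: C_def N_def)
      next
        case False
        then obtain y where y: "y \<in> N v" "x \<in> N y" using x by (auto simp: C_def)
        have "v = u"
        proof (rule less.prems(4)[of v y x u])
          show "{v, y, x, u} \<subseteq> V" using v y u NV by blast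
          show "y \<noteq> u" using y u by (auto simp: C_def)
        qed (use y False xu in \<open>auto simp: N_def\<close>)
        then show False using u by (simp add: C_def)
      qed
    qed
    have "lw F (C \<union> (V - C)) (d * d + d + 1)"
    proof (rule lw_disjoint_union)
      show "lw F C (d * d + d + 1)" using finC cardC by (rule lw_card)
      have "v \<in> C" by (simp add: C_def)
      show "lw F (V - C) (d * d + d + 1)"
      proof (rule less.hyps)
        show "card (V - C) < card V"
          using \<open>v \<in> C\<close> v less.prems(1) by (intro psubset_card_mono) auto
        show "card {w \<in> V - C. F x w} \<le> d" if "x \<in> V - C" for x
        proof -
          have "card {w \<in> V - C. F x w} \<le> card (N x)" using fin by (intro card_mono) (auto simp: N_def)
          then show ?thesis using cardN[of x] that by simp
        qed
        show "x = u" if "{x, y, z, u} \<subseteq> V - C" "F x y" "F y z" "F z u" "x \<noteq> z" "y \<noteq> u" for x y z u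
          using less.prems(4)[of x y z u] that by blast
      qed (use less.prems in auto)
    qed (use closed in auto)
    then show ?thesis using CV by (simp add: Un_absorb1)
  qed simp
qed

section \<open>Adjacency patterns of the classes around a five-cycle\<close>

definition consecutive :: "nat \<Rightarrow> nat \<Rightarrow> bool" where
  "consecutive i j \<longleftrightarrow> i < 5 \<and> j < 5 \<and> (j = (i + 1) mod 5 \<or> i = (j + 1) mod 5)"

text \<open>Parts \<open>0\<close> to \<open>4\<close> are the classes around the five-cycle and part \<open>5\<close> consists of the vertices without neighbours on the cycle; \<open>L\<close> tells which classes are large. Active pairs are those between which the flipped graph may have edges.\<close>

definition active :: "(nat \<Rightarrow> bool) \<Rightarrow> nat \<Rightarrow> nat \<Rightarrow> bool" where
  "active L i j \<longleftrightarrow> i < 5 \<and> j < 5 \<and> L i \<and> L j \<and>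
     (j = (i + 1) mod 5 \<and> \<not> L ((i + 2) mod 5) \<and> \<not> L ((i + 4) mod 5) \<or>
      j = (i + 2) mod 5 \<and> \<not> L ((i + 1) mod 5)) \<or>
     i = 5 \<and> j < 5 \<and> L j \<and> \<not> L ((j + 2) mod 5) \<and> \<not> L ((j + 3) mod 5)"

lemma less_5_cases: "(i::nat) < 5 \<Longrightarrow> i = 0 \<or> i = 1 \<or> i = 2 \<or> i = 3 \<or> i = 4"
  by linarith

text \<open>\<open>active\<close> mentions each kind of pair from one end only; here both directions
  are expressed by offsets from \<open>i\<close>.\<close>

lemma active_neighbours:
  assumes "active L i j \<or> active L j i" "i < 5"
  shows "L i \<and> (j = (i + 1) mod 5 \<and> L j \<and> \<not> L ((i + 2) mod 5) \<and> \<not> L ((i + 4) mod 5)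
   \<or> j = (i + 4) mod 5 \<and> L j \<and> \<not> L ((i + 1) mod 5) \<and> \<not> L ((i + 3) mod 5)
   \<or> j = (i + 2) mod 5 \<and> L j \<and> \<not> L ((i + 1) mod 5)
   \<or> j = (i + 3) mod 5 \<and> L j \<and> \<not> L ((i + 4) mod 5)
   \<or> j = 5 \<and> \<not> L ((i + 2) mod 5) \<and> \<not> L ((i + 3) mod 5))"
  using assms(1)
proof
  assume "active L j i"
  then consider "j < 5" "L i" "L j" "i = (j + 1) mod 5" "\<not> L ((j + 2) mod 5)" "\<not> L ((j + 4) mod 5)"
    | "j < 5" "L i" "L j" "i = (j + 2) mod 5" "\<not> L ((j + 1) mod 5)"
    | "j = 5" "L i" "\<not> L ((i + 2) mod 5)" "\<not> L ((i + 3) mod 5)"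
    unfolding active_def by blast
  then show ?thesis
  proof cases
    case 1
    have "j = (i + 4) mod 5" "(j + 2) mod 5 = (i + 1) mod 5" "(j + 4) mod 5 = (i + 3) mod 5"
      using less_5_cases[OF 1(1)] 1(4) by (elim disjE; simp)+
    then show ?thesis using 1 by simp
  next
    case 2
    have "j = (i + 3) mod 5" "(j + 1) mod 5 = (i + 4) mod 5"
      using less_5_cases[OF 2(1)] 2(4) by (elim disjE; simp)+
    then show ?thesis using 2 by simp
  qed simp
qed (use assms(2) in \<open>auto simp: active_def\<close>)



text \<open>A part with two active partners lies in a triangle of active pairs, one of them
  consecutive, and these three parts have no further active partners. So a walk of three steps that
  never turns back returns to its start.\<close>

lemma active_path_middle:
  assumes j: "j < 5"
    and a: "active L i j \<or> active L j i" "active L j k \<or> active L k j" "active L k l \<or> active L l k"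
    and neq: "i \<noteq> k" "j \<noteq> l"
  shows "i = l \<and> (consecutive i j \<or> consecutive j k \<or> consecutive k l)"
proof -
  \<comment> \<open>Counting from \<open>j\<close> turns modular arithmetic into propositional
    reasoning about \<open>A 0\<close> to \<open>A 4\<close> and the part \<open>5\<close>.\<close>
  define A where "A x = (j + x) mod 5" for x
  have A0: "A 0 = j" using j by (simp add: A_def)
  have per: "A 5 = A 0" "A 6 = A 1" "A 7 = A 2" "A 8 = A 3"
    unfolding A_def using less_5_cases[OF j] by (elim disjE; simp)+
  have cons: "consecutive (A x) (A (x + 1))" "consecutive (A (x + 1)) (A x)" for x
    by (simp_all add: consecutive_def A_def mod_simps)
  have c: "consecutive (A 0) (A 1)" "consecutive (A 1) (A 0)" "consecutive (A 1) (A 2)" "consecutive (A 2) (A 1)"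
    "consecutive (A 2) (A 3)" "consecutive (A 3) (A 2)" "consecutive (A 3) (A 4)" "consecutive (A 4) (A 3)"
    "consecutive (A 4) (A 0)" "consecutive (A 0) (A 4)"
    using cons[of 0] cons[of 1] cons[of 2] cons[of 3] cons[of 4] per by (simp_all add: numeral_eq_Suc)
  have nb: "L (A x) \<and> (y = A (x + 1) \<and> L (A (x + 1)) \<and> \<not> L (A (x + 2)) \<and> \<not> L (A (x + 4))
     \<or> y = A (x + 4) \<and> L (A (x + 4)) \<and> \<not> L (A (x + 1)) \<and> \<not> L (A (x + 3))
     \<or> y = A (x + 2) \<and> L (A (x + 2)) \<and> \<not> L (A (x + 1))
     \<or> y = A (x + 3) \<and> L (A (x + 3)) \<and> \<not> L (A (x + 4))
     \<or> y = 5 \<and> \<not> L (A (x + 2)) \<and> \<not> L (A (x + 3)))" if "active L (A x) y \<or> active L y (A x)" for x y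
  proof -
    have eq: "(A x + n) mod 5 = A (x + n)" for n by (simp add: A_def mod_simps add.assoc)
    have "A x < 5" by (simp add: A_def)
    from active_neighbours[OF that this] show ?thesis unfolding eq by blast
  qed
  have n0: "L (A 0) \<and> (y = A 1 \<and> L (A 1) \<and> \<not> L (A 2) \<and> \<not> L (A 4) \<or> y = A 4 \<and> L (A 4) \<and> \<not> L (A 1) \<and> \<not> L (A 3)
     \<or> y = A 2 \<and> L (A 2) \<and> \<not> L (A 1) \<or> y = A 3 \<and> L (A 3) \<and> \<not> L (A 4) \<or> y = 5 \<and> \<not> L (A 2) \<and> \<not> L (A 3))"
    if "active L (A 0) y \<or> active L y (A 0)" for y using nb[OF that] by (simp del: One_nat_def add_2_eq_Suc')
  have n1: "y = A 2 \<and> L (A 2) \<and> \<not> L (A 3) \<and> \<not> L (A 0) \<or> y = A 0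
     \<or> y = A 3 \<and> L (A 3) \<and> \<not> L (A 2) \<or> y = A 4 \<and> L (A 4) \<and> \<not> L (A 0) \<or> y = 5 \<and> \<not> L (A 3) \<and> \<not> L (A 4)"
    if "active L (A 1) y \<or> active L y (A 1)" for y using nb[OF that] by (auto simp: per simp del: One_nat_def add_2_eq_Suc')
  have n2: "y = A 3 \<and> L (A 3) \<and> \<not> L (A 4) \<and> \<not> L (A 1) \<or> y = A 1 \<and> L (A 1) \<and> \<not> L (A 3) \<and> \<not> L (A 0)
     \<or> y = A 4 \<and> L (A 4) \<and> \<not> L (A 3) \<or> y = A 0 \<or> y = 5 \<and> \<not> L (A 4) \<and> \<not> L (A 0)"
    if "active L (A 2) y \<or> active L y (A 2)" for y using nb[OF that] by (auto simp: per simp del: One_nat_def add_2_eq_Suc')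
  have n3: "y = A 4 \<and> L (A 4) \<and> \<not> L (A 0) \<and> \<not> L (A 2) \<or> y = A 2 \<and> L (A 2) \<and> \<not> L (A 4) \<and> \<not> L (A 1)
     \<or> y = A 0 \<or> y = A 1 \<and> L (A 1) \<and> \<not> L (A 2) \<or> y = 5 \<and> \<not> L (A 0) \<and> \<not> L (A 1)"
    if "active L (A 3) y \<or> active L y (A 3)" for y using nb[OF that] by (auto simp: per simp del: One_nat_def add_2_eq_Suc')
  have n4: "y = A 0 \<or> y = A 3 \<and> L (A 3) \<and> \<not> L (A 0) \<and> \<not> L (A 2)
     \<or> y = A 1 \<and> L (A 1) \<and> \<not> L (A 0) \<or> y = A 2 \<and> L (A 2) \<and> \<not> L (A 3) \<or> y = 5 \<and> \<not> L (A 1) \<and> \<not> L (A 2)"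
    if "active L (A 4) y \<or> active L y (A 4)" for y using nb[OF that] by (auto simp: per simp del: One_nat_def add_2_eq_Suc')
  have n5: "y = A 0 \<or> y = A 1 \<and> L (A 1) \<and> \<not> L (A 3) \<and> \<not> L (A 4) \<or> y = A 4 \<and> L (A 4) \<and> \<not> L (A 1) \<and> \<not> L (A 2)
     \<or> y = A 2 \<and> \<not> L (A 0) \<or> y = A 3 \<and> \<not> L (A 0)"
    if "active L 5 y \<or> active L y 5" for y
  proof -
    have y: "y < 5" using that by (auto simp: active_def)
    have yA: "y = A 0 \<or> y = A 1 \<or> y = A 2 \<or> y = A 3 \<or> y = A 4"
      using less_5_cases[OF y] less_5_cases[OF j] unfolding A_def by (elim disjE; hypsubst; simp)
    have "\<not> L (A (x + 2)) \<and> \<not> L (A (x + 3)) \<and> L (A x)" if "y = A x" for x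
      using nb[of x 5] \<open>active L 5 y \<or> active L y 5\<close> that by (auto simp: A_def)
    from this[of 0] this[of 1] this[of 2] this[of 3] this[of 4]
      yA show ?thesis by (auto simp: per simp del: One_nat_def add_2_eq_Suc')
  qed
  have "active L (A 0) i \<or> active L i (A 0)" using a(1) A0 by auto
  note i = n0[OF this]
  have "active L (A 0) k \<or> active L k (A 0)" using a(2) A0 by auto
  note k = n0[OF this]
  \<comment> \<open>Two different partners of \<open>A 0\<close> are compatible only in five ways,
    each listed in both orders.\<close>
  from i k neq(1)
  consider "i = A 1" "k = A 3" "L (A 0)" "L (A 1)" "L (A 3)" "\<not> L (A 2)" "\<not> L (A 4)"
    | "i = A 3" "k = A 1" "L (A 0)" "L (A 1)" "L (A 3)" "\<not> L (A 2)" "\<not> L (A 4)"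
    | "i = A 4" "k = A 2" "L (A 0)" "L (A 4)" "L (A 2)" "\<not> L (A 1)" "\<not> L (A 3)"
    | "i = A 2" "k = A 4" "L (A 0)" "L (A 4)" "L (A 2)" "\<not> L (A 1)" "\<not> L (A 3)"
    | "i = A 2" "k = A 3" "L (A 0)" "L (A 2)" "L (A 3)" "\<not> L (A 1)" "\<not> L (A 4)"
    | "i = A 3" "k = A 2" "L (A 0)" "L (A 2)" "L (A 3)" "\<not> L (A 1)" "\<not> L (A 4)"
    | "i = A 1" "k = 5" "L (A 0)" "L (A 1)" "\<not> L (A 2)" "\<not> L (A 3)" "\<not> L (A 4)"
    | "i = 5" "k = A 1" "L (A 0)" "L (A 1)" "\<not> L (A 2)" "\<not> L (A 3)" "\<not> L (A 4)"
    | "i = A 4" "k = 5" "L (A 0)" "L (A 4)" "\<not> L (A 1)" "\<not> L (A 2)" "\<not> L (A 3)"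
    | "i = 5" "k = A 4" "L (A 0)" "L (A 4)" "\<not> L (A 1)" "\<not> L (A 2)" "\<not> L (A 3)"
    by argo
  then have "i = l \<and> (consecutive i (A 0) \<or> consecutive (A 0) k \<or> consecutive k l)"
  proof cases
    case 1
    then show ?thesis using n3[of l] a(3) neq(2) c A0 by blast
  next
    case 2
    then show ?thesis using n1[of l] a(3) neq(2) c A0 by blast
  next
    case 3
    then show ?thesis using n2[of l] a(3) neq(2) c A0 by blast
  next
    case 4
    then show ?thesis using n4[of l] a(3) neq(2) c A0 by blast
  next
    case 5
    then show ?thesis using n3[of l] a(3) neq(2) c A0 by blast
  next
    case 6
    then show ?thesis using n2[of l] a(3) neq(2) c A0 by blast
  next
    case 7
    then show ?thesis using n5[of l] a(3) neq(2) c A0 by blast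
  next
    case 8
    then show ?thesis using n1[of l] a(3) neq(2) c A0 by blast
  next
    case 9
    then show ?thesis using n5[of l] a(3) neq(2) c A0 by blast
  next
    case 10
    then show ?thesis using n4[of l] a(3) neq(2) c A0 by blast
  qed
  then show ?thesis unfolding A0 .
qed

lemma active_path:
  assumes a: "active L i j \<or> active L j i" "active L j k \<or> active L k j" "active L k l \<or> active L l k"
    and neq: "i \<noteq> k" "j \<noteq> l"
  shows "i = l \<and> (consecutive i j \<or> consecutive j k \<or> consecutive k l)"
proof (cases "j < 5")
  case True
  then show ?thesis using assms by (rule active_path_middle)
next
  case False
  \<comment> \<open>Part \<open>5\<close> is not active with itself. If it is the second part of the
    walk, the walk is read backwards.\<close>
  then have "k < 5" using a(2) by (auto simp: active_def)
  from active_path_middle[OF this, of L l j i] show ?thesis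
    using a neq by (auto simp: consecutive_def)
qed
context K4_diamond_P2P3_free
begin

text \<open>\<open>P\<close> and \<open>Q\<close> each spoil at most one element: adjacency to a
  fixed vertex for a matching, nonadjacency for the complement of a matching. The latter use
  explains the double negations at the call sites.\<close>

lemma pick_two:
  assumes "5 \<le> card S"
    and "\<And>y y'. y \<in> S \<Longrightarrow> y' \<in> S \<Longrightarrow> P y \<Longrightarrow> P y' \<Longrightarrow> y = y'"
    and "\<And>y y'. y \<in> S \<Longrightarrow> y' \<in> S \<Longrightarrow> Q y \<Longrightarrow> Q y' \<Longrightarrow> y = y'"
  obtains y y' where "y \<in> S" "y' \<in> S" "y \<noteq> y'" "\<not> P y" "\<not> P y'" "\<not> Q y" "\<not> Q y'"
proof -
  let ?B = "{y \<in> S. P y} \<union> {y \<in> S. Q y}"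
  have fin: "finite S" using assms(1) by (intro card_ge_0_finite) simp
  have "card {y \<in> S. P y} \<le> 1" "card {y \<in> S. Q y} \<le> 1"
    by (rule card_le_1I; use assms(2,3) in blast)+
  then have "card ?B \<le> 2" using card_Un_le[of "{y \<in> S. P y}" "{y \<in> S. Q y}"] by linarith
  moreover have "card S - card ?B \<le> card (S - ?B)" using fin by (intro diff_card_le_card_Diff) auto
  ultimately have "2 \<le> card (S - ?B)" using assms(1) by linarith
  then show ?thesis using that by (elim two_elements) auto
qed

end

section \<open>Matchings between the classes around an induced five-cycle\<close>

locale with_C5 = K4_diamond_P2P3_free +
  fixes c :: "nat \<Rightarrow> 'a"
  assumes periodic: "c (i + 5) = c i"
    and cycle: "E (c i) (c (i + 1))"
    and chordless: "\<not> E (c i) (c (i + 2))"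
begin

text \<open>These vertices can replace \<open>c i\<close> on the cycle, and \<open>c i\<close> is
  one of them. The index \<open>i + 4\<close> stands for \<open>i - 1\<close>.\<close>

definition W :: "nat \<Rightarrow> 'a set" where
  "W i = {v. E v (c (i + 1)) \<and> E v (c (i + 4)) \<and> \<not> E v (c i) \<and> \<not> E v (c (i + 2)) \<and> \<not> E v (c (i + 3))}"

definition Z :: "'a set" where
  "Z = {v \<in> V. \<forall>i. \<not> E v (c i)}"

definition large :: "nat \<Rightarrow> bool" where
  "large i \<longleftrightarrow> 5 \<le> card (W i)"

text \<open>Here, in \<open>cycle_nonedges\<close> and in \<open>WD\<close> periodicity is absorbed,
  so that later arguments use offsets 0 to 4 from one base index.\<close>

lemma cycle_edges:
  "E (c i) (c (i + 1))" "E (c (i + 1)) (c (i + 2))" "E (c (i + 2)) (c (i + 3))" "E (c (i + 3)) (c (i + 4))" "E (c (i + 4)) (c i)"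
  using cycle[of i] cycle[of "i + 1"] cycle[of "i + 2"] cycle[of "i + 3"] cycle[of "i + 4"] periodic[of i]
  by (simp_all add: numeral_eq_Suc)

lemma cycle_nonedges:
  "\<not> E (c i) (c (i + 2))" "\<not> E (c (i + 1)) (c (i + 3))" "\<not> E (c (i + 2)) (c (i + 4))" "\<not> E (c (i + 3)) (c i)" "\<not> E (c (i + 4)) (c (i + 1))"
  using chordless[of i] chordless[of "i + 1"] chordless[of "i + 2"] chordless[of "i + 3"] chordless[of "i + 4"]
    periodic[of i] periodic[of "i + 1"]
  by (simp_all add: numeral_eq_Suc)

lemma W_periodic: "W (i + 5) = W i"
  using periodic[of i] periodic[of "i + 1"] periodic[of "i + 2"] periodic[of "i + 3"] periodic[of "i + 4"]
  by (simp add: W_def numeral_eq_Suc)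

lemma WD:
  "w \<in> W i \<Longrightarrow> E w (c (i + 1)) \<and> E w (c (i + 4)) \<and> \<not> E w (c i) \<and> \<not> E w (c (i + 2)) \<and> \<not> E w (c (i + 3))"
  "w \<in> W (i + 1) \<Longrightarrow> E w (c (i + 2)) \<and> E w (c i) \<and> \<not> E w (c (i + 1)) \<and> \<not> E w (c (i + 3)) \<and> \<not> E w (c (i + 4))"
  "w \<in> W (i + 2) \<Longrightarrow> E w (c (i + 3)) \<and> E w (c (i + 1)) \<and> \<not> E w (c (i + 2)) \<and> \<not> E w (c (i + 4)) \<and> \<not> E w (c i)"
  "w \<in> W (i + 3) \<Longrightarrow> E w (c (i + 4)) \<and> E w (c (i + 2)) \<and> \<not> E w (c (i + 3)) \<and> \<not> E w (c i) \<and> \<not> E w (c (i + 1))"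
  "w \<in> W (i + 4) \<Longrightarrow> E w (c i) \<and> E w (c (i + 3)) \<and> \<not> E w (c (i + 4)) \<and> \<not> E w (c (i + 1)) \<and> \<not> E w (c (i + 2))"
  using periodic[of i] periodic[of "i + 1"] periodic[of "i + 2"] periodic[of "i + 3"]
  by (simp_all add: W_def numeral_eq_Suc)

lemma Z_nonadjacent: "z \<in> Z \<Longrightarrow> \<not> E z (c i)" "z \<in> Z \<Longrightarrow> \<not> E (c i) z"
  using sym by (auto simp: Z_def)

lemma cycle_distinct: "c i \<noteq> c (i + 2)" "c (i + 1) \<noteq> c (i + 4)"
  using cycle_edges[of i] cycle_nonedges[of i] irrefl sym by metis+

lemma W_independent: "u \<in> W i \<Longrightarrow> v \<in> W i \<Longrightarrow> \<not> E u v"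
  using one_triangle[of u v "c (i + 1)" "c (i + 4)"] WD(1) cycle_distinct(2) by blast

lemma Z_independent: "u \<in> Z \<Longrightarrow> v \<in> Z \<Longrightarrow> \<not> E u v"
  using P2P3[of u v "c 0" "c (0 + 1)" "c (0 + 2)"] Z_nonadjacent cycle_edges[of 0] cycle_nonedges[of 0] cycle_distinct(1) by blast

text \<open>The edge from \<open>c (i + 2)\<close> to \<open>c (i + 3)\<close> has no neighbours in
  \<open>W i\<close> or \<open>Z\<close>, so there is no induced path between these two
  sets.\<close>

lemma Z_W_matching:
  assumes "w \<in> W i" "z \<in> Z" "E z w"
  shows "w' \<in> W i \<Longrightarrow> E z w' \<Longrightarrow> w = w'" and "z' \<in> Z \<Longrightarrow> E z' w \<Longrightarrow> z = z'"
proof -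
  show "w = w'" if "w' \<in> W i" "E z w'"
    using P2P3[of "c (i + 2)" "c (i + 3)" w z w'] assms that WD(1)[OF assms(1)] WD(1)[OF that(1)]
      cycle_edges(3)[of i] Z_nonadjacent(2)[OF assms(2)] W_independent[OF assms(1) that(1)] sym by blast
  show "z = z'" if "z' \<in> Z" "E z' w"
    using P2P3[of "c (i + 2)" "c (i + 3)" z w z'] assms that WD(1)[OF assms(1)]
      cycle_edges(3)[of i] Z_nonadjacent(2)[OF assms(2)] Z_nonadjacent(2)[OF that(1)] Z_independent[OF assms(2) that(1)] sym by blast
qed

text \<open>Two nonneighbours \<open>x\<close>, \<open>x'\<close> of \<open>w\<close> form a path
  through \<open>c (i + 2)\<close>, which misses the edge from \<open>w\<close> to
  \<open>c (i + 4)\<close>; the other direction is symmetric.\<close>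

lemma W_W1_comatching:
  assumes "w \<in> W i" "x \<in> W (i + 1)" "\<not> E w x"
  shows "x' \<in> W (i + 1) \<Longrightarrow> \<not> E w x' \<Longrightarrow> x = x'" and "w' \<in> W i \<Longrightarrow> \<not> E w' x \<Longrightarrow> w = w'"
proof -
  show "x = x'" if "x' \<in> W (i + 1)" "\<not> E w x'"
    using P2P3[of w "c (i + 4)" x "c (i + 2)" x'] assms that WD(1)[OF assms(1)] WD(2)[OF assms(2)] WD(2)[OF that(1)]
      cycle_nonedges(3)[of i] W_independent[OF assms(2) that(1)] sym by blast
  show "w = w'" if "w' \<in> W i" "\<not> E w' x"
    using P2P3[of x "c (i + 2)" w "c (i + 4)" w'] assms that WD(1)[OF assms(1)] WD(2)[OF assms(2)] WD(1)[OF that(1)]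
      cycle_nonedges(3)[of i] W_independent[OF assms(1) that(1)] sym by blast
qed

text \<open>Both classes are adjacent to \<open>c (i + 1)\<close>, so a second neighbour would
  create a second triangle on an edge at \<open>c (i + 1)\<close>.\<close>

lemma W_W2_matching:
  assumes "w \<in> W i" "x \<in> W (i + 2)" "E w x"
  shows "x' \<in> W (i + 2) \<Longrightarrow> E w x' \<Longrightarrow> x = x'" and "w' \<in> W i \<Longrightarrow> E w' x \<Longrightarrow> w = w'"
proof -
  show "x = x'" if "x' \<in> W (i + 2)" "E w x'"
    using one_triangle[of w "c (i + 1)" x x'] assms that WD(1)[OF assms(1)] WD(3)[OF assms(2)] WD(3)[OF that(1)] sym by blast
  show "w = w'" if "w' \<in> W i" "E w' x"
    using one_triangle[of x "c (i + 1)" w w'] assms that WD(1)[OF assms(1)] WD(3)[OF assms(2)] WD(1)[OF that(1)] sym by blast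
qed

text \<open>A large third class next to \<open>x\<close> contains two neighbours of \<open>x\<close>
  that miss \<open>w\<close>. They form with \<open>x\<close> a path, to be combined with the edge
  from \<open>w\<close> to \<open>c (i + 4)\<close>. A large class next to \<open>w\<close> works
  the same way with the roles exchanged.\<close>

lemma W_W1_complete:
  assumes w: "w \<in> W i" and x: "x \<in> W (i + 1)" and "large (i + 2) \<or> large (i + 4)"
  shows "E w x"
proof (rule ccontr)
  assume n: "\<not> E w x"
  show False
    using assms(3)
  proof
    assume "large (i + 2)"
    then have "5 \<le> card (W (i + 2))" by (simp add: large_def)
    then obtain y y' where y: "y \<in> W (i + 2)" "y' \<in> W (i + 2)" "y \<noteq> y'" "\<not> \<not> E x y" "\<not> \<not> E x y'" "\<not> E w y" "\<not> E w y'"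
    proof (rule pick_two)
      show "y = y'" if "y \<in> W (i + 2)" "y' \<in> W (i + 2)" "\<not> E x y" "\<not> E x y'" for y y'
        using W_W1_comatching(1)[of x "i + 1" y y'] x that by (simp add: numeral_eq_Suc)
      show "y = y'" if "y \<in> W (i + 2)" "y' \<in> W (i + 2)" "E w y" "E w y'" for y y'
        using W_W2_matching(1)[OF w that(1,3,2,4)] .
    qed
    then show False
      using P2P3[of w "c (i + 4)" y x y'] n WD(1)[OF w] WD(2)[OF x] WD(3)[OF y(1)] WD(3)[OF y(2)]
        W_independent[OF y(1,2)] sym by blast
  next
    assume "large (i + 4)"
    then have "5 \<le> card (W (i + 4))" by (simp add: large_def)
    then obtain y y' where y: "y \<in> W (i + 4)" "y' \<in> W (i + 4)" "y \<noteq> y'" "\<not> \<not> E y w" "\<not> \<not> E y' w" "\<not> E y x" "\<not> E y' x"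
    proof (rule pick_two)
      have w5: "w \<in> W ((i + 4) + 1)" using w W_periodic[of i] by (simp add: numeral_eq_Suc)
      have x6: "x \<in> W ((i + 4) + 2)" using x W_periodic[of "i + 1"] by (simp add: numeral_eq_Suc)
      show "y = y'" if "y \<in> W (i + 4)" "y' \<in> W (i + 4)" "\<not> E y w" "\<not> E y' w" for y y'
        using W_W1_comatching(2)[OF that(1) w5 that(3,2,4)] .
      show "y = y'" if "y \<in> W (i + 4)" "y' \<in> W (i + 4)" "E y x" "E y' x" for y y'
        using W_W2_matching(2)[OF that(1) x6 that(3,2,4)] .
    qed
    then show False
      using P2P3[of x "c (i + 2)" y w y'] n WD(1)[OF w] WD(2)[OF x] WD(5)[OF y(1)] WD(5)[OF y(2)]
        W_independent[OF y(1,2)] sym by blast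
  qed
qed

text \<open>Two vertices of the large class in between are adjacent to both \<open>w\<close> and
  \<open>x\<close>, so an edge \<open>w x\<close> would lie in two triangles.\<close>

lemma W_W2_anticomplete:
  assumes w: "w \<in> W i" and x: "x \<in> W (i + 2)" and "large (i + 1)"
  shows "\<not> E w x"
proof
  assume wx: "E w x"
  have "5 \<le> card (W (i + 1))" using assms(3) by (simp add: large_def)
  then obtain y y' where y: "y \<in> W (i + 1)" "y' \<in> W (i + 1)" "y \<noteq> y'" "\<not> \<not> E w y" "\<not> \<not> E w y'" "\<not> \<not> E y x" "\<not> \<not> E y' x"
  proof (rule pick_two)
    have x2: "x \<in> W ((i + 1) + 1)" using x by (simp add: numeral_eq_Suc)
    show "y = y'" if "y \<in> W (i + 1)" "y' \<in> W (i + 1)" "\<not> E w y" "\<not> E w y'" for y y'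
      using W_W1_comatching(1)[OF w that(1,3,2,4)] .
    show "y = y'" if "y \<in> W (i + 1)" "y' \<in> W (i + 1)" "\<not> E y x" "\<not> E y' x" for y y'
      using W_W1_comatching(2)[OF that(1) x2 that(3,2,4)] .
  qed
  then show False using one_triangle[of w x y y'] wx sym by blast
qed

lemma Z_W_anticomplete:
  assumes z: "z \<in> Z" and w: "w \<in> W i" and "large (i + 2) \<or> large (i + 3)"
  shows "\<not> E z w"
proof
  assume zw: "E z w"
  show False
    using assms(3)
  proof
    assume "large (i + 2)"
    then have "5 \<le> card (W (i + 2))" by (simp add: large_def)
    then obtain y y' where "y \<in> W (i + 2)" "y' \<in> W (i + 2)" "y \<noteq> y'" "\<not> E z y" "\<not> E z y'" "\<not> E w y" "\<not> E w y'"
    proof (rule pick_two)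
      show "y = y'" if "y \<in> W (i + 2)" "y' \<in> W (i + 2)" "E z y" "E z y'" for y y'
        using Z_W_matching(1)[OF that(1) z that(3,2,4)] .
      show "y = y'" if "y \<in> W (i + 2)" "y' \<in> W (i + 2)" "E w y" "E w y'" for y y'
        using W_W2_matching(1)[OF w that(1,3,2,4)] .
    qed
    \<comment> \<open>One end of the path is \<open>c (i + 2)\<close> itself, so of the two
      candidates one different from it is kept.\<close>
    then obtain x where x: "x \<in> W (i + 2)" "x \<noteq> c (i + 2)" "\<not> E z x" "\<not> E w x" by metis
    show False
      using P2P3[of z w "c (i + 2)" "c (i + 3)" x] zw x(2-4) WD(1)[OF w] WD(3)[OF x(1)] cycle_edges(3)[of i]
        Z_nonadjacent[OF z] sym by blast
  next
    assume "large (i + 3)"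
    then have "5 \<le> card (W (i + 3))" by (simp add: large_def)
    then obtain y y' where "y \<in> W (i + 3)" "y' \<in> W (i + 3)" "y \<noteq> y'" "\<not> E z y" "\<not> E z y'" "\<not> E y w" "\<not> E y' w"
    proof (rule pick_two)
      have w5: "w \<in> W ((i + 3) + 2)" using w W_periodic[of i] by (simp add: numeral_eq_Suc)
      show "y = y'" if "y \<in> W (i + 3)" "y' \<in> W (i + 3)" "E z y" "E z y'" for y y'
        using Z_W_matching(1)[OF that(1) z that(3,2,4)] .
      show "y = y'" if "y \<in> W (i + 3)" "y' \<in> W (i + 3)" "E y w" "E y' w" for y y'
        using W_W2_matching(2)[OF that(1) w5 that(3,2,4)] .
    qed
    then obtain x where x: "x \<in> W (i + 3)" "x \<noteq> c (i + 3)" "\<not> E z x" "\<not> E x w" by metis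
    show False
      using P2P3[of z w "c (i + 3)" "c (i + 2)" x] zw x(2-4) WD(1)[OF w] WD(4)[OF x(1)] cycle_edges(3)[of i]
        Z_nonadjacent[OF z] sym by blast
  qed
qed

text \<open>If \<open>z\<close> sees only \<open>w\<close>, then the edge \<open>z w\<close> misses
  the path through \<open>x\<close> from \<open>c i\<close> to \<open>c (i + 2)\<close>; if it sees
  only \<open>x\<close>, the path through \<open>w\<close> serves.\<close>

lemma Z_twins:
  assumes w: "w \<in> W i" and x: "x \<in> W (i + 1)" and "\<not> E w x" and z: "z \<in> Z"
  shows "E z w \<longleftrightarrow> E z x"
proof
  show "E z x" if "E z w"
    using P2P3[of z w "c i" x "c (i + 2)"] assms(3) that WD(1)[OF w] WD(2)[OF x] Z_nonadjacent[OF z]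
      cycle_nonedges(1)[of i] cycle_distinct(1)[of i] sym by blast
  show "E z w" if "E z x"
    using P2P3[of z x "c (i + 4)" w "c (i + 1)"] assms(3) that WD(1)[OF w] WD(2)[OF x] Z_nonadjacent[OF z]
      cycle_nonedges(5)[of i] cycle_distinct(2)[of i] sym by metis
qed

text \<open>If \<open>y\<close> sees only \<open>w\<close>, the large class of \<open>w\<close>
  contains two neighbours of \<open>x\<close> that \<open>y\<close> does not see; they form with
  \<open>x\<close> a path that misses the edge \<open>w y\<close>. The other case is
  symmetric.\<close>

lemma W3_twins:
  assumes w: "w \<in> W i" and x: "x \<in> W (i + 1)" and "\<not> E w x" and y: "y \<in> W (i + 3)"
    and "large i" "large (i + 1)"
  shows "E y w \<longleftrightarrow> E y x"
proof -
  have W5: "W ((i + 3) + 2) = W i" using W_periodic[of i] by (simp add: numeral_eq_Suc)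
  have y3: "y \<in> W ((i + 1) + 2)" using y by (simp add: numeral_eq_Suc)
  show ?thesis
  proof
    assume yw: "E y w"
    show "E y x"
    proof (rule ccontr)
      assume n: "\<not> E y x"
      have "5 \<le> card (W i)" using assms(5) by (simp add: large_def)
      then obtain v v' where v: "v \<in> W i" "v' \<in> W i" "v \<noteq> v'" "\<not> \<not> E v x" "\<not> \<not> E v' x" "\<not> E y v" "\<not> E y v'"
      proof (rule pick_two)
        show "v = v'" if "v \<in> W i" "v' \<in> W i" "\<not> E v x" "\<not> E v' x" for v v'
          using W_W1_comatching(2)[OF that(1) x that(3,2,4)] .
        show "v = v'" if "v \<in> W i" "v' \<in> W i" "E y v" "E y v'" for v v'
          using W_W2_matching(1)[OF y, unfolded W5, OF that(1,3,2,4)] .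
      qed
      then show False
        using P2P3[of w y v x v'] yw n assms(3) W_independent[OF w] W_independent[OF v(1,2)] sym by blast
    qed
  next
    assume yx: "E y x"
    show "E y w"
    proof (rule ccontr)
      assume n: "\<not> E y w"
      have "5 \<le> card (W (i + 1))" using assms(6) by (simp add: large_def)
      then obtain v v' where v: "v \<in> W (i + 1)" "v' \<in> W (i + 1)" "v \<noteq> v'" "\<not> \<not> E w v" "\<not> \<not> E w v'" "\<not> E v y" "\<not> E v' y"
      proof (rule pick_two)
        show "v = v'" if "v \<in> W (i + 1)" "v' \<in> W (i + 1)" "\<not> E w v" "\<not> E w v'" for v v'
          using W_W1_comatching(1)[OF w that(1,3,2,4)] .
        show "v = v'" if "v \<in> W (i + 1)" "v' \<in> W (i + 1)" "E v y" "E v' y" for v v'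
          using W_W2_matching(2)[OF that(1) y3 that(3,2,4)] .
      qed
      then show False
        using P2P3[of x y v w v'] yx n assms(3) W_independent[OF x] W_independent[OF v(1,2)] sym by blast
    qed
  qed
qed


section \<open>The flipped graph on \<open>Z\<close> and the large classes\<close>

lemma shift_mod: "c (i mod 5 + k) = c (i + k)"
proof -
  have "c (n + 5 * m) = c n" for n m
  proof (induction m)
    case (Suc m)
    then show ?case using periodic[of "n + 5 * m"] by (simp add: algebra_simps)
  qed simp
  from this[of "i mod 5 + k" "i div 5"] have "c (i mod 5 + 5 * (i div 5) + k) = c (i mod 5 + k)"
    by (simp only: add_ac)
  then show ?thesis by simp
qed

lemma W_mod: "W (i mod 5) = W i"
  using shift_mod[of i 0] by (simp add: W_def shift_mod del: One_nat_def add_2_eq_Suc')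

lemma large_mod: "large (i mod 5) = large i"
  by (simp add: large_def W_mod)

text \<open>The classes are indexed by all natural numbers with period five, so the least index is
  the residue below 5.\<close>

definition part :: "'a \<Rightarrow> nat" where
  "part v = (if v \<in> Z then 5 else LEAST i. v \<in> W i)"

definition core :: "'a set" where
  "core = Z \<union> (\<Union>i\<in>{i. i < 5 \<and> large i}. W i)"

definition flipped :: "'a \<Rightarrow> 'a \<Rightarrow> bool" where
  "flipped u v \<longleftrightarrow> E u v \<noteq> consecutive (part u) (part v)"

lemma residue_cases:
  fixes i j :: nat
  assumes "i < 5" "j < 5"
  shows "i = j \<or> j = (i + 1) mod 5 \<or> i = (j + 1) mod 5 \<or> j = (i + 2) mod 5 \<or> i = (j + 2) mod 5"
  using less_5_cases[OF assms(1)] less_5_cases[OF assms(2)] by (elim disjE; simp)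

lemma W_disjoint:
  assumes "v \<in> W i" "v \<in> W j" "i < 5" "j < 5" shows "i = j"
proof -
  have "v \<notin> W (k + 1)" "v \<notin> W (k + 2)" if "v \<in> W k" for k
    using WD(1)[OF that] WD(2)[of v k] WD(3)[of v k] by blast+
  then have n: "v \<notin> W ((k + 1) mod 5)" "v \<notin> W ((k + 2) mod 5)" if "v \<in> W k" for k
    using that unfolding W_mod by blast+
  show ?thesis
    using residue_cases[OF assms(3,4)] n[OF assms(1)] n[OF assms(2)] assms(1,2) by blast
qed

lemma part_Z: "v \<in> Z \<Longrightarrow> part v = 5"
  by (simp add: part_def)

lemma part_W:
  assumes "v \<in> W i" "i < 5" shows "part v = i"
proof -
  have "v \<notin> Z" using WD(1)[OF assms(1)] Z_nonadjacent by blast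
  moreover have "(LEAST i. v \<in> W i) = i"
  proof (rule Least_equality)
    show "i \<le> j" if "v \<in> W j" for j
      using W_disjoint[of v i "j mod 5"] assms that by (simp add: W_mod)
  qed (rule assms)
  ultimately show ?thesis by (simp add: part_def)
qed

lemma part_cases:
  assumes "v \<in> core"
  obtains (Z) "v \<in> Z" "part v = 5" | (W) "v \<in> W (part v)" "part v < 5" "large (part v)"
proof (cases "v \<in> Z")
  case False
  then obtain i where i: "i < 5" "large i" "v \<in> W i" using assms by (auto simp: core_def)
  then have "part v = i" by (intro part_W)
  with i show ?thesis using W by simp
qed (use Z part_Z in blast)

lemma consecutive_sym: "consecutive i j \<longleftrightarrow> consecutive j i"
  by (auto simp: consecutive_def)

lemma flipped_sym: "flipped u v \<Longrightarrow> flipped v u"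
  using sym consecutive_sym by (auto simp: flipped_def)

lemma not_consecutive: "\<not> consecutive 5 j" "\<not> consecutive i 5" "\<not> consecutive i i"
    "\<not> consecutive i ((i + 2) mod 5)" "\<not> consecutive ((i + 2) mod 5) i"
    "\<not> consecutive i ((i + 3) mod 5)" "\<not> consecutive ((i + 3) mod 5) i"
    "\<not> consecutive ((i + 3) mod 5) ((i + 1) mod 5)"
proof -
  have r: "\<not> consecutive i ((i + 2) mod 5)" "\<not> consecutive ((i + 2) mod 5) i" "\<not> consecutive i ((i + 3) mod 5)"
    "\<not> consecutive ((i + 3) mod 5) i" "\<not> consecutive ((i + 3) mod 5) ((i + 1) mod 5)" "\<not> consecutive i i" if "i < 5" for i
    using less_5_cases[OF that] by (elim disjE; simp add: consecutive_def)+
  show "\<not> consecutive 5 j" "\<not> consecutive i 5" by (simp_all add: consecutive_def)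
  show "\<not> consecutive i i" "\<not> consecutive i ((i + 2) mod 5)" "\<not> consecutive ((i + 2) mod 5) i"
    "\<not> consecutive i ((i + 3) mod 5)" "\<not> consecutive ((i + 3) mod 5) i"
    using r[of i] by (cases "i < 5"; simp add: consecutive_def)+
  have "\<not> consecutive ((i mod 5 + 3) mod 5) ((i mod 5 + 1) mod 5)" by (rule r) simp
  then show "\<not> consecutive ((i + 3) mod 5) ((i + 1) mod 5)" by (simp add: mod_simps)
qed

lemma consecutive_Suc: "i < 5 \<Longrightarrow> consecutive i ((i + 1) mod 5)" "i < 5 \<Longrightarrow> consecutive ((i + 1) mod 5) i"
  by (simp_all add: consecutive_def)

lemma flipped_cases:
  assumes u: "u \<in> core" and v: "v \<in> core" and F: "flipped u v"
  obtains (ZW) "u \<in> Z" "part u = 5" "part v < 5" "v \<in> W (part v)" "E u v" "large (part v)"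
    | (WZ) "v \<in> Z" "part v = 5" "part u < 5" "u \<in> W (part u)" "E v u" "large (part u)"
    | (W1) "part u < 5" "part v = (part u + 1) mod 5" "u \<in> W (part u)" "v \<in> W (part u + 1)" "\<not> E u v"
        "large (part u)" "large (part u + 1)"
    | (W1') "part v < 5" "part u = (part v + 1) mod 5" "v \<in> W (part v)" "u \<in> W (part v + 1)" "\<not> E v u"
        "large (part v)" "large (part v + 1)"
    | (W2) "part u < 5" "part v = (part u + 2) mod 5" "u \<in> W (part u)" "v \<in> W (part u + 2)" "E u v"
        "large (part u)" "large (part u + 2)"
    | (W2') "part v < 5" "part u = (part v + 2) mod 5" "v \<in> W (part v)" "u \<in> W (part v + 2)" "E v u"
        "large (part v)" "large (part v + 2)"
proof -
  have WW: thesis if i: "part u < 5" "u \<in> W (part u)" "large (part u)" and j: "part v < 5" "v \<in> W (part v)" "large (part v)"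
    using residue_cases[OF i(1) j(1)]
  proof (elim disjE)
    assume eq: "part u = part v"
    have "\<not> E u v" using i(2) j(2) W_independent unfolding eq by blast
    then show thesis using F by (simp add: flipped_def eq not_consecutive)
  next
    assume eq: "part v = (part u + 1) mod 5"
    have c: "consecutive (part u) (part v)" unfolding eq using i(1) by (rule consecutive_Suc)
    have "\<not> E u v" using F c by (simp add: flipped_def)
    then show thesis using W1 eq i j(2,3) unfolding eq W_mod large_mod by blast
  next
    assume eq: "part u = (part v + 1) mod 5"
    have c: "consecutive (part u) (part v)" unfolding eq using j(1) by (rule consecutive_Suc)
    have "\<not> E v u" using F c sym by (auto simp: flipped_def)
    then show thesis using W1' eq j i(2,3) unfolding eq W_mod large_mod by blast
  next
    assume eq: "part v = (part u + 2) mod 5"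
    have c: "\<not> consecutive (part u) (part v)" unfolding eq by (rule not_consecutive)
    have "E u v" using F c by (simp add: flipped_def)
    then show thesis using W2 eq i j(2,3) unfolding eq W_mod large_mod by blast
  next
    assume eq: "part u = (part v + 2) mod 5"
    have c: "\<not> consecutive (part u) (part v)" unfolding eq by (rule not_consecutive)
    have "E v u" using F c sym by (auto simp: flipped_def)
    then show thesis using W2' eq j i(2,3) unfolding eq W_mod large_mod by blast
  qed
  show thesis
    using u
  proof (cases rule: part_cases)
    case uZ: Z
    then have "E u v" using F by (simp add: flipped_def not_consecutive)
    moreover have "v \<notin> Z" using calculation uZ Z_independent by blast
    ultimately show thesis using part_cases[OF v] ZW uZ by blast
  next
    case uW: W
    show thesis
      using v
    proof (cases rule: part_cases)
      case Z
      then have "E v u" using F sym by (auto simp: flipped_def not_consecutive)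
      then show thesis using WZ uW Z by blast
    qed (use WW uW in blast)
  qed
qed

text \<open>Each condition in \<open>active\<close> that a class is not large is the contrapositive
  of one of the completeness and anticompleteness lemmas.\<close>

lemma flipped_active:
  assumes "u \<in> core" "v \<in> core" "flipped u v"
  shows "active large (part u) (part v) \<or> active large (part v) (part u)"
  using assms
proof (cases rule: flipped_cases)
  case ZW
  then have "\<not> large (part v + 2)" "\<not> large (part v + 3)" using Z_W_anticomplete by blast+
  then show ?thesis using ZW by (simp add: active_def large_mod)
next
  case WZ
  then have "\<not> large (part u + 2)" "\<not> large (part u + 3)" using Z_W_anticomplete by blast+
  then show ?thesis using WZ by (simp add: active_def large_mod)
next
  case W1
  then have "\<not> large (part u + 2)" "\<not> large (part u + 4)" using W_W1_complete by blast+
  then show ?thesis using W1(1,2,6,7) large_mod[of "part u + 1"] large_mod[of "part u + 2"] large_mod[of "part u + 4"]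
    by (simp add: active_def)
next
  case W1'
  then have "\<not> large (part v + 2)" "\<not> large (part v + 4)" using W_W1_complete by blast+
  then show ?thesis using W1'(1,2,6,7) large_mod[of "part v + 1"] large_mod[of "part v + 2"] large_mod[of "part v + 4"]
    by (simp add: active_def)
next
  case W2
  then have "\<not> large (part u + 1)" using W_W2_anticomplete by blast
  then show ?thesis using W2(1,2,6,7) large_mod[of "part u + 1"] large_mod[of "part u + 2"]
    by (simp add: active_def)
next
  case W2'
  then have "\<not> large (part v + 1)" using W_W2_anticomplete by blast
  then show ?thesis using W2'(1,2,6,7) large_mod[of "part v + 1"] large_mod[of "part v + 2"]
    by (simp add: active_def)
qed

text \<open>The flip turns the complements of matchings between consecutive classes into matchings;
  all other pairs of parts were matchings or empty before.\<close>

lemma flipped_degree: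
  assumes u: "u \<in> core" and v: "v \<in> core" and v': "v' \<in> core"
    and F: "flipped u v" "flipped u v'" and eq: "part v = part v'"
  shows "v = v'"
proof -
  have EE: "E u v \<longleftrightarrow> E u v'" using F eq by (simp add: flipped_def)
  have vW: "v' \<in> W (part v)" if "part v < 5"
    using part_cases[OF v'] eq that by (metis less_irrefl)
  show ?thesis
    using u v F(1)
  proof (cases rule: flipped_cases)
    case ZW
    then show ?thesis using Z_W_matching(1)[of v "part v" u v'] vW EE by blast
  next
    case WZ
    then have "v' \<in> Z" using part_cases[OF v'] eq by (metis less_irrefl)
    then show ?thesis using Z_W_matching(2)[of u "part u" v v'] WZ EE sym by blast
  next
    case W1
    then have "part v < 5" by simp
    with vW have "v' \<in> W (part u + 1)" using W1(2) by (simp add: W_mod)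
    then show ?thesis using W_W1_comatching(1)[of u "part u" v v'] W1 EE by blast
  next
    case W1'
    then show ?thesis using W_W1_comatching(2)[of v "part v" u v'] vW EE sym by blast
  next
    case W2
    then have "part v < 5" by simp
    with vW have "v' \<in> W (part u + 2)" using W2(2) by (simp add: W_mod)
    then show ?thesis using W_W2_matching(1)[of u "part u" v v'] W2 EE by blast
  next
    case W2'
    then show ?thesis using W_W2_matching(2)[of v "part v" u v'] vW EE sym by blast
  qed
qed

text \<open>The nonadjacent vertices \<open>x\<close>, \<open>y\<close> of consecutive classes look
  alike from \<open>Z\<close> by \<open>Z_twins\<close> and from the opposite class by
  \<open>W3_twins\<close>; the two remaining classes cannot be large by
  \<open>W_W1_complete\<close>.\<close>

lemma flipped_twins:
  assumes x: "x \<in> core" and y: "y \<in> core" and v: "v \<in> core" and F: "flipped x y"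
    and c: "consecutive (part x) (part y)" and neq: "part v \<noteq> part x" "part v \<noteq> part y"
  shows "flipped v x \<longleftrightarrow> flipped v y"
proof -
  have main: "flipped v x \<longleftrightarrow> flipped v y"
    if x: "x \<in> core" and y: "y \<in> core" and F: "flipped x y" and eq: "part y = (part x + 1) mod 5" and i: "part x < 5"
      and neq: "part v \<noteq> part x" "part v \<noteq> part y" for x y
  proof -
    define i where "i = part x"
    have c: "consecutive (part x) (part y)" unfolding eq using i by (rule consecutive_Suc)
    have n: "\<not> E x y" using F c by (simp add: flipped_def)
    have xW: "x \<in> W i" "large i" using part_cases[OF x] i by (auto simp: i_def)
    have "part y < 5" by (simp add: eq)
    then have "y \<in> W (part y)" "large (part y)" using part_cases[OF y] by auto
    then have yW: "y \<in> W (i + 1)" "large (i + 1)" unfolding eq W_mod large_mod i_def .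
    show ?thesis
      using v
    proof (cases rule: part_cases)
      case Z
      then show ?thesis using Z_twins[OF xW(1) yW(1) n] by (simp add: flipped_def not_consecutive)
    next
      case W
      have "part v = (i + 2) mod 5 \<or> part v = (i + 3) mod 5 \<or> part v = (i + 4) mod 5"
      proof -
        have "part v \<noteq> i" "part v \<noteq> (i + 1) mod 5" "i < 5" using neq i unfolding eq i_def by auto
        then show ?thesis
          using less_5_cases[OF W(2)] less_5_cases[OF \<open>i < 5\<close>] by (elim disjE; simp)
      qed
      then show ?thesis
      proof (elim disjE)
        assume k: "part v = (i + 2) mod 5"
        have "large (i + 2)" using W(3) unfolding k large_mod .
        then show ?thesis using W_W1_complete[OF xW(1) yW(1)] n by blast
      next
        assume k: "part v = (i + 4) mod 5"
        have "large (i + 4)" using W(3) unfolding k large_mod .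
        then show ?thesis using W_W1_complete[OF xW(1) yW(1)] n by blast
      next
        assume k: "part v = (i + 3) mod 5"
        have "v \<in> W (i + 3)" using W(1) unfolding k W_mod .
        then have "E v x \<longleftrightarrow> E v y" using W3_twins[OF xW(1) yW(1) n _ xW(2) yW(2)] by blast
        moreover have "\<not> consecutive (part v) (part x)" "\<not> consecutive (part v) (part y)"
          unfolding k eq i_def[symmetric] by (rule not_consecutive)+
        ultimately show ?thesis by (simp add: flipped_def)
      qed
    qed
  qed
  have "part x < 5" "part y < 5" "part y = (part x + 1) mod 5 \<or> part x = (part y + 1) mod 5"
    using c by (auto simp: consecutive_def)
  then show ?thesis using main[OF x y F] main[OF y x flipped_sym[OF F]] neq by blast
qed

text \<open>A path \<open>x y z u\<close> would return to the part of \<open>x\<close> and use a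
  consecutive pair of parts. Replacing one end of that flipped edge by its twin makes
  \<open>x\<close> and \<open>u\<close> neighbours of a common vertex, and one vertex has at most
  one neighbour per part. With six parts the degree is at most 6.\<close>

lemma core_lw: "lw flipped core 43"
proof -
  have fin: "finite core"
  proof -
    have "W i \<subseteq> V" for i using in_V by (auto simp: W_def)
    then have "core \<subseteq> V" by (auto simp: core_def Z_def)
    then show ?thesis by (rule finite_subset_V)
  qed
  have "lw flipped core (6 * 6 + 6 + 1)"
  proof (rule lw_no_P4[OF fin flipped_sym])
    fix v assume v: "v \<in> core"
    show "card {w \<in> core. flipped v w} \<le> 6"
    proof -
      have "inj_on part {w \<in> core. flipped v w}"
        using flipped_degree[OF v] unfolding inj_on_def by blast
      moreover have "part w < 6" if "w \<in> core" for w
        by (cases rule: part_cases[OF that]) auto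
      then have "part ` {w \<in> core. flipped v w} \<subseteq> {..<6}" by blast
      ultimately have "card {w \<in> core. flipped v w} \<le> card {..<6::nat}"
        using finite_lessThan by (rule card_inj_on_le)
      then show ?thesis by simp
    qed
  next
    fix x y z u assume core: "{x, y, z, u} \<subseteq> core"
      and F: "flipped x y" "flipped y z" "flipped z u" and neq: "x \<noteq> z" "y \<noteq> u"
    have c: "x \<in> core" "y \<in> core" "z \<in> core" "u \<in> core" using core by auto
    have same: "part a \<noteq> part b" if "a \<in> core" "b \<in> core" "flipped a b" for a b
    proof
      assume eq: "part a = part b"
      then have "\<not> consecutive (part a) (part b)" by (simp add: not_consecutive)
      then have "E a b" using that(3) by (simp add: flipped_def)
      then show False
        using part_cases[OF that(1)] part_cases[OF that(2)] eq W_independent Z_independent by (metis less_irrefl)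
    qed
    have "part x \<noteq> part z" using flipped_degree[OF c(2,1,3) flipped_sym[OF F(1)] F(2)] neq by blast
    moreover have "part y \<noteq> part u" using flipped_degree[OF c(3,2,4) flipped_sym[OF F(2)] F(3)] neq by blast
    ultimately have xu: "part x = part u"
      and cons: "consecutive (part x) (part y) \<or> consecutive (part y) (part z) \<or> consecutive (part z) (part u)"
      using active_path[OF flipped_active[OF c(1,2) F(1)] flipped_active[OF c(2,3) F(2)] flipped_active[OF c(3,4) F(3)]]
      by blast+
    have pxz: "part z \<noteq> part x" "part x \<noteq> part z" using \<open>part x \<noteq> part z\<close> by auto
    have pyu: "part y \<noteq> part u" "part u \<noteq> part y" using \<open>part y \<noteq> part u\<close> by auto
    have pyz: "part y \<noteq> part z" "part z \<noteq> part y" "part x \<noteq> part y" "part z \<noteq> part u"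
      using same c F by metis+
    from cons show "x = u"
    proof (elim disjE)
      assume "consecutive (part x) (part y)"
      then have "flipped z x" using flipped_twins[OF c(1,2,3) F(1)] pxz pyz flipped_sym[OF F(2)] by blast
      then show ?thesis using flipped_degree[OF c(3,1,4) _ F(3) xu] by blast
    next
      assume "consecutive (part y) (part z)"
      then have "flipped x z" using flipped_twins[OF c(2,3,1) F(2)] pxz pyz F(1) by blast
      then show ?thesis using flipped_degree[OF c(3,1,4) flipped_sym F(3) xu] by blast
    next
      assume "consecutive (part z) (part u)"
      then have "flipped y u" using flipped_twins[OF c(3,4,2) F(3)] pyz pyu F(2) by blast
      then show ?thesis using flipped_degree[OF c(2,1,4) flipped_sym[OF F(1)] _ xu] by blast
    qed
  qed
  then show ?thesis by simp
qed

lemma with_C5_lw: "lw E V 294"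
proof -
  define A where "A i = {v. E v (c i) \<and> E v (c (i + 1))}" for i
  define T where "T i = {v. E v (c i) \<and> \<not> E v (c (i + 1)) \<and> \<not> E v (c (i + 2)) \<and> \<not> E v (c (i + 3)) \<and> \<not> E v (c (i + 4))}" for i
  define S where "S i = (if large i then {} else W i)" for i
  have part5: "part v < 6" if "v \<in> core" for v
    by (cases rule: part_cases[OF that]) auto
  have subV: "A i \<subseteq> V" "T i \<subseteq> V" "W i \<subseteq> V" for i
    using in_V by (auto simp: A_def T_def W_def)
  have A1: "card (A i) \<le> 1" for i
    by (rule card_le_1I) (use one_triangle[OF cycle[of i]] sym in \<open>auto simp: A_def\<close>)
  \<comment> \<open>Two vertices attached only to \<open>c i\<close> are, if adjacent, an edge that
    misses the path from \<open>c (i + 1)\<close> to \<open>c (i + 3)\<close>; otherwise they form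
    with \<open>c i\<close> a path that misses the edge from \<open>c (i + 2)\<close> to
    \<open>c (i + 3)\<close>.\<close>
  have T1: "card (T i) \<le> 1" for i
  proof (rule card_le_1I, rule ccontr)
    fix t t' assume t: "t \<in> T i" "t' \<in> T i" "t \<noteq> t'"
    note e = cycle_edges[of i] cycle_nonedges[of i] cycle_distinct(1)[of i]
    show False
    proof (cases "E t t'")
      case True
      have "c (i + 1) \<noteq> c (i + 3)" using e irrefl sym by metis
      then show False
        using P2P3[of t t' "c (i + 1)" "c (i + 2)" "c (i + 3)"] True t e(2,3,7) unfolding T_def by blast
    next
      case False
      then show False
        using P2P3[of "c (i + 2)" "c (i + 3)" t "c i" t'] t e(3,6,9) sym unfolding T_def by blast
    qed
  qed
  have S4: "card (S i) \<le> 4" for i by (auto simp: S_def large_def)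
  \<comment> \<open>Each of the five indices contributes one vertex of \<open>A\<close>, one of
    \<open>T\<close> and at most four of a class that is not large, 30 in total.\<close>
  define D where "D = (\<Union>i\<in>{..<5}. A i \<union> T i \<union> S i)"
  have "card D \<le> (\<Sum>i\<in>{..<5}. card (A i \<union> T i \<union> S i))" unfolding D_def by (rule card_UN_le) simp
  also have "\<dots> \<le> (\<Sum>i\<in>{..<5::nat}. 6)"
  proof (rule sum_mono)
    fix i show "card (A i \<union> T i \<union> S i) \<le> 6"
      using card_Un3_le[of "A i" "T i" "S i"] A1[of i] T1[of i] S4[of i] by linarith
  qed
  finally have cardD: "card D \<le> 30" by simp
  have DV: "D \<subseteq> V" unfolding D_def S_def by (intro UN_least Un_least) (simp_all add: subV)
  have cover: "v \<in> core \<union> D" if v: "v \<in> V" for v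
  proof (cases "v \<in> Z")
    case False
    then obtain i where i: "E v (c i)" using v by (auto simp: Z_def)
    \<comment> \<open>Without two consecutive neighbours on the cycle, \<open>v\<close> has besides
      \<open>c i\<close> at most one more neighbour there, at distance two from
      \<open>c i\<close>.\<close>
    have "\<exists>k. v \<in> A k \<union> T k \<union> W k"
    proof -
      have "v \<in> A (i + 4)" if "E v (c (i + 4))" using that i periodic[of i] by (simp add: A_def numeral_eq_Suc)
      moreover have "v \<in> A i" if "E v (c (i + 1))" using that i by (simp add: A_def)
      moreover have "v \<in> A (i + 2)" if "E v (c (i + 2))" "E v (c (i + 3))"
        using that by (simp add: A_def numeral_eq_Suc)
      moreover have "v \<in> W (i + 1)" if "E v (c (i + 2))" "\<not> E v (c (i + 1))" "\<not> E v (c (i + 3))" "\<not> E v (c (i + 4))"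
        using that i periodic[of i] by (simp add: W_def numeral_eq_Suc)
      moreover have "v \<in> W (i + 4)" if "E v (c (i + 3))" "\<not> E v (c (i + 1))" "\<not> E v (c (i + 2))" "\<not> E v (c (i + 4))"
        using that i periodic[of i] periodic[of "i + 1"] periodic[of "i + 2"] periodic[of "i + 3"]
        by (simp add: W_def numeral_eq_Suc)
      moreover have "v \<in> T i" if "\<not> E v (c (i + 1))" "\<not> E v (c (i + 2))" "\<not> E v (c (i + 3))" "\<not> E v (c (i + 4))"
        using that i by (simp add: T_def)
      ultimately show ?thesis by blast
    qed
    then obtain k where "v \<in> A k \<union> T k \<union> W k" by blast
    moreover have "A (k mod 5) = A k" "T (k mod 5) = T k"
      using shift_mod[of k 0] by (simp_all add: A_def T_def shift_mod del: One_nat_def add_2_eq_Suc')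
    ultimately have "v \<in> A (k mod 5) \<union> T (k mod 5) \<union> W (k mod 5)" by (simp only: W_mod)
    moreover have "k mod 5 < 5" by simp
    ultimately show ?thesis unfolding D_def S_def core_def by (cases "large (k mod 5)") auto
  qed (simp add: core_def)
  have coreV: "core \<subseteq> V"
    unfolding core_def Z_def by (intro Un_least UN_least) (simp_all add: subV Collect_subset)
  have "lw E core ((43 + 1) * 6)"
  proof (rule lw_flip[OF core_lw, where p = part and \<phi> = consecutive])
    show "part ` core \<subseteq> {..<6}" using part5 by auto
  qed (auto simp: flipped_def)
  moreover have "core = V - (V - core)" using coreV by blast
  ultimately have "lw E (V - (V - core)) 264" by simp
  then have "lw E V (264 + 30)"
  proof (rule lw_delete)
    have "V - core \<subseteq> D" using cover by blast
    then show "card (V - core) \<le> 30" using cardD finite_subset_V[OF DV] by (meson card_mono le_trans)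
  qed (use finite_V in auto)
  then show ?thesis by simp
qed

end

subsection \<open>The bound\<close>

text \<open>This is Ramsey's theorem for a clique of four, which would put an edge into two
  triangles, against eight independent vertices. Taking \<open>r + 4\<close> guarantees the lower
  bound 4 that \<open>sparse_lw\<close> asks for.\<close>

lemma K4_diamond_P2P3_free_indep:
  "\<exists>r\<ge>4. \<forall>V (E :: 'a \<Rightarrow> 'a \<Rightarrow> bool) S. K4_diamond_P2P3_free V E \<longrightarrow> S \<subseteq> V \<longrightarrow> r \<le> card S \<longrightarrow>
     (\<exists>I\<subseteq>S. card I = 8 \<and> (\<forall>u\<in>I. \<forall>v\<in>I. \<not> E u v))"
proof -
  obtain r where r: "\<forall>(S :: 'a set) (F :: 'a set set). finite S \<and> r \<le> card S \<longrightarrow>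
      (\<exists>R\<subseteq>S. card R = 4 \<and> clique R F \<or> card R = 8 \<and> indep R F)"
    using ramsey2[of 4 8] by blast
  have "\<exists>I\<subseteq>S. card I = 8 \<and> (\<forall>u\<in>I. \<forall>v\<in>I. \<not> E u v)"
    if G: "K4_diamond_P2P3_free V E" and S: "S \<subseteq> V" "r + 4 \<le> card S" for V E and S :: "'a set"
  proof -
    interpret K4_diamond_P2P3_free V E by (rule G)
    define F where "F = {{u, v} | u v. E u v}"
    have F: "{u, v} \<in> F \<longleftrightarrow> E u v" for u v using sym by (auto simp: F_def doubleton_eq_iff)
    have "finite S \<and> r \<le> card S" using finite_subset_V[OF S(1)] S(2) by simp
    with r obtain R where R: "R \<subseteq> S" "card R = 4 \<and> clique R F \<or> card R = 8 \<and> indep R F"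
      by blast
    show ?thesis
      using R(2)
    proof
      assume K: "card R = 4 \<and> clique R F"
      then have E: "E u v" if "u \<in> R" "v \<in> R" "u \<noteq> v" for u v using that F by (auto simp: clique_def)
      have "2 \<le> card R" using K by simp
      then obtain u v where uv: "u \<in> R" "v \<in> R" "u \<noteq> v" by (rule two_elements)
      have "card (R - {u, v}) = 2" using K uv by (simp add: card_Diff_subset)
      then have "2 \<le> card (R - {u, v})" by simp
      then obtain a b where "a \<in> R - {u, v}" "b \<in> R - {u, v}" "a \<noteq> b" by (rule two_elements)
      then show ?thesis using one_triangle[of u v a b] E uv by blast
    next
      assume I: "card R = 8 \<and> indep R F"
      then have "\<not> E u v" if "u \<in> R" "v \<in> R" for u v
        using that F irrefl by (cases "u = v") (auto simp: indep_def)
      then show ?thesis using I R(1) by blast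
    qed
  qed
  then show ?thesis by (intro exI[of _ "r + 4"]) auto
qed

lemma cycle_mod_5:
  fixes c :: "nat \<Rightarrow> 'a"
  assumes "K4_diamond_P2P3_free V E"
    and "E a b" "E b d" "E d e" "E e f" "E f a" "\<not> E a d" "\<not> E b e" "\<not> E d f" "\<not> E e a" "\<not> E f b"
  shows "with_C5 V E (\<lambda>i. [a, b, d, e, f] ! (i mod 5))"
proof -
  interpret K4_diamond_P2P3_free V E by (rule assms(1))
  let ?c = "\<lambda>i. [a, b, d, e, f] ! (i mod 5)"
  have "E (?c i) (?c (i + 1)) \<and> \<not> E (?c i) (?c (i + 2))" for i
  proof -
    have "E ([a, b, d, e, f] ! k) ([a, b, d, e, f] ! ((k + 1) mod 5)) \<and>
        \<not> E ([a, b, d, e, f] ! k) ([a, b, d, e, f] ! ((k + 2) mod 5))" if "k < 5" for k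
      using less_5_cases[OF that] assms(2-) by (elim disjE; hypsubst; simp)
    from this[of "i mod 5"] show ?thesis by (simp only: mod_less_divisor mod_add_left_eq zero_less_numeral simp_thms)
  qed
  then show ?thesis by unfold_locales auto
qed

theorem diamond_P2P3_free_bounded_lw:
  "\<exists>k. \<forall>V (E :: 'a \<Rightarrow> 'a \<Rightarrow> bool). diamond_P2P3_free V E \<longrightarrow> lw E V k"
proof -
  obtain r where "4 \<le> r" and r: "\<And>V (E :: 'a \<Rightarrow> 'a \<Rightarrow> bool) S. K4_diamond_P2P3_free V E \<Longrightarrow> S \<subseteq> V \<Longrightarrow> r \<le> card S \<Longrightarrow>
     \<exists>I\<subseteq>S. card I = 8 \<and> (\<forall>u\<in>I. \<forall>v\<in>I. \<not> E u v)"
    using K4_diamond_P2P3_free_indep by metis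
  \<comment> \<open>One bound for all cases: 6 and 200 for the cliques, 294 with a five-cycle, 37
    with a biclique, and \<open>10 * r + 16\<close> otherwise.\<close>
  have "lw E V (10 * r + 300)" if G: "diamond_P2P3_free V E" for V and E :: "'a \<Rightarrow> 'a \<Rightarrow> bool"
  proof -
    interpret diamond_P2P3_free V E by (rule G)
    have fin: "finite {K. complete_on K}"
      by (rule finite_subset[of _ "Pow V"]) (auto simp: complete_on_def finite_V)
    have "complete_on {}" by (simp add: complete_on_def)
    then have "Max (card ` {K. complete_on K}) \<in> card ` {K. complete_on K}"
      using fin by (intro Max_in) auto
    then obtain K where "complete_on K" and max: "Max (card ` {K. complete_on K}) = card K" by blast
    have "card K' \<le> card K" if "complete_on K'" for K'
      unfolding max[symmetric] using that fin by (intro Max_ge) auto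
    note K = \<open>complete_on K\<close> this
    consider "5 \<le> card K" | "card K = 4" | "card K < 4" by linarith
    then show ?thesis
    proof cases
      case 1
      then show ?thesis using lw_mono[OF large_clique_lw[OF K]] by simp
    next
      case 2
      then show ?thesis using lw_mono[OF clique_4_lw[OF K]] by simp
    next
      case 3
      have free: "K4_diamond_P2P3_free V E"
      proof
        show "a = b" if t: "E u v" "E u a" "E v a" "E u b" "E v b" for u v a b
        proof (rule ccontr)
          assume "a \<noteq> b"
          then have "E a b" using diamond t by blast
          then have "complete_on {u, v, a, b}" using t sym in_V by (auto simp: complete_on_def)
          moreover have "u \<noteq> v" "u \<noteq> a" "u \<noteq> b" "v \<noteq> a" "v \<noteq> b" using t irrefl by blast+
          then have "card {u, v, a, b} = 4" using \<open>a \<noteq> b\<close> by simp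
          ultimately show False using K(2) 3 by fastforce
        qed
      qed
      interpret K4_diamond_P2P3_free V E by (rule free)
      show ?thesis
      proof (cases C5_free)
        case False
        then obtain a b d e f where
          "E a b" "E b d" "E d e" "E e f" "E f a" "\<not> E a d" "\<not> E b e" "\<not> E d f" "\<not> E e a" "\<not> E f b"
          unfolding C5_free_def by blast
        then have "with_C5 V E (\<lambda>i. [a, b, d, e, f] ! (i mod 5))" by (intro cycle_mod_5[OF free])
        then show ?thesis by (rule lw_mono[OF with_C5.with_C5_lw]) simp
      next
        case True
        show ?thesis
        proof (cases "\<exists>X Y. biclique X Y")
          case True
          then show ?thesis using lw_mono[OF biclique_lw[OF \<open>C5_free\<close>]] by fastforce
        next
          case False
          have "lw E V (10 * r + 16)"
          proof (rule sparse_lw[OF r[OF free] \<open>4 \<le> r\<close>])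
            show False if "card X = 4" "4 \<le> card Y" "\<forall>x\<in>X. \<forall>y\<in>Y. E x y" for X Y
              using False that unfolding biclique_def by (metis order_refl)
          qed
          then show ?thesis by (rule lw_mono) simp
        qed
      qed
    qed
  qed
  then show ?thesis by blast
qed

section \<open>From forbidden induced subgraphs to conditions on adjacency\<close>

lemma not_free_of:
  assumes "bij_betw f (verts H) S" "S \<subseteq> verts G"
    "\<And>x y. x \<in> verts H \<Longrightarrow> y \<in> verts H \<Longrightarrow> {x, y} \<in> edges H \<longleftrightarrow> {f x, f y} \<in> edges G"
  shows "\<not> free_of H G"
proof -
  let ?g = "the_inv_into (verts H) f"
  have g: "bij_betw ?g S (verts H)" using assms(1) by (rule bij_betw_the_inv_into)
  have "{x, y} \<in> edges (induced G S) \<longleftrightarrow> {?g x, ?g y} \<in> edges H" if "x \<in> S" "y \<in> S" for x y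
  proof -
    have "f (?g x) = x" "f (?g y) = y" using assms(1) that by (auto simp: f_the_inv_into_f_bij_betw)
    moreover have "?g x \<in> verts H" "?g y \<in> verts H" using g that by (auto simp: bij_betw_def)
    ultimately show ?thesis using assms(3)[of "?g x" "?g y"] that by (simp add: induced_def)
  qed
  then have "graph_iso (induced G S) H"
    unfolding graph_iso_def using g by (intro exI[of _ ?g]) (simp add: induced_def)
  then show ?thesis using assms(2) unfolding free_of_def by blast
qed

lemma bij_betw_image_card:
  assumes "finite A" "card (f ` A) = card A" shows "bij_betw f A (f ` A)"
  using assms by (simp add: bij_betw_def eq_card_imp_inj_on)

lemma path_graph_1: "path_graph 1 = \<lparr>verts = {0}, edges = {}\<rparr>"
  by (auto simp: path_graph_def)

lemma path_graph_2: "path_graph 2 = \<lparr>verts = {0, 1}, edges = {{0, 1}}\<rparr>"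
  by (auto simp: path_graph_def less_2_cases_iff)

lemma path_graph_3: "path_graph 3 = \<lparr>verts = {0, 1, 2}, edges = {{0, 1}, {1, 2}}\<rparr>"
proof -
  have "{i. Suc i < 3} = {0, 1}" "{..<3} = {0, 1, 2 :: nat}" by auto
  then show ?thesis by (simp add: path_graph_def setcompr_eq_image numeral_2_eq_2)
qed

lemma simple_graph_diamond_P2P3_free:
  fixes G :: "'a ugraph"
  assumes G: "simple_graph G"
    and diamond: "free_of (complement_graph (disjoint_union (copies 2 (path_graph 1)) (path_graph 2))) G"
    and P2P3: "free_of (disjoint_union (path_graph 2) (path_graph 3)) G"
  shows "diamond_P2P3_free (verts G) (adj G)"
proof
  show "finite (verts G)" using G by (simp add: simple_graph_def)
  show "adj G u v \<Longrightarrow> adj G v u" for u v by (simp add: adj_def insert_commute)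
  show irrefl: "\<not> adj G v v" for v using G by (force simp: simple_graph_def adj_def)
  show inV: "u \<in> verts G" if "adj G u v" for u v using G that by (auto simp: simple_graph_def adj_def)
  have sym: "adj G u v \<longleftrightarrow> adj G v u" for u v by (simp add: adj_def insert_commute)
  show "adj G a b" if uv: "adj G u v" "adj G u a" "adj G v a" "adj G u b" "adj G v b" and "a \<noteq> b" for u v a b
  proof (rule ccontr)
    assume "\<not> adj G a b"
    then have "\<not> adj G b a" using sym by blast
    have ne: "u \<noteq> v" "u \<noteq> a" "u \<noteq> b" "v \<noteq> a" "v \<noteq> b" using uv irrefl by auto
    \<comment> \<open>In the complement the two copies of \<open>P\<^sub>1\<close> become the
      vertices of degree three, so they are sent to \<open>u\<close> and \<open>v\<close>; the ends
      of \<open>P\<^sub>2\<close> become the nonadjacent pair \<open>a\<close>,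
      \<open>b\<close>.\<close>
    define f :: "nat \<times> nat + nat \<Rightarrow> 'a" where
      "f = case_sum (\<lambda>p. if fst p = 0 then u else v) (\<lambda>i. if i = 0 then a else b)"
    let ?H = "complement_graph (disjoint_union (copies 2 (path_graph 1)) (path_graph 2))"
    have H: "verts ?H = {Inl (0, 0), Inl (1, 0), Inr 0, Inr 1}"
      by (auto simp: complement_graph_def disjoint_union_def copies_def path_graph_def less_2_cases_iff)
    have eH: "{x, y} \<in> edges ?H \<longleftrightarrow> x \<noteq> y \<and> {x, y} \<noteq> {Inr 0, Inr 1}" if "x \<in> verts ?H" "y \<in> verts ?H" for x y
    proof -
      have "edges (disjoint_union (copies 2 (path_graph 1)) (path_graph 2)) = {{Inr 0, Inr 1 :: nat \<times> nat + nat}}"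
        by (auto simp: disjoint_union_def copies_def path_graph_2 path_graph_1[unfolded One_nat_def])
      moreover have "verts (disjoint_union (copies 2 (path_graph 1)) (path_graph 2)) = verts ?H"
        by (simp add: complement_graph_def)
      ultimately show ?thesis
        using that unfolding complement_graph_def[of "disjoint_union _ _"] by (auto simp: doubleton_eq_iff)
    qed
    have "bij_betw f (verts ?H) (f ` verts ?H)"
    proof (rule bij_betw_image_card)
      show "card (f ` verts ?H) = card (verts ?H)"
        unfolding H using ne \<open>a \<noteq> b\<close> by (simp add: f_def)
    qed (unfold H, simp)
    moreover have "f ` verts ?H \<subseteq> verts G"
      using uv inV sym unfolding H by (auto simp: f_def)
    moreover have "{x, y} \<in> edges ?H \<longleftrightarrow> {f x, f y} \<in> edges G" if "x \<in> verts ?H" "y \<in> verts ?H" for x y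
    proof -
      have "x \<noteq> y \<and> {x, y} \<noteq> {Inr 0, Inr 1} \<longleftrightarrow> adj G (f x) (f y)"
        using that uv uv[THEN sym[THEN iffD1]] irrefl \<open>\<not> adj G a b\<close> \<open>\<not> adj G b a\<close> unfolding H
        by (elim insertE emptyE; simp add: f_def doubleton_eq_iff)
      then show ?thesis using eH[OF that] by (simp add: adj_def)
    qed
    ultimately show False using not_free_of[of f ?H "f ` verts ?H" G] diamond by simp
  qed
  show False
    if uv: "adj G u v" "adj G a b" "adj G b c" "a \<noteq> c" "\<not> adj G a c" "\<not> adj G u a" "\<not> adj G u b" "\<not> adj G u c"
      "\<not> adj G v a" "\<not> adj G v b" "\<not> adj G v c" for u v a b c
  proof -
    have ne: "u \<noteq> v" "a \<noteq> b" "b \<noteq> c" "u \<noteq> a" "u \<noteq> b" "u \<noteq> c" "v \<noteq> a" "v \<noteq> b" "v \<noteq> c"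
      using uv irrefl sym by auto
    have uv': "adj G v u" "adj G b a" "adj G c b" "\<not> adj G c a" "\<not> adj G a u" "\<not> adj G b u" "\<not> adj G c u"
      "\<not> adj G a v" "\<not> adj G b v" "\<not> adj G c v"
      using uv sym by blast+
    define f :: "nat + nat \<Rightarrow> 'a" where
      "f = case_sum (\<lambda>i. if i = 0 then u else v) (\<lambda>i. if i = 0 then a else if i = 1 then b else c)"
    let ?H = "disjoint_union (path_graph 2) (path_graph 3)"
    have H: "verts ?H = {Inl 0, Inl 1, Inr 0, Inr 1, Inr 2}"
      by (auto simp: disjoint_union_def path_graph_def less_2_cases_iff numeral_3_eq_3 less_Suc_eq)
    have eH: "edges ?H = {{Inl 0, Inl 1}, {Inr 0, Inr 1}, {Inr 1, Inr 2}}"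
      by (auto simp: disjoint_union_def path_graph_2 path_graph_3)
    have "bij_betw f (verts ?H) (f ` verts ?H)"
    proof (rule bij_betw_image_card)
      show "card (f ` verts ?H) = card (verts ?H)"
        unfolding H using ne \<open>a \<noteq> c\<close> by (simp add: f_def)
    qed (unfold H, simp)
    moreover have "f ` verts ?H \<subseteq> verts G"
      using uv inV sym unfolding H by (auto simp: f_def)
    moreover have "{x, y} \<in> edges ?H \<longleftrightarrow> {f x, f y} \<in> edges G" if "x \<in> verts ?H" "y \<in> verts ?H" for x y
    proof -
      have "{x, y} \<in> {{Inl 0, Inl 1}, {Inr 0, Inr 1}, {Inr 1, Inr 2}} \<longleftrightarrow> adj G (f x) (f y)"
        using that uv uv' irrefl unfolding H
        by (elim insertE emptyE; simp add: f_def doubleton_eq_iff)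
      then show ?thesis unfolding eH by (simp add: adj_def)
    qed
    ultimately show False using not_free_of[of f ?H "f ` verts ?H" G] P2P3 by simp
  qed
qed

theorem theorem1:
  "bounded_clique_width
     {G :: 'a ugraph. simple_graph G \<and>
        free_of (complement_graph (disjoint_union (copies 2 (path_graph 1)) (path_graph 2))) G \<and>
        free_of (disjoint_union (path_graph 2) (path_graph 3)) G}"
proof -
  obtain k where k: "\<And>V (E :: 'a \<Rightarrow> 'a \<Rightarrow> bool). diamond_P2P3_free V E \<Longrightarrow> lw E V k"
    using diamond_P2P3_free_bounded_lw by blast
  show ?thesis
    unfolding bounded_clique_width_def
  proof (intro exI ballI)
    fix G :: "'a ugraph"
    assume "G \<in> {G. simple_graph G \<and>
        free_of (complement_graph (disjoint_union (copies 2 (path_graph 1)) (path_graph 2))) G \<and>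
        free_of (disjoint_union (path_graph 2) (path_graph 3)) G}"
    then show "clique_width G \<le> k + 2"
      using lw_clique_width k simple_graph_diamond_P2P3_free by blast
  qed
qed

end
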